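(* Let $k\in\{0,1\}$, $s\in\mathbb{C}$ and $v\in(0,1]$ satisfy one of the following three conditions: (i) $k=0$, $v\in(0,1)$, $\mathrm{Re}\,s\in(1,\infty)$, $\mathrm{Re}\,s\neq 3,5,7,\ldots$, and $s\notin\mathbb{N}$; (ii) $k=0$, $v=1$, and $\mathrm{Re}\,s\in\bigcup_{d\in\mathbb{Z}_+}(1+2d,2+2d)$; (iii) $k=1$, $v\in(0,1]$, $\mathrm{Re}\,s\in(0,\infty)$, $\mathrm{Re}\,s\neq 2,4,6,\ldots$, and $s\notin\mathbb{N}$. Let $m_0:=\lfloor(\mathrm{Re}\,s-1)/2\rfloor$ and $m_1:=\lfloor(\mathrm{Re}\,s)/2\rfloor$. For $y\in\mathbb{R}$ define $$g_{k,s,v}(y):=-\sin(y+\pi k/2)\Bigg(\sum_{j=1}^{m_k}(-1)^{j-1}\Gamma(s-2j)\,\Phi\big((-1)^k,s-2j,v\big)(2y)^{2j}+\frac{\pi 2^{s}y^{2(m_k+1)}}{\sin(\pi s)}\sum_{n=1-k}^\infty\frac{[\pi(n+k/2)]^{s-2m_k-1}\sin[\pi(2n+k)v+\pi s/2]}{y^2-[\pi(n+k/2)]^2}\Bigg)$$ and $$f_{k,s,v}(y):=-\pi 2^{s-2}\left(\frac{|y|^s\sin[(2v-1)y-\pi k/2]}{\sin(\pi s/2)}+\frac{|y|^s\,\mathrm{sgn}(y)\cos[(2v-1)y-\pi k/2]}{\cos(\pi s/2)}\right).$$ Then the following statements hold. (a) $g_{k,s,v}$ is an entire function of exponential type $1$,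 and it is the only entire function of exponential type $1$ that interpolates $f_{k,s,v}$ at the nodes $\{\pi(n+k/2)\}_{n\in\mathbb{Z}}$ and satisfies the two conditions (C1) $f_{k,s,v}-g_{k,s,v}\in L_\infty(\mathbb{R})$ and (C2) $g_{k,s,v}^{(1-k)}(0)=0$ (i.e. $g_{0,s,v}'(0)=0$ if $k=0$, and $g_{1,s,v}(0)=0$ if $k=1$). (b) For every $n\in\mathbb{Z}$, $$f_{k,s,v}[\pi(n+k/2)]=g_{k,s,v}[\pi(n+k/2)]=-\frac{\pi 2^{s-1}(-1)^{n+k}\,[\pi|n+k/2|]^s}{\sin(\pi s)}\,\sin\big[\pi(2n+k)v+(\pi s/2)\,\mathrm{sgn}(n+k/2)\big].$$ (c) $$\Phi\big((-1)^k,s,v\big)=\frac{1}{\Gamma(s)}\lim_{|y|\to\infty}\frac{f_{k,s,v}(y)-g_{k,s,v}(y)}{\sin(y+\pi k/2)}.$$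
   Context: $\mathbb{N}=\{1,2,\ldots\}$, $\mathbb{Z}_+=\{0,1,2,\ldots\}$. The Lerch transcendent is used for $z=\pm1$: for $v>0$, $$\Phi(z,s,v)=\frac{1}{\Gamma(s)}\int_0^\infty\frac{t^{s-1}e^{(1-v)t}}{e^t-z}\,dt,$$ where $\mathrm{Re}\,s>1$ if $z=1$ and $\mathrm{Re}\,s>0$ if $z=-1$. An entire function $g:\mathbb{C}\to\mathbb{C}$ has exponential type $\sigma$ if for every $\varepsilon>0$ there is a constant $C>0$ with $|g(z)|\le C\exp((\sigma+\varepsilon)|z|)$ for all $z\in\mathbb{C}$. An entire function is identified with its restriction to $\mathbb{R}$. Conventions: complex powers of positive reals are principal ($a^w=e^{w\ln a}$), and $0^s=0$ when $\mathrm{Re}\,s>0$. In the definition of $g_{k,s,v}$ the factor $\sin(y+\pi k/2)$ multiplies each term of the series, and at the points $y=\pm\pi(n+k/2)$ the product $\sin(y+\pi k/2)/(y^2-[\pi(n+k/2)]^2)$ is understood by continuity. The series is understood as the limit of its partial sums (it need not converge absolutely). An empty sum is zero. In the limit in (c), $y$ runs over real numbers at which the denominator does not vanish. *)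

theory Defs
  imports "HOL-Complex_Analysis.Complex_Analysis"
begin

text \<open>
  The integrand is absolutely integrable for \<open>v > 0\<close> when \<open>z = 1\<close>, \<open>Re s > 1\<close> and when
  \<open>z = -1\<close>, \<open>Re s > 0\<close>; only these parameters are meaningful.
\<close>
definition lerch_phi :: "complex \<Rightarrow> complex \<Rightarrow> real \<Rightarrow> complex" where
  "lerch_phi z s v =
     1 / Gamma s *
       (LINT t:{0<..}|lborel.
          of_real t powr (s - 1) * of_real (exp ((1 - v) * t)) / (of_real (exp t) - z))"

definition has_exponential_type :: "(complex \<Rightarrow> complex) \<Rightarrow> real \<Rightarrow> bool" where
  "has_exponential_type g \<sigma> \<longleftrightarrow>
     (\<forall>\<epsilon>>0. \<exists>C>0. \<forall>z. norm (g z) \<le> C * exp ((\<sigma> + \<epsilon>) * norm z))"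

definition in_L_infinity :: "(real \<Rightarrow> complex) \<Rightarrow> bool" where
  "in_L_infinity h \<longleftrightarrow>
     h \<in> borel_measurable lebesgue \<and> (\<exists>C. AE x in lebesgue. norm (h x) \<le> C)"

definition node :: "nat \<Rightarrow> int \<Rightarrow> real" where
  "node k n = pi * (of_int n + of_nat k / 2)"

definition m_index :: "nat \<Rightarrow> complex \<Rightarrow> nat" where
  "m_index k s = (if k = 0 then nat \<lfloor>(Re s - 1) / 2\<rfloor> else nat \<lfloor>Re s / 2\<rfloor>)"

text \<open>The quotient \<open>sin (y + \<pi>k/2) / (y\<^sup>2 - a\<^sup>2)\<close>, extended by continuity to \<open>y = \<plusminus>a\<close>.\<close>
definition sin_quot :: "nat \<Rightarrow> real \<Rightarrow> real \<Rightarrow> real" where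
  "sin_quot k a y =
     (let q = (\<lambda>x. sin (x + pi * of_nat k / 2) / (x\<^sup>2 - a\<^sup>2))
      in if y\<^sup>2 = a\<^sup>2 then Lim (at y) q else q y)"

text \<open>
  The \<open>n\<close>-th term of the series in \<open>g\<^sub>k\<^sub>,\<^sub>s\<^sub>,\<^sub>v\<close>, multiplied by \<open>sin (y + \<pi>k/2)\<close>;
  the summation index starts at \<open>1 - k\<close>.
\<close>
definition g_term :: "nat \<Rightarrow> complex \<Rightarrow> real \<Rightarrow> real \<Rightarrow> nat \<Rightarrow> complex" where
  "g_term k s v y n =
     of_real (node k (int n)) powr (s - 2 * of_nat (m_index k s) - 1)
       * sin (of_real (pi * (2 * of_nat n + of_nat k) * v) + of_real pi * s / 2)
       * of_real (sin_quot k (node k (int n)) y)"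

definition g_fun :: "nat \<Rightarrow> complex \<Rightarrow> real \<Rightarrow> real \<Rightarrow> complex" where
  "g_fun k s v y =
     - (of_real (sin (y + pi * of_nat k / 2))
          * (\<Sum>j = 1..m_index k s.
               (-1) ^ (j - 1) * Gamma (s - 2 * of_nat j)
                 * lerch_phi ((-1) ^ k) (s - 2 * of_nat j) v * of_real ((2 * y) ^ (2 * j)))
        + of_real pi * 2 powr s * of_real (y ^ (2 * (m_index k s + 1))) / sin (of_real pi * s)
          * (\<Sum>i. g_term k s v y (i + (1 - k))))"

definition f_fun :: "nat \<Rightarrow> complex \<Rightarrow> real \<Rightarrow> real \<Rightarrow> complex" where
  "f_fun k s v y =
     - (of_real pi * 2 powr (s - 2)
        * (of_real \<bar>y\<bar> powr s * of_real (sin ((2 * v - 1) * y - pi * of_nat k / 2))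
             / sin (of_real pi * s / 2)
           + of_real \<bar>y\<bar> powr s * of_real (sgn y)
             * of_real (cos ((2 * v - 1) * y - pi * of_nat k / 2))
             / cos (of_real pi * s / 2)))"

definition admissible :: "nat \<Rightarrow> complex \<Rightarrow> real \<Rightarrow> bool" where
  "admissible k s v \<longleftrightarrow>
     (k = 0 \<and> v \<in> {0<..<1} \<and> Re s > 1 \<and> (\<forall>d::nat. Re s \<noteq> 3 + 2 * of_nat d)
        \<and> (\<forall>n::nat. n \<ge> 1 \<longrightarrow> s \<noteq> of_nat n))
   \<or> (k = 0 \<and> v = 1 \<and> (\<exists>d::nat. Re s \<in> {1 + 2 * of_nat d <..< 2 + 2 * of_nat d}))
   \<or> (k = 1 \<and> v \<in> {0<..1} \<and> Re s > 0 \<and> (\<forall>d::nat. Re s \<noteq> 2 + 2 * of_nat d)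
        \<and> (\<forall>n::nat. n \<ge> 1 \<longrightarrow> s \<noteq> of_nat n))"

text \<open>The last condition reads \<open>G' 0 = 0\<close> if \<open>k = 0\<close> and \<open>G 0 = 0\<close> if \<open>k = 1\<close>.\<close>
definition is_interpolant :: "nat \<Rightarrow> complex \<Rightarrow> real \<Rightarrow> (complex \<Rightarrow> complex) \<Rightarrow> bool" where
  "is_interpolant k s v G \<longleftrightarrow>
     G holomorphic_on UNIV \<and> has_exponential_type G 1
   \<and> (\<forall>n::int. G (of_real (node k n)) = f_fun k s v (node k n))
   \<and> in_L_infinity (\<lambda>y. f_fun k s v y - G (of_real y))
   \<and> (deriv ^^ (1 - k)) G 0 = 0"

end

theory Submission
  imports Defs "HOL-Probability.Sinc_Integral" "HOL-Real_Asymp.Real_Asymp"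
begin

text \<open>
  Let \<open>h(t) = exp ((1 - v) t) / (exp t - (-1)\<^sup>k)\<close> be the kernel of the Lerch integral. Everything rests on
  \<open>f(y) - g(y) = sin (y + \<pi>k/2) \<integral> t\<^sup>s\<^sup>-\<^sup>1 h(t) (2y)\<^sup>2 / (t\<^sup>2 + (2y)\<^sup>2) dt\<close>: the last factor lies in \<open>[0, 1]\<close> and
  tends to 1, which bounds \<open>f - g\<close> and gives the limit in (c). For the identity, \<open>h\<close> is expanded in partial
  fractions with poles at \<open>\<plusminus>2\<i>\<alpha>\<^sub>n\<close>, where \<open>\<alpha>\<^sub>n\<close> are the nodes, and integrated term by term using
  the Mellin transforms of \<open>1 / ((t\<^sup>2 + a\<^sup>2) (t\<^sup>2 + b\<^sup>2))\<close>. The resulting powers of \<open>\<alpha>\<^sub>n\<close> form the series in \<open>g\<close>,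
  while the powers of \<open>2y\<close> are resummed to \<open>f\<close> by the same partial fractions at \<open>t = \<plusminus>2\<i>y\<close>. This works for the
  exponent \<open>s - 2m\<^sub>k\<close>; a finite geometric expansion of \<open>(2y)\<^sup>2 / (t\<^sup>2 + (2y)\<^sup>2)\<close> then produces the polynomial part.
  For uniqueness, the Phragmen--Lindelof principle bounds the difference of two interpolants by
  \<open>M exp \<bar>Im z\<bar>\<close>, so its quotient by the sine is constant by Liouville's theorem.
\<close>

section \<open>Partial fractions of the kernel\<close>

text \<open>Termwise integration confines the exponent to a strip. Near 0 the kernel behaves like
  \<open>t\<close> to the power \<open>k - 1\<close>, while the bounds on its partial sums that are
  uniform in the number of terms decay at infinity at best like 1/t, and at \<open>v = 1\<close> not
  at all. Against \<open>1 / (t\<^sup>2 + (2y)\<^sup>2)\<close> the strip used is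
  \<open>1 < Re s < 3\<close> for \<open>k = 0\<close>, \<open>v < 1\<close>; in the remaining cases
  its upper end is 2. Subtracting \<open>2 * m_index k s\<close> moves \<open>s\<close> into this
  strip: the excluded values of \<open>Re s\<close> are its edges, and integers \<open>s\<close> are
  poles of the Mellin transforms involved. The second obstacle is that the partial fraction series
  in general converges only conditionally. Its sum is therefore found by differentiating in
  \<open>v\<close>, which leads to a Dirichlet kernel and the sine integral; domination comes from
  summation by parts for \<open>v < 1\<close> and from a telescoping comparison at
  \<open>v = 1\<close>. The same difficulty recurs in the series of \<open>g\<close>, where absolute
  convergence is regained only after splitting off two powers of the node.\<close>

definition csinc :: "complex \<Rightarrow> complex" where
  "csinc w = (if w = 0 then 1 else sin w / w)"

lemma csinc_mult: "w * csinc w = sin w"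
  by (simp add: csinc_def)

lemma holomorphic_csinc: "csinc holomorphic_on UNIV"
proof -
  have "(\<lambda>z. if z = 0 then deriv sin 0 else (sin z - sin 0) / (z - 0)) holomorphic_on (UNIV::complex set)"
    by (rule pole_lemma_open) (auto intro!: holomorphic_intros)
  moreover have "deriv sin (0::complex) = 1"
    by (rule DERIV_imp_deriv) (auto intro!: derivative_eq_intros)
  moreover have "csinc = (\<lambda>z. if z = 0 then 1 else (sin z - sin 0) / (z - 0))"
    by (auto simp: csinc_def)
  ultimately show ?thesis
    by metis
qed

lemma holomorphic_csinc' [holomorphic_intros]:
  "f holomorphic_on A \<Longrightarrow> (\<lambda>z. csinc (f z)) holomorphic_on A"
  using holomorphic_on_compose_gen[OF _ holomorphic_csinc, of f A] by (simp add: o_def)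

lemma norm_sin_cos_le_exp:
  fixes w :: complex
  shows "norm (sin w) \<le> exp \<bar>Im w\<bar>" "norm (cos w) \<le> exp \<bar>Im w\<bar>"
proof -
  have e: "(norm (exp (\<i> * w)) + norm (exp (- (\<i> * w)))) / 2 \<le> exp \<bar>Im w\<bar>"
  proof -
    have "(exp (- Im w) + exp (Im w)) / 2 \<le> (exp \<bar>Im w\<bar> + exp \<bar>Im w\<bar>) / 2"
      by (intro divide_right_mono add_mono) auto
    then show ?thesis by simp
  qed
  have "norm (sin w) = norm (exp (\<i> * w) - exp (- (\<i> * w))) / 2"
    by (simp add: sin_exp_eq norm_divide norm_mult)
  also have "\<dots> \<le> (norm (exp (\<i> * w)) + norm (exp (- (\<i> * w)))) / 2"
    by (intro divide_right_mono norm_triangle_ineq4) auto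
  finally show "norm (sin w) \<le> exp \<bar>Im w\<bar>" using e by (rule order_trans)
  have "norm (cos w) = norm (exp (\<i> * w) + exp (- (\<i> * w))) / 2"
    by (simp add: cos_exp_eq norm_divide)
  also have "\<dots> \<le> (norm (exp (\<i> * w)) + norm (exp (- (\<i> * w)))) / 2"
    by (intro divide_right_mono norm_triangle_ineq) auto
  finally show "norm (cos w) \<le> exp \<bar>Im w\<bar>" using e by (rule order_trans)
qed

text \<open>The mean value inequality on the segment from 0 to \<open>w\<close>. Unlike
  \<open>norm_sin_cos_le_exp\<close> the bound vanishes at 0, so division by \<open>w\<close> in
  \<open>norm_csinc_le\<close> costs no constant.\<close>

lemma norm_sin_le: "norm (sin w) \<le> norm w * exp \<bar>Im w\<bar>" for w :: complex
proof -
  have "norm (sin w - sin 0) \<le> exp \<bar>Im w\<bar> * norm (w - 0)"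
  proof (rule field_differentiable_bound[where S = "closed_segment 0 w"])
    fix z assume "z \<in> closed_segment 0 w"
    then obtain u where u: "0 \<le> u" "u \<le> 1" "z = u *\<^sub>R w"
      by (auto simp: closed_segment_def)
    have "norm (cos z) \<le> exp \<bar>Im z\<bar>" by (rule norm_sin_cos_le_exp)
    also have "\<bar>Im z\<bar> = u * \<bar>Im w\<bar>" using u by (simp add: abs_mult)
    also have "\<dots> \<le> 1 * \<bar>Im w\<bar>" using u by (intro mult_right_mono) auto
    finally show "norm (cos z) \<le> exp \<bar>Im w\<bar>" by simp
  qed (auto intro!: derivative_eq_intros)
  then show ?thesis by (simp add: mult.commute)
qed

lemma norm_csinc_le: "norm (csinc w) \<le> exp \<bar>Im w\<bar>"
  using norm_sin_le[of w] by (auto simp: csinc_def norm_divide field_simps)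

text \<open>The poles of the kernel off 0 lie at plus and minus \<open>\<i> * freq k i\<close>. The
  frequency is twice the node of index \<open>i + (1 - k)\<close>, see \<open>node_freq\<close>, so
  that \<open>i\<close> starts at 0 for both values of \<open>k\<close>.\<close>

definition freq :: "nat \<Rightarrow> nat \<Rightarrow> real" where
  "freq k i = pi * (2 * real i + 2 - real k)"

lemma freq_pos: "k \<le> 1 \<Longrightarrow> freq k i > 0"
  by (simp add: freq_def)

lemma freq_ge_pi:
  assumes "k \<le> 1"
  shows "pi \<le> freq k i"
proof -
  have "real k \<le> 1" using assms by simp
  then have "pi * 1 \<le> pi * (2 * real i + 2 - real k)" by (intro mult_left_mono) auto
  then show ?thesis by (simp add: freq_def)
qed

text \<open>
  Symmetric partial sums of the series of \<open>exp (\<i>wv) / (t + \<i>w)\<close> over \<open>w \<in> 2\<pi>\<int> + \<pi>k\<close>: the terms for \<open>\<plusminus>w\<close> are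
  combined, and \<open>(1 - k) / t\<close> is the term for \<open>w = 0\<close>.
\<close>
definition psum :: "nat \<Rightarrow> complex \<Rightarrow> complex \<Rightarrow> nat \<Rightarrow> complex" where
  "psum k v t n = (1 - of_nat k) / t +
     (\<Sum>i<n. (2 * t * cos (of_real (freq k i) * v) + 2 * of_real (freq k i) * sin (of_real (freq k i) * v))
            / (t\<^sup>2 + (of_real (freq k i))\<^sup>2))"

text \<open>The Dirichlet kernel: the symmetric partial sum of \<open>exp (\<i> * w * x)\<close>
  over the frequencies of \<open>psum\<close>. The term \<open>w = 0\<close> occurs only for
  \<open>k = 0\<close>, hence \<open>1 - k\<close>.\<close>

definition dkern :: "nat \<Rightarrow> complex \<Rightarrow> nat \<Rightarrow> complex" where
  "dkern k x n = 1 - of_nat k + (\<Sum>i<n. 2 * cos (of_real (freq k i) * x))"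

text \<open>Telescoping: \<open>freq k n\<close> lies midway between (2n + 1 - k) pi and (2n + 3 -
  k) pi, so each new cosine adds exactly the difference of the two sines.\<close>

lemma dkern_sin:
  assumes "k \<le> 1"
  shows "dkern k x n * sin (of_real pi * x) = sin (of_nat (2 * n + 1 - k) * of_real pi * x)"
proof (induction n)
  case 0
  have "k = 0 \<or> k = 1" using assms by auto
  then show ?case by (auto simp: dkern_def)
next
  case (Suc n)
  have e1: "of_nat (2 * n + 1 - k) * of_real pi * x = of_real (freq k n) * x - of_real pi * x"
    using assms by (simp add: freq_def of_nat_diff algebra_simps)
  have e2: "of_nat (2 * Suc n + 1 - k) * of_real pi * x = of_real (freq k n) * x + of_real pi * x"
    using assms by (simp add: freq_def of_nat_diff algebra_simps)
  have "dkern k x (Suc n) * sin (of_real pi * x) =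
        dkern k x n * sin (of_real pi * x) + 2 * cos (of_real (freq k n) * x) * sin (of_real pi * x)"
    by (simp add: dkern_def algebra_simps)
  then show ?case
    unfolding Suc.IH e1 e2 by (simp add: sin_add sin_diff)
qed

lemma dkern_0: "k \<le> 1 \<Longrightarrow> dkern k 0 n = of_nat (2 * n + 1 - k)"
  by (simp add: dkern_def of_nat_diff)

text \<open>Each term of \<open>exp (t * x) * psum k x t n\<close> has the form
  \<open>exp ((t + \<i> * w) * x) / (t + \<i> * w)\<close>, and differentiation in \<open>x\<close>
  removes the denominator.\<close>

lemma exp_psum_deriv:
  assumes nz: "\<And>i. t\<^sup>2 + (of_real (freq k i))\<^sup>2 \<noteq> (0::complex)"
    and t0: "k = 0 \<Longrightarrow> t \<noteq> 0" and "k \<le> 1"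
  shows "((\<lambda>x. exp (t * x) * psum k x t n) has_field_derivative exp (t * x) * dkern k x n) (at x)"
proof -
  let ?w = "\<lambda>i. complex_of_real (freq k i)"
  have c: "t * ((1 - of_nat k) / t) = 1 - of_nat k"
    using t0 assms(3) by (cases "k = 0") auto
  have term_eq: "t * ((2 * t * cos (?w i * x) + 2 * ?w i * sin (?w i * x)) / (t\<^sup>2 + (?w i)\<^sup>2))
      + (2 * t * (- sin (?w i * x) * ?w i) + 2 * ?w i * (cos (?w i * x) * ?w i)) / (t\<^sup>2 + (?w i)\<^sup>2)
      = 2 * cos (?w i * x)" for i
    using nz[of i] by (simp add: add_divide_distrib[symmetric] divide_eq_eq power2_eq_square algebra_simps)
  have "((\<lambda>x. psum k x t n) has_field_derivative
     (\<Sum>i<n. (2 * t * (- sin (?w i * x) * ?w i) + 2 * ?w i * (cos (?w i * x) * ?w i)) / (t\<^sup>2 + (?w i)\<^sup>2))) (at x)"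
    unfolding psum_def by (auto intro!: derivative_eq_intros sum.cong simp: nz)
  then have "((\<lambda>x. exp (t * x) * psum k x t n) has_field_derivative
     exp (t * x) * (t * psum k x t n + (\<Sum>i<n. (2 * t * (- sin (?w i * x) * ?w i)
          + 2 * ?w i * (cos (?w i * x) * ?w i)) / (t\<^sup>2 + (?w i)\<^sup>2)))) (at x)"
    by (auto intro!: derivative_eq_intros simp: algebra_simps)
  also have "t * psum k x t n + (\<Sum>i<n. (2 * t * (- sin (?w i * x) * ?w i)
          + 2 * ?w i * (cos (?w i * x) * ?w i)) / (t\<^sup>2 + (?w i)\<^sup>2)) = dkern k x n"
    unfolding psum_def dkern_def distrib_left c sum_distrib_left add.assoc sum.distrib[symmetric] term_eq
    by simp
  finally show ?thesis .
qed

text \<open>Both functions have a simple pole at 0 with residue 1/pi, and the next zeros of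
  \<open>sin (pi * w)\<close> are at 1 and -1, whence the unit disc. The difference is the
  difference quotient at 0 of \<open>r\<close>, where \<open>r 0 = 1\<close>, divided by pi.\<close>

lemma removable_kernel:
  obtains g where "g holomorphic_on ball (0::complex) 1"
    "\<And>w. w \<in> ball 0 1 \<Longrightarrow> w \<noteq> 0 \<Longrightarrow> g w = exp (t * w) / sin (of_real pi * w) - 1 / (of_real pi * w)"
proof -
  define r where "r = (\<lambda>w. exp (t * w) / csinc (of_real pi * w))"
  have nz: "csinc (of_real pi * w) \<noteq> 0" if "w \<in> ball 0 1" for w
  proof (cases "w = 0")
    case False
    have "sin (of_real pi * w) \<noteq> 0"
    proof
      assume "sin (of_real pi * w) = 0"
      then obtain n :: int where "of_real pi * w = of_real (real_of_int n * pi)"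
        by (auto simp: sin_eq_0)
      then have w: "w = of_int n" by simp
      with that have "\<bar>real_of_int n\<bar> < 1"
        by simp
      with w False show False by simp
    qed
    then show ?thesis using False by (auto simp: csinc_def)
  qed (simp add: csinc_def)
  have "r holomorphic_on ball 0 1"
    unfolding r_def by (intro holomorphic_intros) (use nz in auto)
  then have h: "(\<lambda>z. if z = 0 then deriv r 0 else (r z - r 0) / (z - 0)) holomorphic_on ball 0 1"
    by (rule pole_lemma_open) auto
  show ?thesis
  proof (rule that[of "\<lambda>w. (if w = 0 then deriv r 0 else (r w - r 0) / (w - 0)) / of_real pi"])
    show "(\<lambda>w. (if w = 0 then deriv r 0 else (r w - r 0) / (w - 0)) / of_real pi) holomorphic_on ball 0 1"
      by (intro holomorphic_on_divide h) auto
    fix w :: complex assume "w \<in> ball 0 1" "w \<noteq> 0"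
    then show "(if w = 0 then deriv r 0 else (r w - r 0) / (w - 0)) / of_real pi
      = exp (t * w) / sin (of_real pi * w) - 1 / (of_real pi * w)"
      using nz[of w] by (simp add: r_def csinc_def field_simps)
  qed
qed

text \<open>
  By \<open>exp_psum_deriv\<close> the derivative in \<open>v\<close> is \<open>exp (tv) sin (M\<pi>v) / sin (\<pi>v)\<close> with \<open>M = 2n + 1 - k\<close>.
  Subtracting \<open>Si (M\<pi>v) / \<pi>\<close>, whose derivative is \<open>sin (M\<pi>v) / (\<pi>v)\<close>, leaves \<open>g(v) sin (M\<pi>v)\<close> with \<open>g\<close>
  holomorphic up to \<open>v = 0\<close>; adding \<open>g(v) cos (M\<pi>v) / (M\<pi>)\<close> (integration by parts) makes the
  derivative \<open>O(1/M)\<close>.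
\<close>
lemma exp_psum_diff_tendsto:
  assumes nz: "\<And>i. t\<^sup>2 + (of_real (freq k i))\<^sup>2 \<noteq> (0::complex)"
    and t0: "k = 0 \<Longrightarrow> t \<noteq> 0" and k: "k \<le> 1" and v: "0 < v" "v < 1"
  shows "(\<lambda>n. exp (t * of_real v) * psum k (of_real v) t n - psum k 0 t n) \<longlonglongrightarrow> 1 / 2"
proof -
  obtain g where g: "g holomorphic_on ball (0::complex) 1"
    and geq: "\<And>w. w \<in> ball 0 1 \<Longrightarrow> w \<noteq> 0 \<Longrightarrow> g w = exp (t * w) / sin (of_real pi * w) - 1 / (of_real pi * w)"
    using removable_kernel by blast
  define K where "K = complex_of_real ` {0..v}"
  have Kb: "K \<subseteq> ball 0 1" using v by (auto simp: K_def)
  have cK: "compact K" unfolding K_def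
    by (intro compact_continuous_image continuous_intros) auto
  have dg: "deriv g holomorphic_on ball 0 1" using g by (rule holomorphic_deriv) auto
  have "compact (g ` K)" "compact (deriv g ` K)"
    using cK g dg Kb by (auto intro!: compact_continuous_image holomorphic_on_imp_continuous_on
        intro: holomorphic_on_subset)
  then obtain B B' where "\<forall>w\<in>K. norm (g w) \<le> B" "\<forall>w\<in>K. norm (deriv g w) \<le> B'"
    by (auto dest!: compact_imp_bounded simp: bounded_iff)
  then have B: "\<And>w. w \<in> K \<Longrightarrow> norm (g w) \<le> B" "\<And>w. w \<in> K \<Longrightarrow> norm (deriv g w) \<le> B'"
    by auto
  define M where "M = (\<lambda>n. real (2 * n + 1 - k))"
  have Mtop: "filterlim M at_top sequentially"
    unfolding M_def using k
    by (intro filterlim_compose[OF filterlim_real_sequentially] filterlim_at_top_mono[OF filterlim_ident] always_eventually) auto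
  have bound: "norm (exp (t * of_real v) * psum k (of_real v) t n - psum k 0 t n - of_real (Si (M n * pi * v) / pi))
      \<le> (B' + 2 * B) / (M n * pi)" if n: "n \<ge> 1" for n
  proof -
    have M0: "M n > 0" using n k by (simp add: M_def)
    define \<Phi> where "\<Phi> = (\<lambda>x::real. exp (t * of_real x) * psum k (of_real x) t n - of_real (Si (M n * pi * x) / pi)
        + g (of_real x) * cos (of_real (M n * pi * x)) / of_real (M n * pi))"
    have D: "(\<Phi> has_vector_derivative deriv g (of_real x) * cos (of_real (M n * pi * x)) / of_real (M n * pi))
        (at x within {0..v})"
      if x: "x \<in> {0..v}" for x
    proof -
      have xb: "complex_of_real x \<in> ball 0 1" using x v by auto
      have d1: "((\<lambda>x. exp (t * of_real x) * psum k (of_real x) t n) has_vector_derivative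
          exp (t * of_real x) * dkern k (of_real x) n) (at x within {0..v})"
        by (intro has_vector_derivative_real_field exp_psum_deriv assms)
      have "((\<lambda>x. Si (M n * pi * x) / pi) has_real_derivative
              sinc (M n * pi * x) * (M n * pi) / pi) (at x within {0..v})"
        by (rule DERIV_cdivide, rule DERIV_chain2[OF DERIV_Si]) (auto intro!: derivative_eq_intros)
      then have d2: "((\<lambda>x. complex_of_real (Si (M n * pi * x) / pi)) has_vector_derivative
          of_real (sinc (M n * pi * x) * M n)) (at x within {0..v})"
        by (intro has_vector_derivative_of_real) (simp add: has_real_derivative_iff_has_vector_derivative)
      have "(g has_field_derivative deriv g (of_real x)) (at (of_real x))"
        using g xb by (intro holomorphic_derivI[of g "ball 0 1"]) auto
      then have "((\<lambda>w. g w * cos (of_real (M n * pi) * w) / of_real (M n * pi)) has_field_derivative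
          (deriv g (of_real x) * cos (of_real (M n * pi) * of_real x) +
           g (of_real x) * (- sin (of_real (M n * pi) * of_real x) * of_real (M n * pi))) / of_real (M n * pi))
          (at (of_real x))"
        by (intro DERIV_cdivide) (auto intro!: derivative_eq_intros simp: algebra_simps)
      then have d3: "((\<lambda>x. g (of_real x) * cos (of_real (M n * pi) * of_real x) / of_real (M n * pi)) has_vector_derivative
          (deriv g (of_real x) * cos (of_real (M n * pi) * of_real x) +
           g (of_real x) * (- sin (of_real (M n * pi) * of_real x) * of_real (M n * pi))) / of_real (M n * pi))
          (at x within {0..v})"
        by (rule has_vector_derivative_real_field)
      have key: "exp (t * of_real x) * dkern k (of_real x) n - of_real (sinc (M n * pi * x) * M n)
          = g (of_real x) * sin (of_real (M n * pi * x))"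
      proof (cases "x = 0")
        case True
        then show ?thesis using dkern_0[OF k, of n] by (simp add: M_def)
      next
        case False
        have s: "sin (pi * x) > 0" using x v False by (intro sin_gt_zero) auto
        have sc: "sin (of_real pi * complex_of_real x) \<noteq> 0"
          using s by (simp add: sin_of_real flip: of_real_mult)
        have "dkern k (of_real x) n = sin (of_real (M n * pi * x)) / sin (of_real pi * of_real x)"
          using dkern_sin[OF k, of "of_real x" n] sc by (simp add: M_def field_simps)
        moreover have "complex_of_real (sinc (M n * pi * x) * M n) = sin (of_real (M n * pi * x)) / (of_real pi * of_real x)"
          using False M0 by (simp add: sin_of_real del: of_real_mult) (simp add: field_simps)
        ultimately show ?thesis
          using geq[OF xb] False by (simp only: of_real_eq_0_iff) (simp add: left_diff_distrib)
      qed
      show ?thesis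
        unfolding \<Phi>_def
      proof (rule has_vector_derivative_eq_rhs[OF has_vector_derivative_add[OF has_vector_derivative_diff[OF d1 d2]]])
        show "((\<lambda>x. g (of_real x) * cos (of_real (M n * pi * x)) / of_real (M n * pi)) has_vector_derivative
          (deriv g (of_real x) * cos (of_real (M n * pi) * of_real x) +
           g (of_real x) * (- sin (of_real (M n * pi) * of_real x) * of_real (M n * pi))) / of_real (M n * pi))
          (at x within {0..v})"
          using d3 by simp
        show "exp (t * of_real x) * dkern k (of_real x) n - of_real (sinc (M n * pi * x) * M n) +
          (deriv g (of_real x) * cos (of_real (M n * pi) * of_real x) +
           g (of_real x) * (- sin (of_real (M n * pi) * of_real x) * of_real (M n * pi))) / of_real (M n * pi)
          = deriv g (of_real x) * cos (of_real (M n * pi * x)) / of_real (M n * pi)"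
          unfolding key using M0 by (simp add: add_divide_distrib diff_divide_distrib)
      qed
    qed
    have cosle: "norm (cos (complex_of_real r)) \<le> 1" for r
      by (simp add: cos_of_real)
    have "norm (\<Phi> v - \<Phi> 0) \<le> B' / (M n * pi) * norm (v - 0)"
    proof (rule differentiable_bound[where S = "{0..v}" and f' = "\<lambda>x h. h *\<^sub>R (deriv g (of_real x) * cos (of_real (M n * pi * x)) / of_real (M n * pi))"])
      fix x assume x: "x \<in> {0..v}"
      show "(\<Phi> has_derivative (\<lambda>h. h *\<^sub>R (deriv g (of_real x) * cos (of_real (M n * pi * x)) / of_real (M n * pi)))) (at x within {0..v})"
        using D[OF x] by (simp add: has_vector_derivative_def)
      have "norm (deriv g (of_real x) * cos (of_real (M n * pi * x)) / of_real (M n * pi)) \<le> B' * 1 / (M n * pi)"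
        unfolding norm_mult norm_divide using B(2)[of "of_real x"] x M0 cosle[of "M n * pi * x"]
        by (intro frac_le mult_mono) (auto simp: K_def norm_mult intro: order_trans[OF norm_ge_zero])
      then show "onorm (\<lambda>h. h *\<^sub>R (deriv g (of_real x) * cos (of_real (M n * pi * x)) / of_real (M n * pi))) \<le> B' / (M n * pi)"
        by (intro onorm_le) (metis mult.commute mult.right_neutral mult_right_mono norm_ge_zero norm_scaleR real_norm_def)
    qed (use v in auto)
    also have "\<dots> \<le> B' / (M n * pi) * 1"
    proof (rule mult_left_mono)
      have "B' \<ge> 0" using B(2)[of 0] v by (auto simp: K_def intro: order_trans[OF norm_ge_zero])
      then show "0 \<le> B' / (M n * pi)" using M0 by auto
    qed (use v in auto)
    finally have 1: "norm (\<Phi> v - \<Phi> 0) \<le> B' / (M n * pi)" by simp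
    have 2: "norm (g (of_real x) * cos (of_real (M n * pi * x)) / of_real (M n * pi)) \<le> B / (M n * pi)"
      if "x \<in> {0..v}" for x
    proof -
      have "norm (g (of_real x) * cos (of_real (M n * pi * x)) / of_real (M n * pi)) \<le> B * 1 / (M n * pi)"
        unfolding norm_mult norm_divide using B(1)[of "of_real x"] that M0 cosle[of "M n * pi * x"]
        by (intro frac_le mult_mono) (auto simp: K_def norm_mult intro: order_trans[OF norm_ge_zero])
      then show ?thesis by simp
    qed
    define q where "q = (\<lambda>x. g (of_real x) * cos (of_real (M n * pi * x)) / of_real (M n * pi))"
    have "exp (t * of_real v) * psum k (of_real v) t n - psum k 0 t n - of_real (Si (M n * pi * v) / pi)
       = (\<Phi> v - \<Phi> 0) + (q 0 - q v)"
      by (simp add: \<Phi>_def q_def Si_def flip: zero_ereal_def)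
    also have "norm \<dots> \<le> B' / (M n * pi) + (B / (M n * pi) + B / (M n * pi))"
    proof (intro order_trans[OF norm_triangle_ineq] add_mono)
      have "norm (q 0 - q v) \<le> norm (q 0) + norm (q v)" by (rule norm_triangle_ineq4)
      moreover have "norm (q 0) \<le> B / (M n * pi)" "norm (q v) \<le> B / (M n * pi)"
        unfolding q_def by (rule 2, use v in simp)+
      ultimately show "norm (q 0 - q v) \<le> B / (M n * pi) + B / (M n * pi)"
        by linarith
    qed (rule 1)
    also have "\<dots> = (B' + 2 * B) / (M n * pi)" by (simp add: add_divide_distrib)
    finally show ?thesis .
  qed
  have lim0: "(\<lambda>n. exp (t * of_real v) * psum k (of_real v) t n - psum k 0 t n - of_real (Si (M n * pi * v) / pi)) \<longlonglongrightarrow> 0"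
  proof (rule Lim_null_comparison)
    show "\<forall>\<^sub>F n in sequentially. norm (exp (t * of_real v) * psum k (of_real v) t n - psum k 0 t n - of_real (Si (M n * pi * v) / pi))
      \<le> (B' + 2 * B) / (M n * pi)"
      using eventually_ge_at_top[of 1] by eventually_elim (rule bound)
    show "(\<lambda>n. (B' + 2 * B) / (M n * pi)) \<longlonglongrightarrow> 0"
      by (rule tendsto_divide_0[OF tendsto_const])
         (intro filterlim_at_top_imp_at_infinity filterlim_at_top_mult_tendsto_pos[OF tendsto_const] Mtop, simp)
  qed
  have "(\<lambda>n. Si (M n * pi * v)) \<longlonglongrightarrow> pi / 2"
  proof (rule filterlim_compose[OF Si_at_top])
    show "filterlim (\<lambda>n. M n * pi * v) at_top sequentially"
      using v by (intro filterlim_at_top_mult_tendsto_pos[OF tendsto_const] Mtop) auto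
  qed
  then have "(\<lambda>n. complex_of_real (Si (M n * pi * v) / pi)) \<longlonglongrightarrow> of_real (pi / 2 / pi)"
    by (intro tendsto_of_real tendsto_divide) auto
  from tendsto_add[OF lim0 this] show ?thesis by simp
qed

lemma cos_sin_freq:
  assumes "k \<le> 1"
  shows "cos (freq k i) = (-1) ^ k" "sin (freq k i) = 0"
proof -
  have "k = 0 \<or> k = 1" using assms by auto
  moreover have "freq 0 i = real (2 * Suc i) * pi" "freq 1 i = real (2 * i + 1) * pi"
    by (simp_all add: freq_def algebra_simps)
  ultimately show "cos (freq k i) = (-1) ^ k" "sin (freq k i) = 0"
    by (auto simp only: cos_npi sin_npi) auto
qed

lemma exp_neq_imp_freq:
  assumes "k \<le> 1" "exp t \<noteq> (-1) ^ k"
  shows "t\<^sup>2 + (of_real (freq k i))\<^sup>2 \<noteq> (0::complex)" and "k = 0 \<Longrightarrow> t \<noteq> 0"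
proof -
  have E: "exp (\<i> * of_real (freq k i)) = (-1) ^ k" "exp (- (\<i> * of_real (freq k i))) = (-1) ^ k"
  proof -
    have "k = 0 \<or> k = 1" using assms by auto
    show "exp (\<i> * of_real (freq k i)) = (-1) ^ k"
      using cos_sin_freq[OF assms(1), of i]
      by (simp add: exp_Euler sin_of_real cos_of_real)
    then show "exp (- (\<i> * of_real (freq k i))) = (-1) ^ k"
      using \<open>k = 0 \<or> k = 1\<close> by (auto simp: exp_minus)
  qed
  show "t\<^sup>2 + (of_real (freq k i))\<^sup>2 \<noteq> (0::complex)"
  proof
    assume "t\<^sup>2 + (of_real (freq k i))\<^sup>2 = (0::complex)"
    then have "(t - \<i> * of_real (freq k i)) * (t + \<i> * of_real (freq k i)) = 0"
      by (simp add: algebra_simps power2_eq_square)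
    then have "t = \<i> * of_real (freq k i) \<or> t = - (\<i> * of_real (freq k i))"
      by (auto simp: eq_neg_iff_add_eq_0)
    with E assms show False by auto
  qed
  show "k = 0 \<Longrightarrow> t \<noteq> 0" using assms by auto
qed

lemma freq_reflect:
  assumes "k \<le> 1"
  shows "cos (of_real (freq k i) * (1 - x)) = (-1) ^ k * cos (of_real (freq k i) * x :: complex)"
    and "sin (of_real (freq k i) * (1 - x)) = - ((-1) ^ k) * sin (of_real (freq k i) * x :: complex)"
proof -
  note cos_sin_freq[OF assms, of i]
  then have "cos (complex_of_real (freq k i)) = (-1) ^ k" "sin (complex_of_real (freq k i)) = 0"
    by (simp_all add: cos_of_real sin_of_real)
  then show "cos (of_real (freq k i) * (1 - x)) = (-1) ^ k * cos (of_real (freq k i) * x :: complex)"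
    "sin (of_real (freq k i) * (1 - x)) = - ((-1) ^ k) * sin (of_real (freq k i) * x :: complex)"
    by (simp_all add: right_diff_distrib cos_diff sin_diff)
qed

text \<open>Mirrors the symmetry \<open>hker k (1 - v) t = - ((-1) ^ k) * hker k v (- t)\<close> of
  the kernel; on partial sums it holds because
  \<open>exp (\<i> * freq k i) = (-1) ^ k\<close>.\<close>

lemma psum_reflect:
  assumes k: "k \<le> 1"
  shows "psum k (1 - x) t n = - ((-1) ^ k) * psum k x (- t) n"
proof -
  have "(1 - of_nat k) / t = - ((-1) ^ k) * ((1 - of_nat k) / - t)"
    using k by (cases "k = 0") auto
  then show ?thesis
    unfolding psum_def freq_reflect[OF k] distrib_left sum_distrib_left
    by (intro arg_cong2[where f = "(+)"] sum.cong) (auto simp: algebra_simps add_divide_distrib diff_divide_distrib)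
qed

lemma psum_0_minus: "psum k 0 (- t) n = - psum k 0 t n"
  by (simp add: psum_def sum_negf)

text \<open>
  At \<open>v = 1/2\<close> the symmetry \<open>psum_reflect\<close> turns the limits for \<open>t\<close> and \<open>-t\<close> into an equation for the
  limit itself, and the values at \<open>0\<close> and then at all \<open>v\<close> follow. At \<open>v = 1\<close> the sum of the series jumps, hence
  the extra half.
\<close>
theorem psum_tendsto:
  fixes t :: complex
  assumes k: "k \<le> 1" and t: "exp t \<noteq> (-1) ^ k" and v: "0 < v" "v \<le> 1"
  shows "psum k (of_real v) t \<longlonglongrightarrow> exp ((1 - of_real v) * t) / (exp t - (-1) ^ k)
           + (if v = 1 then (-1) ^ k / 2 else 0)"
proof -
  let ?z = "(-1) ^ k :: complex"
  have z: "?z = 1 \<or> ?z = -1" by (simp add: minus_one_power_iff)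
  have t': "exp (- t) \<noteq> ?z" using t z by (metis exp_minus inverse_1 inverse_inverse_eq inverse_minus_eq)
  have nz: "exp t - ?z \<noteq> 0" using t by simp
  have half: "(of_real (1/2) :: complex) = 1/2" by simp
  note L = exp_psum_diff_tendsto[OF exp_neq_imp_freq[OF k t] k]
  note L' = exp_psum_diff_tendsto[OF exp_neq_imp_freq[OF k t'] k]
  have sq: "exp (t/2) * exp (t/2) = exp t" by (simp flip: exp_add)
  have m: "psum k (1/2) (- t) n = - ?z * psum k (1/2) t n" for n
    using psum_reflect[OF k, of "1/2" "-t" n] by simp
  \<comment> \<open>\<open>psum k 0\<close> is odd in \<open>t\<close> and cancels from the sum of
    the two limits, so that only \<open>psum k (1/2) t\<close> remains.\<close>
  have "(\<lambda>n. (exp (t * of_real (1/2)) * psum k (of_real (1/2)) t n - psum k 0 t n) +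
     (exp (- t * of_real (1/2)) * psum k (of_real (1/2)) (- t) n - psum k 0 (- t) n)) \<longlonglongrightarrow> 1/2 + 1/2"
    by (intro tendsto_add L L') auto
  moreover have "(exp (t * of_real (1/2)) * psum k (of_real (1/2)) t n - psum k 0 t n) +
     (exp (- t * of_real (1/2)) * psum k (of_real (1/2)) (- t) n - psum k 0 (- t) n)
     = (exp (t/2) - ?z * exp (- (t/2))) * psum k (1/2) t n" for n
    unfolding half psum_0_minus m by (simp add: algebra_simps)
  ultimately have "(\<lambda>n. (exp (t/2) - ?z * exp (- (t/2))) * psum k (1/2) t n) \<longlonglongrightarrow> 1"
    by simp
  then have "(\<lambda>n. exp (t/2) / (exp t - ?z) * ((exp (t/2) - ?z * exp (- (t/2))) * psum k (1/2) t n)) \<longlonglongrightarrow> exp (t/2) / (exp t - ?z) * 1"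
    by (intro tendsto_mult tendsto_const)
  moreover have "exp (t/2) / (exp t - ?z) * ((exp (t/2) - ?z * exp (- (t/2))) * psum k (1/2) t n) = psum k (1/2) t n" for n
  proof -
    have "exp (t/2) * (exp (t/2) - ?z * exp (- (t/2))) = exp t - ?z"
      by (simp add: right_diff_distrib sq exp_minus)
    then have "exp (t/2) / (exp t - ?z) * (exp (t/2) - ?z * exp (- (t/2))) = 1"
      using nz by simp
    then show ?thesis by (metis mult.assoc mult_1)
  qed
  ultimately have "psum k (1/2) t \<longlonglongrightarrow> exp (t/2) / (exp t - ?z)"
    by (simp add: ext)
  then have "(\<lambda>n. exp (t * of_real (1/2)) * psum k (of_real (1/2)) t n - (exp (t * of_real (1/2)) * psum k (of_real (1/2)) t n - psum k 0 t n))
      \<longlonglongrightarrow> exp (t * of_real (1/2)) * (exp (t/2) / (exp t - ?z)) - 1/2"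
    by (intro tendsto_diff tendsto_mult tendsto_const L) auto
  then have S0: "psum k 0 t \<longlonglongrightarrow> exp t / (exp t - ?z) - 1/2"
    by (simp add: sq)
  show ?thesis
  proof (cases "v = 1")
    case True
    have "psum k 1 t = (\<lambda>n. ?z * psum k 0 t n)"
      using psum_reflect[OF k, of 0 t] by (simp add: psum_0_minus fun_eq_iff)
    moreover have "(\<lambda>n. ?z * psum k 0 t n) \<longlonglongrightarrow> ?z * (exp t / (exp t - ?z) - 1/2)"
      by (intro tendsto_mult tendsto_const S0)
    moreover have "?z * (exp t / (exp t - ?z) - 1/2) = 1 / (exp t - ?z) + ?z / 2"
      using z nz by (auto simp: field_simps)
    ultimately show ?thesis using True by simp
  next
    case False
    have "(\<lambda>n. exp (- t * of_real v) * ((exp (t * of_real v) * psum k (of_real v) t n - psum k 0 t n) + psum k 0 t n))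
       \<longlonglongrightarrow> exp (- t * of_real v) * (1/2 + (exp t / (exp t - ?z) - 1/2))"
      by (intro tendsto_mult tendsto_const tendsto_add S0 L) (use v False in auto)
    moreover have "exp (- t * of_real v) * (1/2 + (exp t / (exp t - ?z) - 1/2)) = exp ((1 - of_real v) * t) / (exp t - ?z)"
    proof -
      have "exp (- t * of_real v) * (1/2 + (exp t / (exp t - ?z) - 1/2)) = exp (- t * of_real v + t) / (exp t - ?z)"
        unfolding exp_add by simp
      also have "- t * of_real v + t = (1 - of_real v) * t"
        by (simp add: algebra_simps)
      finally show ?thesis .
    qed
    moreover have "exp (- t * of_real v) * ((exp (t * of_real v) * p - q) + q) = p" for p q
      by (simp add: mult.assoc[symmetric] flip: exp_add)
    ultimately show ?thesis using False by (simp only: if_False add_0_right)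
  qed
qed

section \<open>Uniform bounds for the partial sums\<close>

lemma abel_summation_bound:
  fixes w u :: "nat \<Rightarrow> complex" and r :: "nat \<Rightarrow> real"
  assumes W: "\<And>n. norm (\<Sum>i<n. w i) \<le> B"
    and u: "\<And>i. norm (u i) \<le> r i" "\<And>i. norm (u i - u (Suc i)) \<le> r i - r (Suc i)"
  shows "norm (\<Sum>i<n. w i * u i) \<le> B * r 0"
proof -
  \<comment> \<open>Summation by parts. The boundary term is at most \<open>B * r n\<close>, and
    since the decrements of \<open>r\<close> majorise those of \<open>u\<close>, the remaining sum
    telescopes to \<open>B * (r 0 - r n)\<close>.\<close>
  have "(\<Sum>i<n. w i * u i) = (\<Sum>i<n. w i) * u n + (\<Sum>i<n. (\<Sum>j<Suc i. w j) * (u i - u (Suc i)))"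
    by (induction n) (auto simp: algebra_simps)
  also have "norm \<dots> \<le> B * r n + (\<Sum>i<n. B * (r i - r (Suc i)))"
    by (intro order_trans[OF norm_triangle_ineq] add_mono order_trans[OF norm_sum] sum_mono)
       (auto simp: norm_mult simp del: sum.lessThan_Suc intro!: mult_mono W u order_trans[OF norm_ge_zero W])
  also have "\<dots> = B * r 0"
    by (induction n) (auto simp: algebra_simps)
  finally show ?thesis .
qed

lemma norm_inverse_linear_le:
  fixes t w :: real
  assumes "t > 0" "w \<ge> 0"
  shows "norm (1 / (of_real t + \<i> * of_real w)) \<le> 2 / (t + w)"
proof -
  have "t + w \<le> 2 * norm (Complex t w)"
    using abs_Re_le_cmod[of "Complex t w"] abs_Im_le_cmod[of "Complex t w"] assms by auto
  moreover have "Complex t w = of_real t + \<i> * of_real w"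
    by (simp add: complex_eq_iff)
  moreover have "norm (Complex t w) > 0"
    using assms by (auto simp: complex_eq_iff)
  ultimately show ?thesis
    using assms by (simp add: norm_divide field_simps)
qed

text \<open>
  The right-hand side telescopes, which bounds the total variation of \<open>1 / (t + \<i>w)\<close> in \<open>w\<close>.
\<close>
lemma norm_inverse_linear_diff_le:
  fixes t a b :: real
  assumes "t > 0" "0 \<le> a" "a \<le> b"
  shows "norm (1 / (of_real t + \<i> * of_real a) - 1 / (of_real t + \<i> * of_real b)) \<le> 4 / (t + a) - 4 / (t + b)"
proof -
  have nz: "of_real t + \<i> * of_real w \<noteq> 0" for w using assms by (simp add: complex_eq_iff)
  have "1 / (of_real t + \<i> * of_real a) - 1 / (of_real t + \<i> * of_real b)
     = (\<i> * of_real (b - a)) * (1 / (of_real t + \<i> * of_real a)) * (1 / (of_real t + \<i> * of_real b))"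
    using nz[of a] nz[of b] by (simp add: field_simps)
  also have "norm \<dots> = (b - a) * norm (1 / (of_real t + \<i> * of_real a)) * norm (1 / (of_real t + \<i> * of_real b))"
    using assms by (simp only: norm_mult norm_of_real) simp
  also have "\<dots> \<le> (b - a) * (2 / (t + a)) * (2 / (t + b))"
    by (intro mult_mono norm_inverse_linear_le) (use assms in auto)
  also have "\<dots> = 4 / (t + a) - 4 / (t + b)"
    using assms by (simp add: field_simps)
  finally show ?thesis .
qed

text \<open>A geometric sum whose ratio has argument \<open>2 * pi * v\<close> and so differs from
  1. The bound degenerates as \<open>v\<close> tends to 1, where \<open>psum_bound_endpoint\<close>
  takes over.\<close>

lemma exp_freq_sum_bound:
  assumes k: "k \<le> 1" and v: "0 < v" "v < 1"
  shows "norm (\<Sum>i<n. exp (\<i> * of_real (freq k i * v))) \<le> 1 / sin (pi * v)"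
proof -
  define q where "q = exp (\<i> * of_real (2 * pi * v))"
  have s: "sin (pi * v) > 0" using v by (intro sin_gt_zero) auto
  have q1: "norm (q - 1) = 2 * sin (pi * v)"
    using s by (simp add: q_def dist_exp_i_1[of "2 * pi * v"] flip: of_real_mult)
  have nq: "norm q = 1" by (simp add: q_def)
  have E: "exp (\<i> * of_real (freq k i * v)) = exp (\<i> * of_real (freq k 0 * v)) * q ^ i" for i
  proof -
    have "\<i> * of_real (freq k i * v) = \<i> * of_real (freq k 0 * v) + of_nat i * (\<i> * of_real (2 * pi * v))"
      by (simp add: freq_def algebra_simps)
    then show ?thesis by (simp only: exp_add exp_of_nat_mult q_def)
  qed
  have "(\<Sum>i<n. exp (\<i> * of_real (freq k i * v))) = exp (\<i> * of_real (freq k 0 * v)) * (\<Sum>i<n. q ^ i)"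
    unfolding sum_distrib_left by (rule sum.cong[OF refl E])
  also have "norm \<dots> = norm (\<Sum>i<n. q ^ i)"
    by (simp only: norm_mult norm_exp_i_times)
  also have "\<dots> = norm (q ^ n - 1) / norm (q - 1)"
    using q1 s by (subst geometric_sum) (auto simp: norm_divide)
  also have "\<dots> \<le> 2 / norm (q - 1)"
    using norm_triangle_ineq4[of "q ^ n" 1] nq by (intro divide_right_mono) (auto simp: norm_power)
  finally show ?thesis using q1 by simp
qed

text \<open>For real \<open>t\<close> the terms of frequency \<open>w\<close> and \<open>-w\<close>
  are complex conjugates. Writing their sum as twice a real part separates the oscillating factor
  from the monotone one, as summation by parts requires.\<close>

lemma psum_term_eq:
  fixes t v w :: real
  assumes "t > 0"
  shows "(2 * of_real t * cos (of_real w * of_real v) + 2 * of_real w * sin (of_real w * of_real v))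
            / ((of_real t)\<^sup>2 + (of_real w)\<^sup>2)
    = complex_of_real (2 * Re (exp (\<i> * of_real (w * v)) * (1 / (of_real t + \<i> * of_real w))))"
proof -
  have "exp (\<i> * of_real (w * v)) = Complex (cos (w * v)) (sin (w * v))"
    unfolding cis_conv_exp[symmetric] by (simp add: complex_eq_iff)
  moreover have "1 / (of_real t + \<i> * of_real w) = Complex (t / (t\<^sup>2 + w\<^sup>2)) (- w / (t\<^sup>2 + w\<^sup>2))"
    by (simp add: complex_eq_iff Re_divide Im_divide)
  ultimately have "2 * Re (exp (\<i> * of_real (w * v)) * (1 / (of_real t + \<i> * of_real w)))
     = (2 * t * cos (w * v) + 2 * w * sin (w * v)) / (t\<^sup>2 + w\<^sup>2)"
    by (simp only: complex.sel times_complex.sel) (simp add: add_divide_distrib algebra_simps)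
  moreover have "(2 * of_real t * cos (of_real w * of_real v) + 2 * of_real w * sin (of_real w * of_real v))
            / ((of_real t)\<^sup>2 + (of_real w)\<^sup>2) =
      complex_of_real ((2 * t * cos (w * v) + 2 * w * sin (w * v)) / (t\<^sup>2 + w\<^sup>2))"
    by (simp flip: sin_of_real cos_of_real)
  ultimately show ?thesis by simp
qed

text \<open>Summation by parts: the exponential sums are bounded and
  \<open>1 / (t + \<i> * w)\<close> has total variation of order \<open>1 / (t + 1)\<close>. This
  decay, uniform in \<open>n\<close>, is what later admits \<open>Re s\<close> up to 3 for
  \<open>k = 0\<close>.\<close>

lemma psum_bound_interior:
  assumes k: "k \<le> 1" and v: "0 < v" "v < 1"
  shows "\<exists>C. \<forall>t>0. \<forall>n. norm (psum k (of_real v) (of_real t) n - (1 - of_nat k) / of_real t) \<le> C / (t + 1)"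
proof (intro exI allI impI)
  fix t :: real and n assume t: "t > 0"
  let ?u = "\<lambda>i. 1 / (complex_of_real t + \<i> * of_real (freq k i))"
  let ?S = "\<Sum>i<n. exp (\<i> * of_real (freq k i * v)) * ?u i"
  have s: "sin (pi * v) > 0" using v by (intro sin_gt_zero) auto
  have "norm ?S \<le> 1 / sin (pi * v) * (4 / (t + freq k 0))"
  proof (rule abel_summation_bound[where r = "\<lambda>i. 4 / (t + freq k i)"])
    fix i
    have f: "0 < freq k i" using freq_pos[OF k] .
    have "freq k i \<le> freq k (Suc i)" by (simp add: freq_def)
    then show "norm (?u i - ?u (Suc i)) \<le> 4 / (t + freq k i) - 4 / (t + freq k (Suc i))"
      using f t by (intro norm_inverse_linear_diff_le) auto
    have "norm (?u i) \<le> 2 / (t + freq k i)"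
      using f t by (intro norm_inverse_linear_le) auto
    also have "\<dots> \<le> 4 / (t + freq k i)" using f t by (intro divide_right_mono) auto
    finally show "norm (?u i) \<le> 4 / (t + freq k i)" .
  qed (rule exp_freq_sum_bound[OF assms])
  also have "\<dots> \<le> 1 / sin (pi * v) * (4 / (t + 1))"
  proof (intro mult_left_mono divide_left_mono)
    show *: "t + 1 \<le> t + freq k 0" using pi_gt3 freq_ge_pi[OF k, of 0] by simp
    show "0 < (t + freq k 0) * (t + 1)" using t freq_pos[OF k, of 0] by simp
  qed (use s in auto)
  finally have S: "norm ?S \<le> 4 / sin (pi * v) / (t + 1)" by simp
  have "psum k (of_real v) (of_real t) n - (1 - of_nat k) / of_real t = of_real (2 * Re ?S)"
    by (simp only: psum_def psum_term_eq[OF t] add_diff_cancel_left' Re_sum of_real_sum of_real_mult sum_distrib_left)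
  also have "norm \<dots> \<le> 2 * norm ?S"
    using abs_Re_le_cmod[of ?S] unfolding norm_of_real by linarith
  also have "\<dots> \<le> 2 * (4 / sin (pi * v) / (t + 1))" using S by linarith
  also have "\<dots> = (8 / sin (pi * v)) / (t + 1)" by simp
  finally show "norm (psum k (of_real v) (of_real t) n - (1 - of_nat k) / of_real t) \<le> (8 / sin (pi * v)) / (t + 1)" .
qed

text \<open>At \<open>v = 1\<close> the sines vanish and all cosines equal \<open>(-1) ^ k\<close>,
  so nothing cancels. What remains resembles a Riemann sum of
  \<open>2 * t / (t\<^sup>2 + w\<^sup>2)\<close>, whose integral over \<open>w\<close> does not
  depend on \<open>t\<close>.\<close>

lemma psum_bound_endpoint:
  assumes k: "k \<le> 1"
  shows "\<exists>C. \<forall>t>0. \<forall>n. norm (psum k 1 (of_real t) n - (1 - of_nat k) / of_real t) \<le> C"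
proof (intro exI allI impI)
  fix t :: real and n assume t: "t > 0"
  \<comment> \<open>The shift by half the spacing 2 pi places \<open>r i\<close> and
    \<open>r (Suc i)\<close> symmetrically about \<open>t + freq k i\<close>; their product is then
    below the square of the latter, and the comparison series telescopes.\<close>
  define r where "r = (\<lambda>i. t + freq k i - pi)"
  note f = freq_ge_pi[OF k]
  have rpos: "r i > 0" for i using f[of i] t by (simp add: r_def)
  have rS: "r (Suc i) = r i + 2 * pi" for i by (simp add: r_def freq_def algebra_simps)
  have term_le: "2 * t / (t\<^sup>2 + (freq k i)\<^sup>2) \<le> 4 * t / (2 * pi) * (1 / r i - 1 / r (Suc i))" for i
  proof -
    have "r i * r (Suc i) = (t + freq k i)\<^sup>2 - pi\<^sup>2"
      by (simp add: rS) (simp add: r_def power2_eq_square algebra_simps)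
    also have "\<dots> \<le> (t + freq k i)\<^sup>2" by simp
    also have "\<dots> \<le> 2 * (t\<^sup>2 + (freq k i)\<^sup>2)"
      using zero_le_power2[of "t - freq k i"] by (simp add: power2_eq_square algebra_simps)
    finally have le: "r i * r (Suc i) \<le> 2 * (t\<^sup>2 + (freq k i)\<^sup>2)" .
    have p: "t\<^sup>2 + (freq k i)\<^sup>2 > 0" using t by (simp add: sum_power2_gt_zero_iff)
    have "2 * t / (t\<^sup>2 + (freq k i)\<^sup>2) = (2 * (2 * t)) / (2 * (t\<^sup>2 + (freq k i)\<^sup>2))"
      by (rule mult_divide_mult_cancel_left[symmetric]) simp
    also have "\<dots> = 4 * t / (2 * (t\<^sup>2 + (freq k i)\<^sup>2))" by simp
    also have "\<dots> \<le> 4 * t / (r i * r (Suc i))"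
      using le p rpos t by (intro divide_left_mono) auto
    also have "\<dots> = 4 * t / (2 * pi) * (1 / r i - 1 / r (Suc i))"
    proof -
      have "1 / r i - 1 / r (Suc i) = (r (Suc i) - r i) / (r i * r (Suc i))"
        using rpos[of i] rpos[of "Suc i"] by (simp add: diff_frac_eq)
      then show ?thesis by (simp add: rS)
    qed
    finally show ?thesis .
  qed
  have c: "cos (complex_of_real (freq k i)) = (-1) ^ k" "sin (complex_of_real (freq k i)) = 0" for i
    using cos_sin_freq[OF k, of i] by (simp_all add: cos_of_real sin_of_real)
  have "psum k 1 (of_real t) n - (1 - of_nat k) / of_real t = of_real ((-1) ^ k * (\<Sum>i<n. 2 * t / (t\<^sup>2 + (freq k i)\<^sup>2)))"
    by (simp add: psum_def c sum_distrib_left mult_ac)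
  also have "norm \<dots> = (\<Sum>i<n. 2 * t / (t\<^sup>2 + (freq k i)\<^sup>2))"
    using t by (simp only: norm_of_real abs_mult power_abs) (auto intro!: abs_of_nonneg sum_nonneg)
  also have "\<dots> \<le> (\<Sum>i<n. 4 * t / (2 * pi) * (1 / r i - 1 / r (Suc i)))"
    by (intro sum_mono term_le)
  also have "\<dots> = 4 * t / (2 * pi) * (1 / r 0 - 1 / r n)"
  proof -
    have "(\<Sum>i<n. 1 / r i - 1 / r (Suc i)) = 1 / r 0 - 1 / r n"
      by (induction n) auto
    then show ?thesis by (simp only: sum_distrib_left[symmetric])
  qed
  also have "\<dots> \<le> 4 * t / (2 * pi) * (1 / r 0)"
    using t rpos[of n] by (intro mult_left_mono) auto
  also have "\<dots> \<le> 4 * t / (2 * pi) * (1 / t)"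
    using t rpos[of 0] f[of 0] by (intro mult_left_mono divide_left_mono) (auto simp: r_def)
  also have "\<dots> = 2 / pi" using t by simp
  finally show "norm (psum k 1 (of_real t) n - (1 - of_nat k) / of_real t) \<le> 2 / pi" .
qed

section \<open>Mellin transforms of rational functions\<close>

text \<open>The common majorant for Mellin integrands. Positive \<open>\<alpha>\<close> and
  \<open>\<beta>\<close> are the distances of the exponent from the two edges of the strip of
  convergence.\<close>

definition mdom :: "real \<Rightarrow> real \<Rightarrow> real \<Rightarrow> real" where
  "mdom \<alpha> \<beta> t = (if t \<le> 1 then t powr (\<alpha> - 1) else t powr (- \<beta> - 1))"

lemma borel_measurable_mdom [measurable]: "mdom \<alpha> \<beta> \<in> borel_measurable borel"
  unfolding mdom_def[abs_def] by measurable

lemma set_integrable_mdom: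
  assumes "\<alpha> > 0" "\<beta> > 0"
  shows "set_integrable lborel {0<..} (mdom \<alpha> \<beta>)"
proof -
  have "(\<lambda>t. t powr (\<alpha> - 1)) absolutely_integrable_on {0..1}"
    using assms by (intro nonnegative_absolutely_integrable_1 integrable_on_powr_from_0) auto
  then have 1: "set_integrable lebesgue {0<..1} (\<lambda>t. t powr (\<alpha> - 1))"
    by (rule set_integrable_subset) auto
  have "((\<lambda>t. t powr (- \<beta> - 1)) has_integral - (1 powr (- \<beta> - 1 + 1)) / (- \<beta> - 1 + 1)) {1..}"
    using assms by (intro has_integral_powr_to_inf) auto
  then have "(\<lambda>t. t powr (- \<beta> - 1)) absolutely_integrable_on {1..}"
    by (intro nonnegative_absolutely_integrable_1) (auto intro: has_integral_integrable)
  then have 2: "set_integrable lebesgue {1<..} (\<lambda>t. t powr (- \<beta> - 1))"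
    by (rule set_integrable_subset) auto
  have "set_integrable lebesgue {0<..1} (mdom \<alpha> \<beta>) = set_integrable lebesgue {0<..1} (\<lambda>t. t powr (\<alpha> - 1))"
    by (rule set_integrable_cong) (simp_all add: mdom_def)
  moreover have "set_integrable lebesgue {1<..} (mdom \<alpha> \<beta>) = set_integrable lebesgue {1<..} (\<lambda>t. t powr (- \<beta> - 1))"
    by (rule set_integrable_cong) (simp_all add: mdom_def)
  ultimately have "set_integrable lebesgue ({0<..1} \<union> {1<..}) (mdom \<alpha> \<beta>)"
    by (intro set_integrable_Un) (simp_all add: 1 2)
  moreover have "{0<..1} \<union> {1<..} = {0::real<..}" by auto
  ultimately have "integrable lebesgue (\<lambda>t. indicator {0<..} t *\<^sub>R mdom \<alpha> \<beta> t)"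
    by (simp only: set_integrable_def)
  moreover have "(\<lambda>t. indicator {0<..} t *\<^sub>R mdom \<alpha> \<beta> t) \<in> borel_measurable lborel"
    by simp
  ultimately show ?thesis
    unfolding set_integrable_def using integrable_completion by blast
qed

lemma set_borel_measurable_continuous:
  fixes f :: "real \<Rightarrow> complex"
  assumes "continuous_on A f" "A \<in> sets borel"
  shows "set_borel_measurable lborel A f"
  unfolding set_borel_measurable_def
  using borel_measurable_continuous_on_indicator[OF assms(2,1)] by simp

lemma set_integrable_mellin:
  fixes f :: "real \<Rightarrow> complex"
  assumes "continuous_on {0<..} f" "\<alpha> > 0" "\<beta> > 0" "\<And>t. t > 0 \<Longrightarrow> norm (f t) \<le> C * mdom \<alpha> \<beta> t"
  shows "set_integrable lborel {0<..} f"
proof (rule set_integrable_bound)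
  show "set_integrable lborel {0<..} (\<lambda>t. C * mdom \<alpha> \<beta> t)"
    using set_integrable_mdom[OF assms(2,3)] by simp
  show "AE x in lborel. x \<in> {0<..} \<longrightarrow> norm (f x) \<le> norm (C * mdom \<alpha> \<beta> x)"
    using assms(4) by (auto intro!: AE_I2 order_trans[OF _ abs_ge_self])
qed (auto intro!: set_borel_measurable_continuous assms)

lemma mellin_dominated_convergence:
  fixes f :: "nat \<Rightarrow> real \<Rightarrow> complex"
  assumes "\<And>n. continuous_on A (f n)" "continuous_on A g" "\<alpha> > 0" "\<beta> > 0"
    and A: "A \<in> sets borel" "A \<subseteq> {0<..}"
    and "\<And>n t. t \<in> A \<Longrightarrow> norm (f n t) \<le> C * mdom \<alpha> \<beta> t"
    and ptw: "\<And>t. t \<in> A \<Longrightarrow> (\<lambda>n. f n t) \<longlonglongrightarrow> g t"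
  shows "(\<lambda>n. LINT t:A|lborel. f n t) \<longlonglongrightarrow> (LINT t:A|lborel. g t)"
  unfolding set_lebesgue_integral_def
proof (rule integral_dominated_convergence[where w = "\<lambda>t. indicator A t *\<^sub>R (C * mdom \<alpha> \<beta> t)"])
  have "set_integrable lborel A (mdom \<alpha> \<beta>)"
    by (rule set_integrable_subset[OF set_integrable_mdom]) (use assms in auto)
  then show "integrable lborel (\<lambda>t. indicator A t *\<^sub>R (C * mdom \<alpha> \<beta> t))"
    unfolding set_integrable_def[symmetric] by simp
  show "AE x in lborel. (\<lambda>i. indicator A x *\<^sub>R f i x) \<longlonglongrightarrow> indicator A x *\<^sub>R g x"
    by (auto simp: indicator_def intro: ptw)
  show "AE x in lborel. norm (indicator A x *\<^sub>R f i x) \<le> indicator A x *\<^sub>R (C * mdom \<alpha> \<beta> x)" for i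
    using assms(7) by (auto simp: indicator_def)
qed (use assms(1,2) A set_borel_measurable_continuous in \<open>auto simp: set_borel_measurable_def\<close>)

lemma norm_powr_pos: "t > 0 \<Longrightarrow> norm (complex_of_real t powr z) = t powr Re z"
  by (simp add: norm_powr_real_powr)

lemma continuous_on_powr_pos [continuous_intros]:
  "continuous_on A f \<Longrightarrow> (\<And>t. t \<in> A \<Longrightarrow> f t > 0) \<Longrightarrow> continuous_on A (\<lambda>t. complex_of_real (f t) powr z)"
  by (intro continuous_on_powr_complex continuous_intros)
     (force simp: complex_nonpos_Reals_iff)+

lemma norm_mellin_le:
  assumes "t > 0" "C \<ge> 0" "d \<ge> 0"
    and "t \<le> 1 \<Longrightarrow> norm w \<le> C" and "1 \<le> t \<Longrightarrow> norm w \<le> C * t powr (- d)"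
  shows "norm (complex_of_real t powr (s - 1) * w) \<le> C * mdom (Re s) (d - Re s) t"
proof -
  have "norm (complex_of_real t powr (s - 1) * w) = t powr (Re s - 1) * norm w"
    using assms by (simp add: norm_mult norm_powr_pos)
  also have "\<dots> \<le> C * mdom (Re s) (d - Re s) t"
  proof (cases "t \<le> 1")
    case True
    then show ?thesis using assms mult_left_mono[of "norm w" C "t powr (Re s - 1)"]
      by (simp add: mdom_def mult.commute)
  next
    case False
    then have "t powr (Re s - 1) * norm w \<le> t powr (Re s - 1) * (C * t powr (- d))"
      using assms by (intro mult_left_mono) auto
    also have "\<dots> = C * (t powr (Re s - 1) * t powr (- d))" by simp
    also have "t powr (Re s - 1) * t powr (- d) = t powr (- (d - Re s) - 1)"
      unfolding powr_add[symmetric] by (simp add: algebra_simps)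
    finally show ?thesis using False by (simp add: mdom_def)
  qed
  finally show ?thesis .
qed

lemma powr_shift_one: "t > 0 \<Longrightarrow> complex_of_real t powr s = of_real t powr (s - 1) * of_real t"
  using powr_add[of "complex_of_real t" "s - 1" 1] by simp

lemma powr_shift_square: "t > 0 \<Longrightarrow> complex_of_real t powr (s - 1) = of_real t powr (s - 2 - 1) * of_real t ^ 2"
proof -
  assume t: "t > 0"
  have "complex_of_real t powr (s - 1) = complex_of_real t powr (s - 2 - 1 + of_nat 2)" by simp
  also have "\<dots> = complex_of_real t powr (s - 2 - 1) * complex_of_real t powr of_nat 2" by (rule powr_add)
  also have "complex_of_real t powr of_nat 2 = of_real t ^ 2" using t by (intro powr_complexpow) auto
  finally show ?thesis .
qed

lemma isCont_powr_pos: "x > 0 \<Longrightarrow> isCont (\<lambda>t. complex_of_real t powr z) x"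
  using continuous_on_powr_pos[of "{0<..}" "\<lambda>t. t" z] by (auto simp: continuous_on_eq_continuous_at)

lemma powr_pos_deriv:
  assumes "x > 0" "z \<noteq> 0"
  shows "((\<lambda>t. complex_of_real t powr z / z) has_vector_derivative complex_of_real x powr (z - 1)) (at x)"
proof -
  have "((\<lambda>w. w powr z / z) has_field_derivative complex_of_real x powr (z - 1)) (at (of_real x))"
    using assms by (auto intro!: derivative_eq_intros simp: complex_nonpos_Reals_iff)
  then show ?thesis by (rule has_vector_derivative_real_field)
qed

lemma LINT_powr_0_1:
  assumes "Re z > 0"
  shows "(LINT t:{0<..<1}|lborel. complex_of_real t powr (z - 1)) = 1 / z"
    and "set_integrable lborel {0<..<1} (\<lambda>t. complex_of_real t powr (z - 1))"
proof -
  have z: "z \<noteq> 0" using assms by auto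
  show i: "set_integrable lborel {0<..<1} (\<lambda>t. complex_of_real t powr (z - 1))"
  proof (rule set_integrable_bound)
    show "set_integrable lborel {0<..<1} (mdom (Re z) 1)"
      by (rule set_integrable_subset[OF set_integrable_mdom[of "Re z" 1]]) (use assms in auto)
    show "set_borel_measurable lborel {0<..<1} (\<lambda>t. complex_of_real t powr (z - 1))"
      by (intro set_borel_measurable_continuous continuous_intros) auto
  qed (auto simp: mdom_def norm_powr_pos)
  have "(LBINT t=ereal 0..ereal 1. complex_of_real t powr (z - 1)) = 1 / z - 0"
  proof (rule interval_integral_FTC_integrable[where F = "\<lambda>t. complex_of_real t powr z / z"])
    show "set_integrable lborel (einterval (ereal 0) (ereal 1)) (\<lambda>t. complex_of_real t powr (z - 1))"
      using i by simp
    have "((\<lambda>t. complex_of_real t powr z / z) \<longlongrightarrow> 0) (at_right 0)"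
    proof (rule tendsto_divide_zero, rule tendsto_norm_zero_cancel)
      have "((\<lambda>t. t powr Re z) \<longlongrightarrow> 0) (at_right 0)"
        using assms by real_asymp
      then show "((\<lambda>t. norm (complex_of_real t powr z)) \<longlongrightarrow> 0) (at_right 0)"
        by (rule Lim_transform_eventually)
           (use eventually_at_right_less[of "0::real"] in \<open>eventually_elim, simp add: norm_powr_pos\<close>)
    qed
    then show "(((\<lambda>t. complex_of_real t powr z / z) \<circ> real_of_ereal) \<longlongrightarrow> 0) (at_right (ereal 0))"
      by (simp add: ereal_tendsto_simps1)
    have "((\<lambda>t. complex_of_real t powr z / z) \<longlongrightarrow> complex_of_real 1 powr z / z) (at_left 1)"
      using isCont_powr_pos[of 1 z] z by (intro tendsto_divide tendsto_const) (auto simp: isCont_def intro: tendsto_within_subset)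
    then show "(((\<lambda>t. complex_of_real t powr z / z) \<circ> real_of_ereal) \<longlongrightarrow> 1 / z) (at_left (ereal 1))"
      by (simp add: ereal_tendsto_simps1)
  qed (auto intro!: powr_pos_deriv isCont_powr_pos z)
  then show "(LINT t:{0<..<1}|lborel. complex_of_real t powr (z - 1)) = 1 / z"
    by (simp add: interval_lebesgue_integral_def)
qed

lemma LINT_powr_1_inf:
  assumes "Re z < 0"
  shows "(LINT t:{1<..}|lborel. complex_of_real t powr (z - 1)) = - 1 / z"
    and "set_integrable lborel {1<..} (\<lambda>t. complex_of_real t powr (z - 1))"
proof -
  have z: "z \<noteq> 0" using assms by auto
  show i: "set_integrable lborel {1<..} (\<lambda>t. complex_of_real t powr (z - 1))"
  proof (rule set_integrable_bound)
    show "set_integrable lborel {1<..} (mdom 1 (- Re z))"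
      by (rule set_integrable_subset[OF set_integrable_mdom[of 1 "- Re z"]]) (use assms in auto)
    show "set_borel_measurable lborel {1<..} (\<lambda>t. complex_of_real t powr (z - 1))"
      by (intro set_borel_measurable_continuous continuous_intros) auto
  qed (auto simp: mdom_def norm_powr_pos)
  have "(LBINT t=ereal 1..\<infinity>. complex_of_real t powr (z - 1)) = 0 - 1 / z"
  proof (rule interval_integral_FTC_integrable[where F = "\<lambda>t. complex_of_real t powr z / z"])
    show "set_integrable lborel (einterval (ereal 1) \<infinity>) (\<lambda>t. complex_of_real t powr (z - 1))"
      using i by simp
    have "((\<lambda>t. complex_of_real t powr z / z) \<longlongrightarrow> 0) at_top"
    proof (rule tendsto_divide_zero, rule tendsto_norm_zero_cancel)
      have "((\<lambda>t. t powr Re z) \<longlongrightarrow> 0) at_top"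
        using assms by real_asymp
      then show "((\<lambda>t. norm (complex_of_real t powr z)) \<longlongrightarrow> 0) at_top"
        by (rule Lim_transform_eventually)
           (use eventually_gt_at_top[of "0::real"] in \<open>eventually_elim, simp add: norm_powr_pos\<close>)
    qed
    then show "(((\<lambda>t. complex_of_real t powr z / z) \<circ> real_of_ereal) \<longlongrightarrow> 0) (at_left \<infinity>)"
      by (simp add: ereal_tendsto_simps1)
    have "((\<lambda>t. complex_of_real t powr z / z) \<longlongrightarrow> complex_of_real 1 powr z / z) (at_right 1)"
      using isCont_powr_pos[of 1 z] z by (intro tendsto_divide tendsto_const) (auto simp: isCont_def intro: tendsto_within_subset)
    then show "(((\<lambda>t. complex_of_real t powr z / z) \<circ> real_of_ereal) \<longlongrightarrow> 1 / z) (at_right (ereal 1))"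
      by (simp add: ereal_tendsto_simps1)
  qed (auto intro!: powr_pos_deriv isCont_powr_pos z)
  then show "(LINT t:{1<..}|lborel. complex_of_real t powr (z - 1)) = - 1 / z"
    by (simp add: interval_lebesgue_integral_def)
qed

lemma LINT_sum:
  fixes f :: "'i \<Rightarrow> real \<Rightarrow> complex"
  assumes "\<And>i. i \<in> I \<Longrightarrow> set_integrable lborel A (f i)"
  shows "(LINT t:A|lborel. (\<Sum>i\<in>I. f i t)) = (\<Sum>i\<in>I. LINT t:A|lborel. f i t)"
  using assms unfolding set_lebesgue_integral_def set_integrable_def scaleR_sum_right
  by (intro Bochner_Integration.integral_sum) auto

text \<open>The ratio \<open>-x\<close> keeps distance at least 1 from 1, so the bound is uniform up
  to and including \<open>x = 1\<close>. It supplies a majorant although the series obtained by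
  termwise integration converges only conditionally.\<close>

lemma geom_alt_bound:
  assumes "0 \<le> x" "x \<le> 1"
  shows "norm (\<Sum>j<n. (- complex_of_real x) ^ j) \<le> 2"
proof -
  have ne: "- complex_of_real x \<noteq> 1"
    using assms by (auto simp: complex_eq_iff)
  have "norm (\<Sum>j<n. (- complex_of_real x) ^ j) = norm ((- complex_of_real x) ^ n - 1) / norm (- complex_of_real x - 1)"
    by (subst geometric_sum[OF ne]) (simp add: norm_divide)
  also have "- complex_of_real x - 1 = - of_real (1 + x)" by simp
  also have "norm (- complex_of_real (1 + x)) = 1 + x"
    using assms unfolding norm_minus_cancel norm_of_real by simp
  also have "norm ((- complex_of_real x) ^ n - 1) / (1 + x) \<le> 2 / 1"
  proof (rule frac_le)
    have "norm ((- complex_of_real x) ^ n) \<le> 1"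
      using assms by (simp add: norm_power power_le_one)
    then show "norm ((- complex_of_real x) ^ n - 1) \<le> 2"
      using norm_triangle_ineq4[of "(- complex_of_real x) ^ n" 1] by simp
  qed (use assms in auto)
  finally show ?thesis by simp
qed

lemma geom_alt_tendsto:
  assumes "0 \<le> x" "x < 1"
  shows "(\<lambda>n. \<Sum>j<n. (- complex_of_real x) ^ j) \<longlonglongrightarrow> 1 / (1 + of_real x)"
  using geometric_sums[of "- complex_of_real x"] assms by (simp add: sums_def)

text \<open>The Mellin transform of \<open>1 / (t\<^sup>2 + 1)\<close> for
  \<open>0 < Re s < 2\<close>, see \<open>mellin_quadratic_1\<close>.\<close>

definition mellin_const :: "complex \<Rightarrow> complex" where
  "mellin_const s = of_real pi / (2 * sin (of_real pi * s / 2))"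

text \<open>The case \<open>k = 0\<close>, \<open>v = 1/2\<close> of \<open>psum_tendsto\<close> at
  \<open>t = \<i> * pi * s\<close>, where the kernel equals
  \<open>1 / (2 * \<i> * sin (pi * s / 2))\<close>. Splitting each symmetric term into its two poles
  and regrouping leaves one extra last term, which tends to 0.\<close>

lemma mellin_series:
  assumes "sin (of_real pi * s / 2) \<noteq> 0"
  shows "(\<lambda>n. (\<Sum>j<n. (-1) ^ j / (s + 2 * of_nat j)) + (\<Sum>j<n. (-1) ^ j / (2 * of_nat j + 2 - s)))
           \<longlonglongrightarrow> mellin_const s"
proof -
  define t where "t = \<i> * of_real pi * s"
  have e2: "exp (t / 2) - exp (- (t / 2)) = 2 * \<i> * sin (of_real pi * s / 2)"
    by (simp add: t_def sin_exp_eq mult_ac)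
  have sq: "exp (t/2) * exp (t/2) = exp t" by (simp flip: exp_add)
  have et: "exp t - 1 = exp (t / 2) * (2 * \<i> * sin (of_real pi * s / 2))"
    unfolding e2[symmetric] by (simp add: right_diff_distrib sq exp_minus)
  then have ne: "exp t \<noteq> (-1) ^ 0" using assms by auto
  have "psum 0 (of_real (1/2)) t \<longlonglongrightarrow> exp ((1 - of_real (1/2)) * t) / (exp t - (-1) ^ 0) + (if (1/2::real) = 1 then (-1) ^ 0 / 2 else 0)"
    by (rule psum_tendsto[OF _ ne]) auto
  moreover have "exp ((1 - of_real (1/2)) * t) / (exp t - (-1) ^ 0) = 1 / (2 * \<i> * sin (of_real pi * s / 2))"
    using assms by (simp add: et)
  ultimately have lim: "psum 0 (1/2) t \<longlonglongrightarrow> 1 / (2 * \<i> * sin (of_real pi * s / 2))"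
    by simp
  have term_eq: "(2 * t * cos (of_real (freq 0 i) * (1/2)) + 2 * of_real (freq 0 i) * sin (of_real (freq 0 i) * (1/2))) / (t\<^sup>2 + (of_real (freq 0 i))\<^sup>2)
     = 1 / (\<i> * of_real pi) * ((-1) ^ i / (2 * of_nat i + 2 - s) - (-1) ^ i / (s + 2 * of_nat (Suc i)))" for i
  proof -
    have f: "freq 0 i / 2 = real (Suc i) * pi" by (simp add: freq_def)
    have "cos (freq 0 i / 2) = (-1) ^ Suc i" "sin (freq 0 i / 2) = 0"
      unfolding f by (simp_all only: cos_npi sin_npi)
    then have cs: "cos (complex_of_real (freq 0 i) * (1/2)) = (-1) ^ Suc i" "sin (complex_of_real (freq 0 i) * (1/2)) = 0"
      using cos_of_real[of "freq 0 i / 2", where ?'a = complex] sin_of_real[of "freq 0 i / 2", where ?'a = complex] by simp_all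
    have fr: "complex_of_real (freq 0 i) = of_real pi * (2 * of_nat i + 2)" by (simp add: freq_def)
    have "t\<^sup>2 + (of_real (freq 0 i))\<^sup>2 \<noteq> (0::complex)" by (rule exp_neq_imp_freq[OF _ ne]) simp
    moreover have d: "t\<^sup>2 + (of_real (freq 0 i))\<^sup>2 = (of_real pi)\<^sup>2 * ((2 * of_nat i + 2 - s) * (s + 2 * of_nat (Suc i)))"
      unfolding fr by (simp add: t_def power2_eq_square algebra_simps)
    ultimately have nz: "2 * of_nat i + 2 - s \<noteq> 0" "s + 2 * of_nat (Suc i) \<noteq> 0" by auto
    have r: "1 / (2 * of_nat i + 2 - s) - 1 / (s + 2 * of_nat (Suc i)) = 2 * s / ((2 * of_nat i + 2 - s) * (s + 2 * of_nat (Suc i)))"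
      using nz by (subst diff_frac_eq) (auto simp: algebra_simps)
    have "1 / (\<i> * of_real pi) * ((-1) ^ i / (2 * of_nat i + 2 - s) - (-1) ^ i / (s + 2 * of_nat (Suc i)))
       = (-1) ^ i * (1 / (\<i> * of_real pi)) * (1 / (2 * of_nat i + 2 - s) - 1 / (s + 2 * of_nat (Suc i)))"
      by (simp add: algebra_simps)
    also have "\<dots> = (-1) ^ i * (1 / (\<i> * of_real pi)) * (2 * s / ((2 * of_nat i + 2 - s) * (s + 2 * of_nat (Suc i))))"
      by (simp only: r)
    also have "\<dots> = (-1) ^ i * (- \<i> / of_real pi) * (2 * s / ((2 * of_nat i + 2 - s) * (s + 2 * of_nat (Suc i))))"
      by (simp add: divide_inverse)
    also have "\<dots> = 2 * t * (- ((-1) ^ i)) / ((of_real pi)\<^sup>2 * ((2 * of_nat i + 2 - s) * (s + 2 * of_nat (Suc i))))"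
      by (simp add: t_def power2_eq_square)
    finally have F: "1 / (\<i> * of_real pi) * ((-1) ^ i / (2 * of_nat i + 2 - s) - (-1) ^ i / (s + 2 * of_nat (Suc i)))
      = 2 * t * (- ((-1) ^ i)) / ((of_real pi)\<^sup>2 * ((2 * of_nat i + 2 - s) * (s + 2 * of_nat (Suc i))))" .
    show ?thesis unfolding cs d F by simp
  qed
  have head: "(1 - of_nat 0) / t = 1 / (\<i> * of_real pi) * (1 / s)"
    by (simp add: t_def)
  have P: "psum 0 (1/2) t n = 1 / (\<i> * of_real pi) *
     ((\<Sum>j<n. (-1) ^ j / (s + 2 * of_nat j)) + (\<Sum>j<n. (-1) ^ j / (2 * of_nat j + 2 - s)) + (-1) ^ n / (s + 2 * of_nat n))" for n
  proof -
    define a where "a = (\<lambda>j. (-1) ^ j / (s + 2 * of_nat j))"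
    define b where "b = (\<lambda>j. (-1) ^ j / (2 * of_nat j + 2 - s))"
    have "psum 0 (1/2) t n = 1 / (\<i> * of_real pi) * (a 0 + (\<Sum>i<n. b i + a (Suc i)))"
      unfolding psum_def term_eq head distrib_left sum_distrib_left
      by (simp add: a_def b_def diff_divide_distrib mult_ac)
    also have "a 0 + (\<Sum>i<n. b i + a (Suc i)) = (\<Sum>i<n. a i) + (\<Sum>i<n. b i) + a n"
      by (induction n) simp_all
    finally show ?thesis by (simp only: a_def b_def)
  qed
  have small: "(\<lambda>n. (-1) ^ n / (s + 2 * of_nat n)) \<longlonglongrightarrow> 0"
  proof (rule tendsto_norm_zero_cancel)
    have "filterlim (\<lambda>n. s + 2 * complex_of_nat n) at_infinity sequentially"
      by (intro tendsto_add_filterlim_at_infinity[OF tendsto_const] tendsto_mult_filterlim_at_infinity[OF tendsto_const] tendsto_of_nat) auto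
    then have "(\<lambda>n. 1 / (s + 2 * of_nat n)) \<longlonglongrightarrow> 0"
      by (intro tendsto_divide_0[OF tendsto_const])
    then show "(\<lambda>n. norm ((-1) ^ n / (s + 2 * of_nat n))) \<longlonglongrightarrow> 0"
      by (simp add: norm_divide norm_power tendsto_norm_zero_iff flip: norm_inverse inverse_eq_divide)
  qed
  have "(\<lambda>n. \<i> * of_real pi * psum 0 (1/2) t n - (-1) ^ n / (s + 2 * of_nat n)) \<longlonglongrightarrow>
     \<i> * of_real pi * (1 / (2 * \<i> * sin (of_real pi * s / 2))) - 0"
    by (intro tendsto_diff tendsto_mult tendsto_const lim small)
  moreover have "\<i> * of_real pi * psum 0 (1/2) t n - (-1) ^ n / (s + 2 * of_nat n) =
     (\<Sum>j<n. (-1) ^ j / (s + 2 * of_nat j)) + (\<Sum>j<n. (-1) ^ j / (2 * of_nat j + 2 - s))" for n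
    unfolding P by simp
  ultimately show ?thesis by (simp add: mellin_const_def)
qed

lemma sin_half_nonzero:
  assumes "0 < Re s" "Re s < 4" "s \<noteq> 2"
  shows "sin (of_real pi * s / 2) \<noteq> 0"
proof
  assume "sin (of_real pi * s / 2) = 0"
  then obtain n :: int where "of_real pi * s / 2 = of_real (of_int n * pi)" by (auto simp: sin_eq_0)
  then have s: "s = 2 * of_int n" by (simp add: field_simps)
  with assms have "0 < (2 * of_int n :: real)" "2 * of_int n < (4::real)" by auto
  then have "n = 1" by linarith
  with s assms show False by simp
qed

text \<open>
  The geometric series for \<open>1 / (t\<^sup>2 + 1)\<close> on \<open>(0, 1)\<close> and on \<open>(1, \<infinity>)\<close> is integrated term by term; the result
  is the partial fraction series \<open>mellin_series\<close> of the cosecant.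
\<close>
lemma mellin_quadratic_1:
  assumes s: "0 < Re s" "Re s < 2"
  shows "(LINT t:{0<..}|lborel. complex_of_real t powr (s - 1) * (1 / (of_real t ^ 2 + 1))) = mellin_const s"
    and "set_integrable lborel {0<..} (\<lambda>t. complex_of_real t powr (s - 1) * (1 / (of_real t ^ 2 + 1)))"
proof -
  define f where "f = (\<lambda>t. complex_of_real t powr (s - 1) * (1 / (of_real t ^ 2 + 1)))"
  have den: "complex_of_real t ^ 2 + 1 \<noteq> 0" for t
  proof -
    have "t\<^sup>2 + 1 \<noteq> 0" by (smt (verit) zero_le_power2)
    then have "complex_of_real (t\<^sup>2 + 1) \<noteq> 0" by (simp only: of_real_eq_0_iff) simp
    then show ?thesis by simp
  qed
  have nden: "norm (1 / (complex_of_real t ^ 2 + 1)) = 1 / (t\<^sup>2 + 1)" for t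
  proof -
    have "complex_of_real t ^ 2 + 1 = of_real (t\<^sup>2 + 1)" by simp
    then show ?thesis by (simp only: norm_divide norm_of_real) (simp add: abs_of_pos add_nonneg_pos)
  qed
  have cf: "continuous_on {0<..} f"
    unfolding f_def using den by (intro continuous_intros) auto
  have i: "set_integrable lborel {0<..} f"
  proof (rule set_integrable_mellin[OF cf, of "Re s" "2 - Re s" 1])
    fix t :: real assume "t > 0"
    then show "norm (f t) \<le> 1 * mdom (Re s) (2 - Re s) t"
      unfolding f_def
    proof (rule norm_mellin_le)
      show "norm (1 / (complex_of_real t ^ 2 + 1)) \<le> 1"
        unfolding nden by (simp add: divide_le_eq_1 add_nonneg_pos)
      assume "1 \<le> t"
      then show "norm (1 / (complex_of_real t ^ 2 + 1)) \<le> 1 * t powr - 2"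
        unfolding nden by (simp add: powr_minus divide_inverse le_imp_inverse_le powr_numeral)
    qed auto
  qed (use s in auto)
  then show "set_integrable lborel {0<..} (\<lambda>t. complex_of_real t powr (s - 1) * (1 / (of_real t ^ 2 + 1)))"
    by (simp add: f_def)
  let ?g = "\<lambda>x n. (\<Sum>j<n. (- complex_of_real x) ^ j)"
  have A: "(\<lambda>n. LINT t:{0<..<1}|lborel. complex_of_real t powr (s - 1) * ?g (t\<^sup>2) n) \<longlonglongrightarrow> (LINT t:{0<..<1}|lborel. f t)"
  proof (rule mellin_dominated_convergence[where \<alpha> = "Re s" and \<beta> = 1 and C = 2])
    show "continuous_on {0<..<1} (\<lambda>t. complex_of_real t powr (s - 1) * ?g (t\<^sup>2) n)" for n
      by (intro continuous_intros) auto
    show "continuous_on {0<..<1} f" by (rule continuous_on_subset[OF cf]) auto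
    show "norm (complex_of_real t powr (s - 1) * ?g (t\<^sup>2) n) \<le> 2 * mdom (Re s) 1 t" if "t \<in> {0<..<1}" for t n
      using that geom_alt_bound[of "t\<^sup>2" n]
      by (simp add: norm_mult norm_powr_pos mdom_def power_le_one mult.commute mult_left_mono)
    show "(\<lambda>n. complex_of_real t powr (s - 1) * ?g (t\<^sup>2) n) \<longlonglongrightarrow> f t" if t: "t \<in> {0<..<1}" for t
    proof -
      have "t\<^sup>2 < 1" using t by (simp add: power_less_one_iff)
      then have "?g (t\<^sup>2) \<longlonglongrightarrow> 1 / (1 + of_real (t\<^sup>2))" by (intro geom_alt_tendsto) auto
      then show ?thesis unfolding f_def by (intro tendsto_mult tendsto_const) (simp add: add.commute)
    qed
  qed (use s in auto)
  \<comment> \<open>Here the expansion is in powers of \<open>1 / t\<^sup>2\<close>; the factor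
    \<open>1 / t\<^sup>2\<close> pulled out of \<open>1 / (t\<^sup>2 + 1)\<close> lowers the
    exponent by 2.\<close>
  have B: "(\<lambda>n. LINT t:{1<..}|lborel. complex_of_real t powr (s - 2 - 1) * ?g (1 / t\<^sup>2) n) \<longlonglongrightarrow> (LINT t:{1<..}|lborel. f t)"
  proof (rule mellin_dominated_convergence[where \<alpha> = 1 and \<beta> = "2 - Re s" and C = 2])
    show "continuous_on {1<..} (\<lambda>t. complex_of_real t powr (s - 2 - 1) * ?g (1 / t\<^sup>2) n)" for n
      by (intro continuous_intros) auto
    show "continuous_on {1<..} f" by (rule continuous_on_subset[OF cf]) auto
    show "norm (complex_of_real t powr (s - 2 - 1) * ?g (1 / t\<^sup>2) n) \<le> 2 * mdom 1 (2 - Re s) t" if "t \<in> {1<..}" for t n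
    proof -
      have "1 \<le> t\<^sup>2" using that by (simp add: one_le_power)
      then have "norm (?g (1 / t\<^sup>2) n) \<le> 2" by (intro geom_alt_bound) (auto simp: divide_le_eq)
      then show ?thesis using that
        by (simp add: norm_mult norm_powr_pos mdom_def mult.commute mult_left_mono)
    qed
    show "(\<lambda>n. complex_of_real t powr (s - 2 - 1) * ?g (1 / t\<^sup>2) n) \<longlonglongrightarrow> f t" if t: "t \<in> {1<..}" for t
    proof -
      have "1 < t\<^sup>2" using t by (simp add: one_less_power)
      then have "?g (1 / t\<^sup>2) \<longlonglongrightarrow> 1 / (1 + of_real (1 / t\<^sup>2))" by (intro geom_alt_tendsto) (auto simp: divide_less_eq)
      then have "(\<lambda>n. complex_of_real t powr (s - 2 - 1) * ?g (1 / t\<^sup>2) n) \<longlonglongrightarrow> complex_of_real t powr (s - 2 - 1) * (1 / (1 + of_real (1 / t\<^sup>2)))"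
        by (intro tendsto_mult tendsto_const)
      moreover have "complex_of_real t powr (s - 2 - 1) * (1 / (1 + of_real (1 / t\<^sup>2))) = f t"
      proof -
        have "complex_of_real t powr (s - 1) = complex_of_real t powr (s - 2 - 1) * of_real t ^ 2"
          using t by (intro powr_shift_square) auto
        then show ?thesis using t den[of t] by (simp add: f_def field_simps)
      qed
      ultimately show ?thesis by simp
    qed
  qed (use s in auto)
  have A': "(LINT t:{0<..<1}|lborel. complex_of_real t powr (s - 1) * ?g (t\<^sup>2) n) = (\<Sum>j<n. (-1) ^ j / (s + 2 * of_nat j))" for n
  proof -
    have "(LINT t:{0<..<1}|lborel. complex_of_real t powr (s - 1) * ?g (t\<^sup>2) n)
      = (LINT t:{0<..<1}|lborel. (\<Sum>j<n. (-1) ^ j * complex_of_real t powr (s + 2 * of_nat j - 1)))"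
    proof (intro set_lebesgue_integral_cong allI impI)
      fix t :: real assume t: "t \<in> {0<..<1}"
      have "complex_of_real t powr (s - 1) * (- complex_of_real (t\<^sup>2)) ^ j = (-1) ^ j * complex_of_real t powr (s + 2 * of_nat j - 1)" for j
      proof -
        have "complex_of_real t powr (s + 2 * of_nat j - 1) = complex_of_real t powr (s - 1 + of_nat (2 * j))" by (simp add: algebra_simps)
        also have "\<dots> = complex_of_real t powr (s - 1) * complex_of_real t ^ (2 * j)"
          using t by (subst powr_add, subst powr_complexpow) auto
        finally show ?thesis by (simp add: power_minus[of "complex_of_real t ^ 2"] power_mult)
      qed
      then show "complex_of_real t powr (s - 1) * ?g (t\<^sup>2) n = (\<Sum>j<n. (-1) ^ j * complex_of_real t powr (s + 2 * of_nat j - 1))"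
        by (simp only: sum_distrib_left)
    qed auto
    also have "\<dots> = (\<Sum>j<n. LINT t:{0<..<1}|lborel. (-1) ^ j * complex_of_real t powr (s + 2 * of_nat j - 1))"
      by (intro LINT_sum set_integrable_mult_right LINT_powr_0_1) (use s in auto)
    also have "\<dots> = (\<Sum>j<n. (-1) ^ j / (s + 2 * of_nat j))"
      using s by (intro sum.cong refl) (simp add: LINT_powr_0_1)
    finally show ?thesis .
  qed
  have B': "(LINT t:{1<..}|lborel. complex_of_real t powr (s - 2 - 1) * ?g (1 / t\<^sup>2) n) = (\<Sum>j<n. (-1) ^ j / (2 * of_nat j + 2 - s))" for n
  proof -
    have "(LINT t:{1<..}|lborel. complex_of_real t powr (s - 2 - 1) * ?g (1 / t\<^sup>2) n)
      = (LINT t:{1<..}|lborel. (\<Sum>j<n. (-1) ^ j * complex_of_real t powr (s - 2 - 2 * of_nat j - 1)))"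
    proof (intro set_lebesgue_integral_cong allI impI)
      fix t :: real assume t: "t \<in> {1<..}"
      have "complex_of_real t powr (s - 2 - 1) * (- complex_of_real (1 / t\<^sup>2)) ^ j = (-1) ^ j * complex_of_real t powr (s - 2 - 2 * of_nat j - 1)" for j
      proof -
        have "complex_of_real t powr (s - 2 - 2 * of_nat j - 1) = complex_of_real t powr (s - 2 - 1 - of_nat (2 * j))" by (simp add: algebra_simps)
        also have "\<dots> = complex_of_real t powr (s - 2 - 1) / complex_of_real t ^ (2 * j)"
          using t by (subst powr_diff, subst powr_complexpow) auto
        finally show ?thesis by (simp add: power_minus[of "1 / complex_of_real t ^ 2"] power_mult power_one_over)
      qed
      then show "complex_of_real t powr (s - 2 - 1) * ?g (1 / t\<^sup>2) n = (\<Sum>j<n. (-1) ^ j * complex_of_real t powr (s - 2 - 2 * of_nat j - 1))"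
        by (simp only: sum_distrib_left)
    qed auto
    also have "\<dots> = (\<Sum>j<n. LINT t:{1<..}|lborel. (-1) ^ j * complex_of_real t powr (s - 2 - 2 * of_nat j - 1))"
      by (intro LINT_sum set_integrable_mult_right LINT_powr_1_inf) (use s in auto)
    also have "\<dots> = (\<Sum>j<n. (-1) ^ j / (2 * of_nat j + 2 - s))"
    proof (intro sum.cong refl)
      fix j
      have "- 1 / (s - 2 - 2 * of_nat j) = 1 / (2 * of_nat j + 2 - s)"
        by (metis (no_types, opaque_lifting) diff_diff_eq minus_diff_eq minus_divide_divide add.commute add.inverse_inverse)
      then show "(LINT t:{1<..}|lborel. (-1) ^ j * complex_of_real t powr (s - 2 - 2 * of_nat j - 1)) = (-1) ^ j / (2 * of_nat j + 2 - s)"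
        using s LINT_powr_1_inf(1)[of "s - 2 - 2 * of_nat j"] by simp
    qed
    finally show ?thesis .
  qed
  have ne: "sin (of_real pi * s / 2) \<noteq> 0" using s by (intro sin_half_nonzero) auto
  have "(LINT t:{0<..<1}|lborel. f t) + (LINT t:{1<..}|lborel. f t) = mellin_const s"
    using tendsto_add[OF A B] mellin_series[OF ne] unfolding A' B' by (rule LIMSEQ_unique)
  also have "(LINT t:{0<..<1}|lborel. f t) = (LINT t:{0<..1}|lborel. f t)"
  proof (rule set_integral_cong_set)
    show "AE x in lborel. (x \<in> {0<..1}) = (x \<in> {0<..<1::real})"
      using AE_lborel_singleton[of 1] by eventually_elim auto
  qed (auto intro!: set_borel_measurable_continuous continuous_on_subset[OF cf])
  finally have "(LINT t:{0<..1}|lborel. f t) + (LINT t:{1<..}|lborel. f t) = mellin_const s" .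
  moreover have "(LINT t:{0<..1} \<union> {1<..}|lborel. f t) = (LINT t:{0<..1}|lborel. f t) + (LINT t:{1<..}|lborel. f t)"
    by (intro set_integral_Un set_integrable_subset[OF i]) auto
  moreover have "{0<..1} \<union> {1<..} = {0::real<..}" by auto
  ultimately show "(LINT t:{0<..}|lborel. complex_of_real t powr (s - 1) * (1 / (of_real t ^ 2 + 1))) = mellin_const s"
    by (simp add: f_def)
qed

abbreviation (input) mint :: "(real \<Rightarrow> complex) \<Rightarrow> complex" where
  "mint f \<equiv> LINT t:{0<..}|lborel. f t"

abbreviation (input) mquad :: "complex \<Rightarrow> real \<Rightarrow> real \<Rightarrow> complex" where
  "mquad s a t \<equiv> complex_of_real t powr (s - 1) * (1 / (of_real t ^ 2 + of_real a ^ 2))"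

abbreviation (input) mquart :: "complex \<Rightarrow> real \<Rightarrow> real \<Rightarrow> real \<Rightarrow> complex" where
  "mquart s a b t \<equiv> complex_of_real t powr (s - 1) * (1 / ((of_real t ^ 2 + of_real a ^ 2) * (of_real t ^ 2 + of_real b ^ 2)))"

lemma of_real_square_add_nonzero:
  "a > 0 \<Longrightarrow> (complex_of_real t)\<^sup>2 + (of_real a)\<^sup>2 \<noteq> 0"
proof -
  assume "a > 0"
  then have "complex_of_real (t\<^sup>2 + a\<^sup>2) \<noteq> 0"
    by (simp only: of_real_eq_0_iff) (simp add: sum_power2_eq_zero_iff)
  then show ?thesis by simp
qed

lemma norm_inverse_square_add:
  "norm (1 / ((complex_of_real t)\<^sup>2 + (of_real a)\<^sup>2)) = 1 / (t\<^sup>2 + a\<^sup>2)"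
proof -
  have "(complex_of_real t)\<^sup>2 + (of_real a)\<^sup>2 = of_real (t\<^sup>2 + a\<^sup>2)" by simp
  then show ?thesis by (simp only: norm_divide norm_of_real) simp
qed

lemma norm_inverse_square_add_le:
  assumes "a > 0" "t > 0"
  shows "norm (1 / ((complex_of_real t)\<^sup>2 + (of_real a)\<^sup>2)) \<le> 1 / a\<^sup>2"
    and "norm (1 / ((complex_of_real t)\<^sup>2 + (of_real a)\<^sup>2)) \<le> t powr - 2"
proof -
  show "norm (1 / ((complex_of_real t)\<^sup>2 + (of_real a)\<^sup>2)) \<le> 1 / a\<^sup>2"
    unfolding norm_inverse_square_add using assms by (intro divide_left_mono) (auto simp: add_nonneg_pos)
  have "1 / (t\<^sup>2 + a\<^sup>2) \<le> 1 / t\<^sup>2"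
    using assms by (intro divide_left_mono) (auto simp: add_pos_nonneg)
  also have "\<dots> = t powr - 2" using assms by (simp add: powr_minus divide_inverse powr_numeral)
  finally show "norm (1 / ((complex_of_real t)\<^sup>2 + (of_real a)\<^sup>2)) \<le> t powr - 2"
    unfolding norm_inverse_square_add .
qed

lemma mellin_quadratic_integrable:
  assumes s: "0 < Re s" "Re s < 2" and a: "a > 0"
  shows "set_integrable lborel {0<..} (mquad s a)"
proof (rule set_integrable_mellin[of _ "Re s" "2 - Re s" "max (1 / a\<^sup>2) 1"])
  show "continuous_on {0<..} (mquad s a)"
    using of_real_square_add_nonzero[OF a] by (intro continuous_intros) auto
  fix t :: real assume t: "t > 0"
  then show "norm (mquad s a t) \<le> max (1 / a\<^sup>2) 1 * mdom (Re s) (2 - Re s) t"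
  proof (rule norm_mellin_le)
    have "t powr - 2 \<le> max (1 / a\<^sup>2) 1 * t powr - 2"
      using mult_right_mono[of 1 "max (1 / a\<^sup>2) 1" "t powr - 2"] by simp
    then show "norm (1 / ((complex_of_real t)\<^sup>2 + (of_real a)\<^sup>2)) \<le> max (1 / a\<^sup>2) 1 * t powr - 2"
      using norm_inverse_square_add_le(2)[OF a t] by linarith
  qed (use norm_inverse_square_add_le(1)[OF a t] in auto)
qed (use s in auto)

text \<open>The substitution \<open>t = a * u\<close> in \<open>mellin_quadratic_1\<close>.\<close>

lemma mellin_quadratic:
  assumes s: "0 < Re s" "Re s < 2" and a: "a > 0"
  shows "mint (mquad s a)
    = of_real a powr (s - 2) * mellin_const s"
proof -
  let ?f = "\<lambda>t. mquad s a t"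
  have "(LINT t:{0<..}|lborel. ?f t) = \<bar>a\<bar> *\<^sub>R (LINT t|lborel. indicator {0<..} (0 + a * t) *\<^sub>R ?f (0 + a * t))"
    unfolding set_lebesgue_integral_def by (rule lborel_integral_real_affine) (use a in auto)
  also have "(LINT t|lborel. indicator {0<..} (0 + a * t) *\<^sub>R ?f (0 + a * t)) =
     (LINT t:{0<..}|lborel. (of_real a powr (s - 1) / of_real a ^ 2) * (complex_of_real t powr (s - 1) * (1 / (of_real t ^ 2 + 1))))"
    unfolding set_lebesgue_integral_def
  proof (intro Bochner_Integration.integral_cong refl)
    fix t :: real
    have "?f (a * t) = (of_real a powr (s - 1) / of_real a ^ 2) * (complex_of_real t powr (s - 1) * (1 / (of_real t ^ 2 + 1)))" if "t > 0"
    proof -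
      have "complex_of_real (a * t) powr (s - 1) = of_real a powr (s - 1) * of_real t powr (s - 1)"
        using a that by (simp add: powr_times_real)
      moreover have "complex_of_real (a * t) ^ 2 + of_real a ^ 2 = of_real a ^ 2 * (of_real t ^ 2 + 1)"
        by (simp add: algebra_simps power_mult_distrib)
      ultimately show ?thesis by simp
    qed
    then show "indicator {0<..} (0 + a * t) *\<^sub>R ?f (0 + a * t) =
      indicator {0<..} t *\<^sub>R ((of_real a powr (s - 1) / of_real a ^ 2) * (complex_of_real t powr (s - 1) * (1 / (of_real t ^ 2 + 1))))"
      using a by (auto simp: indicator_def zero_less_mult_iff)
  qed
  also have "\<dots> = (of_real a powr (s - 1) / of_real a ^ 2) * mellin_const s"
    by (simp only: set_integral_mult_right mellin_quadratic_1(1)[OF s])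
  finally have "(LINT t:{0<..}|lborel. ?f t) = of_real a * (of_real a powr (s - 1) / of_real a ^ 2) * mellin_const s"
    using a by (simp add: scaleR_conv_of_real)
  also have "of_real a * (of_real a powr (s - 1) / of_real a ^ 2) = (of_real a powr (s - 2) :: complex)"
    using powr_shift_one[OF a, of "s - 1"] a by (simp add: power2_eq_square)
  finally show ?thesis .
qed

lemma norm_quartic_le:
  assumes a: "a > 0" and b: "b > 0" and t: "t > 0"
  shows "norm (1 / (((complex_of_real t)\<^sup>2 + (of_real a)\<^sup>2) * ((of_real t)\<^sup>2 + (of_real b)\<^sup>2))) \<le> max (1 / (a\<^sup>2 * b\<^sup>2)) 1"
    and "norm (1 / (((complex_of_real t)\<^sup>2 + (of_real a)\<^sup>2) * ((of_real t)\<^sup>2 + (of_real b)\<^sup>2))) \<le> max (1 / (a\<^sup>2 * b\<^sup>2)) 1 * t powr - 4"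
proof -
  have eq: "1 / (((complex_of_real t)\<^sup>2 + (of_real a)\<^sup>2) * ((of_real t)\<^sup>2 + (of_real b)\<^sup>2))
    = 1 / ((complex_of_real t)\<^sup>2 + (of_real a)\<^sup>2) * (1 / ((complex_of_real t)\<^sup>2 + (of_real b)\<^sup>2))" by simp
  have "norm (1 / ((complex_of_real t)\<^sup>2 + (of_real a)\<^sup>2)) * norm (1 / ((complex_of_real t)\<^sup>2 + (of_real b)\<^sup>2)) \<le> 1 / a\<^sup>2 * (1 / b\<^sup>2)"
    by (intro mult_mono norm_inverse_square_add_le assms) auto
  then show "norm (1 / (((complex_of_real t)\<^sup>2 + (of_real a)\<^sup>2) * ((of_real t)\<^sup>2 + (of_real b)\<^sup>2))) \<le> max (1 / (a\<^sup>2 * b\<^sup>2)) 1"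
    unfolding eq norm_mult by simp
  have "norm (1 / ((complex_of_real t)\<^sup>2 + (of_real a)\<^sup>2)) * norm (1 / ((complex_of_real t)\<^sup>2 + (of_real b)\<^sup>2)) \<le> t powr - 2 * t powr - 2"
    by (intro mult_mono norm_inverse_square_add_le assms) auto
  also have "\<dots> = 1 * t powr - 4" by (simp flip: powr_add)
  also have "\<dots> \<le> max (1 / (a\<^sup>2 * b\<^sup>2)) 1 * t powr - 4" by (intro mult_right_mono) auto
  finally show "norm (1 / (((complex_of_real t)\<^sup>2 + (of_real a)\<^sup>2) * ((of_real t)\<^sup>2 + (of_real b)\<^sup>2))) \<le> max (1 / (a\<^sup>2 * b\<^sup>2)) 1 * t powr - 4"
    unfolding eq norm_mult .
qed

lemma mellin_quartic_continuous:
  assumes "a > 0" "b > 0"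
  shows "continuous_on {0<..} (mquart s a b)"
  using of_real_square_add_nonzero assms by (intro continuous_intros) auto

lemma mellin_quartic_integrable:
  assumes s: "0 < Re s" "Re s < 4" and a: "a > 0" and b: "b > 0"
  shows "set_integrable lborel {0<..} (mquart s a b)"
proof (rule set_integrable_mellin[OF mellin_quartic_continuous[OF a b]])
  fix t :: real assume t: "t > 0"
  show "norm (mquart s a b t)
     \<le> max (1 / (a\<^sup>2 * b\<^sup>2)) 1 * mdom (Re s) (4 - Re s) t"
    using norm_quartic_le[OF a b t] by (intro norm_mellin_le t) auto
qed (use s in auto)

text \<open>
  Depending on the sign of \<open>Re s - 2\<close>, two different partial fraction decompositions have convergent Mellin
  transforms; on the line \<open>Re s = 2\<close> neither has, and the formula extends by continuity.
\<close>
lemma mellin_quartic: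
  assumes s: "0 < Re s" "Re s < 4" "s \<noteq> 2" and a: "a > 0" and b: "b > 0" and ab: "a \<noteq> b"
  shows "mint (mquart s a b)
    = mellin_const s * ((of_real a powr (s - 2) - of_real b powr (s - 2)) / (of_real b ^ 2 - of_real a ^ 2))"
proof -
  let ?d = "of_real b ^ 2 - of_real a ^ 2 :: complex"
  have d: "?d \<noteq> 0"
  proof -
    have "b\<^sup>2 \<noteq> a\<^sup>2" using a b ab by (simp add: power2_eq_iff_nonneg)
    then have "complex_of_real (b\<^sup>2 - a\<^sup>2) \<noteq> 0" by (simp only: of_real_eq_0_iff right_minus_eq not_False_eq_True)
    then show ?thesis by simp
  qed
  note nz = of_real_square_add_nonzero[OF a] of_real_square_add_nonzero[OF b]
  have small: "mint (mquart s a b)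
    = mellin_const s * ((of_real a powr (s - 2) - of_real b powr (s - 2)) / ?d)" if s: "0 < Re s" "Re s < 2" for s
  proof -
    have "mquart s a b t
      = (mquad s a t - mquad s b t) / ?d" for t
    proof -
      have "1 / (of_real t ^ 2 + of_real a ^ 2) - 1 / (of_real t ^ 2 + of_real b ^ 2) = ?d / ((of_real t ^ 2 + of_real a ^ 2) * (of_real t ^ 2 + of_real b ^ 2))"
        using nz[of t] by (simp add: diff_frac_eq)
      then have e: "(1 / (of_real t ^ 2 + of_real a ^ 2) - 1 / (of_real t ^ 2 + of_real b ^ 2)) / ?d = 1 / ((of_real t ^ 2 + of_real a ^ 2) * (of_real t ^ 2 + of_real b ^ 2))"
        using d by simp
      show ?thesis unfolding e[symmetric] by (simp only: right_diff_distrib times_divide_eq_right)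
    qed
    then show ?thesis
      using mellin_quadratic_integrable[OF s a] mellin_quadratic_integrable[OF s b]
      by (simp only: set_integral_divide_zero set_integral_diff mellin_quadratic[OF s a] mellin_quadratic[OF s b])
         (simp only: mult.commute[of _ "mellin_const s"] right_diff_distrib times_divide_eq_right)
  qed
  consider "Re s < 2" | "Re s > 2" | "Re s = 2" by linarith
  then show ?thesis
  proof cases
    case 1
    then show ?thesis using small s by simp
  next
    case 2
    then have s2: "0 < Re (s - 2)" "Re (s - 2) < 2" using s by auto
    \<comment> \<open>Moving \<open>t\<^sup>2\<close> from the power to the fraction gives a
      difference of the quotients \<open>b\<^sup>2 / (t\<^sup>2 + b\<^sup>2)\<close> and
      \<open>a\<^sup>2 / (t\<^sup>2 + a\<^sup>2)\<close>, with exponent \<open>s - 2\<close> inside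
      the first strip. \<open>mellin_const\<close> changes sign under this shift, which offsets the
      reversed order of the difference.\<close>
    have "mint (mquart s a b)
     = (LINT t:{0<..}|lborel. (of_real b ^ 2 * (mquad (s - 2) b t)
        - of_real a ^ 2 * (mquad (s - 2) a t)) / ?d)"
    proof (intro set_lebesgue_integral_cong allI impI)
      fix t :: real assume t: "t \<in> {0<..}"
      have "of_real b ^ 2 / (of_real t ^ 2 + of_real b ^ 2) - of_real a ^ 2 / (of_real t ^ 2 + of_real a ^ 2)
         = of_real t ^ 2 * ?d / ((of_real t ^ 2 + of_real a ^ 2) * (of_real t ^ 2 + of_real b ^ 2))"
        using nz[of t] by (subst diff_frac_eq) (auto simp: algebra_simps)
      then have e: "(of_real b ^ 2 / (of_real t ^ 2 + of_real b ^ 2) - of_real a ^ 2 / (of_real t ^ 2 + of_real a ^ 2)) / ?d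
         = of_real t ^ 2 / ((of_real t ^ 2 + of_real a ^ 2) * (of_real t ^ 2 + of_real b ^ 2))"
        using d by simp
      have "(of_real b ^ 2 * (mquad (s - 2) b t)
        - of_real a ^ 2 * (mquad (s - 2) a t)) / ?d
        = complex_of_real t powr (s - 2 - 1) * ((of_real b ^ 2 / (of_real t ^ 2 + of_real b ^ 2) - of_real a ^ 2 / (of_real t ^ 2 + of_real a ^ 2)) / ?d)"
        by (simp add: algebra_simps)
      then show "mquart s a b t
        = (of_real b ^ 2 * (mquad (s - 2) b t)
        - of_real a ^ 2 * (mquad (s - 2) a t)) / ?d"
        unfolding e using t powr_shift_square[of t s] by simp
    qed auto
    also have "\<dots> = (of_real b ^ 2 * (of_real b powr (s - 2 - 2) * mellin_const (s - 2)) - of_real a ^ 2 * (of_real a powr (s - 2 - 2) * mellin_const (s - 2))) / ?d"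
      using mellin_quadratic_integrable[OF s2 a] mellin_quadratic_integrable[OF s2 b]
      by (simp only: set_integral_divide_zero set_integral_diff set_integrable_mult_right set_integral_mult_right mellin_quadratic[OF s2 a] mellin_quadratic[OF s2 b])
    also have "mellin_const (s - 2) = - mellin_const s"
    proof -
      have eq: "of_real pi * (s - 2) / 2 = of_real pi * s / 2 - of_real pi" by (simp add: right_diff_distrib diff_divide_distrib)
      show ?thesis unfolding mellin_const_def eq by (simp add: sin_diff sin_of_real cos_of_real)
    qed
    also have "of_real b ^ 2 * (of_real b powr (s - 2 - 2) * - mellin_const s) = - (of_real b powr (s - 2) * mellin_const s)"
      using powr_shift_square[OF b, of "s - 1"] by (simp add: algebra_simps)
    also have "of_real a ^ 2 * (of_real a powr (s - 2 - 2) * - mellin_const s) = - (of_real a powr (s - 2) * mellin_const s)"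
      using powr_shift_square[OF a, of "s - 1"] by (simp add: algebra_simps)
    finally show ?thesis by (simp add: algebra_simps)
  next
    case 3
    \<comment> \<open>Approaches \<open>s\<close> horizontally from the left. The shift is at most
      1/2, so \<open>Re (r n)\<close> stays above 1 and one majorant, with both margins equal to 1,
      serves all \<open>n\<close>.\<close>
    define r where "r = (\<lambda>n. s - of_real (1 / (real n + 2)))"
    have r: "1 < Re (r n)" "Re (r n) < 2" for n
      using 3 by (auto simp: r_def field_simps)
    have "(\<lambda>n. 1 / (real n + 2)) \<longlonglongrightarrow> 0" by real_asymp
    then have "r \<longlonglongrightarrow> s - of_real 0" unfolding r_def by (intro tendsto_intros)
    then have rl: "r \<longlonglongrightarrow> s" by simp
    have "(\<lambda>n. mint (mquart (r n) a b))
       \<longlonglongrightarrow> mint (mquart s a b)"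
    proof (rule mellin_dominated_convergence[where \<alpha> = 1 and \<beta> = 1 and C = "max (1 / (a\<^sup>2 * b\<^sup>2)) 1"])
      fix n and t :: real assume t: "t \<in> {0<..}"
      have "norm (mquart (r n) a b t)
         \<le> max (1 / (a\<^sup>2 * b\<^sup>2)) 1 * mdom (Re (r n)) (4 - Re (r n)) t"
        using t norm_quartic_le[OF a b, of t] by (intro norm_mellin_le) auto
      also have "\<dots> \<le> max (1 / (a\<^sup>2 * b\<^sup>2)) 1 * mdom 1 1 t"
      proof (rule mult_left_mono)
        show "mdom (Re (r n)) (4 - Re (r n)) t \<le> mdom 1 1 t"
          using r[of n] t by (auto simp: mdom_def intro!: powr_le1 powr_mono)
      qed auto
      finally show "norm (mquart (r n) a b t)
         \<le> max (1 / (a\<^sup>2 * b\<^sup>2)) 1 * mdom 1 1 t" .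
    next
      fix t :: real assume "t \<in> {0<..}"
      then show "(\<lambda>n. mquart (r n) a b t)
        \<longlonglongrightarrow> mquart s a b t"
        by (intro tendsto_mult tendsto_const tendsto_powr_complex tendsto_diff rl) (auto simp: complex_nonpos_Reals_iff)
    qed (rule mellin_quartic_continuous[OF a b] | simp)+
    moreover have "mint (mquart (r n) a b)
       = mellin_const (r n) * ((of_real a powr (r n - 2) - of_real b powr (r n - 2)) / ?d)" for n
      using r[of n] by (intro small) auto
    moreover have "(\<lambda>n. mellin_const (r n) * ((of_real a powr (r n - 2) - of_real b powr (r n - 2)) / ?d))
       \<longlonglongrightarrow> mellin_const s * ((of_real a powr (s - 2) - of_real b powr (s - 2)) / ?d)"
      unfolding mellin_const_def using sin_half_nonzero[OF s] d a b
      by (intro tendsto_intros tendsto_powr_complex rl) (auto simp: complex_nonpos_Reals_iff)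
    ultimately show ?thesis using LIMSEQ_unique by simp
  qed
qed

section \<open>Functions of exponential type bounded on the real line\<close>

lemma holomorphic_compose_UNIV:
  "f holomorphic_on UNIV \<Longrightarrow> g holomorphic_on A \<Longrightarrow> (\<lambda>z. f (g z)) holomorphic_on A"
  using holomorphic_on_compose_gen[of g A f UNIV] by (simp add: o_def)

text \<open>The substitution \<open>z = u\<^sup>2\<close> turns the quadrant into the sector \<open>0 \<le> Im u \<le> Re u\<close>, on which the
  polynomial \<open>(1 - 2\<i>) u\<^sup>3\<close> has real part at least \<open>(Re u)\<^sup>3\<close> and so dominates the growth
  \<open>exp (A \<bar>u\<bar>\<^sup>2)\<close>.\<close>
lemma phragmen_lindelof_quadrant:
  assumes f: "f holomorphic_on UNIV"
    and growth: "\<And>z. norm (f z) \<le> C * exp (A * norm z)"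
    and real: "\<And>x. x \<ge> 0 \<Longrightarrow> norm (f (of_real x)) \<le> M"
    and imag: "\<And>y. y \<ge> 0 \<Longrightarrow> norm (f (\<i> * of_real y)) \<le> M"
    and z: "Re z \<ge> 0" "Im z \<ge> 0"
  shows "norm (f z) \<le> M"
proof -
  define p :: "complex \<Rightarrow> complex" where "p = (\<lambda>u. (1 - 2 * \<i>) * u ^ 3)"
  \<comment> \<open>With \<open>u = x + \<i> * y\<close> the coefficient \<open>- 2 * \<i>\<close>
    contributes \<open>6 * x\<^sup>2 * y - 2 * y ^ 3\<close>, which outweighs the term
    \<open>- 3 * x * y\<^sup>2\<close> of the real part of \<open>u ^ 3\<close> when
    \<open>0 \<le> y \<le> x\<close>.\<close>
  have Rp: "Re (p u) \<ge> Re u ^ 3" if "0 \<le> Im u" "Im u \<le> Re u" for u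
  proof -
    obtain x y where u: "u = Complex x y" by (cases u)
    have xy: "0 \<le> y" "y \<le> x" using that u by auto
    have "Re (p u) = x ^ 3 - 3 * x * y\<^sup>2 + 6 * x\<^sup>2 * y - 2 * y ^ 3"
      by (simp add: p_def u power3_eq_cube power2_eq_square algebra_simps)
    moreover have "x * y * y \<le> x * y * x" using xy by (intro mult_left_mono) auto
    moreover have "y * y * y \<le> x * x * y" using xy by (intro mult_mono) auto
    moreover have "0 \<le> x * x * y" using xy by auto
    ultimately show ?thesis
      by (simp add: u power3_eq_cube power2_eq_square algebra_simps)
  qed
  have M0: "M \<ge> 0" using real[of 0] by (auto intro: order_trans[OF norm_ge_zero])
  have C0: "C \<ge> 0" using growth[of 0] by (auto intro: order_trans[OF norm_ge_zero])
  define u where "u = csqrt z"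
  have uz: "u\<^sup>2 = z" by (simp add: u_def)
  have u: "0 \<le> Im u" "Im u \<le> Re u"
  proof -
    have ru: "Re u \<ge> 0" using csqrt_principal[of z] by (auto simp: u_def)
    have "Im z = 2 * Re u * Im u" "Re z = (Re u)\<^sup>2 - (Im u)\<^sup>2"
      unfolding uz[symmetric] by (simp_all add: power2_eq_square)
    with z have a: "0 \<le> Re u * Im u" "(Im u)\<^sup>2 \<le> (Re u)\<^sup>2" by linarith+
    show "0 \<le> Im u"
    proof (cases "Re u = 0")
      case False
      then show ?thesis using a(1) ru by (simp add: zero_le_mult_iff)
    next
      case True
      then show ?thesis using a(2) by simp
    qed
    then show "Im u \<le> Re u" using a(2) ru by (simp add: power2_le_iff_abs_le)
  qed
  \<comment> \<open>\<open>\<delta>\<close> scales the cubic damping and tends to 0 at the end;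
    \<open>\<epsilon>\<close> makes the target positive even for \<open>M = 0\<close>, so that a
    radius with small values on the arc exists.\<close>
  have step: "norm (f z) * exp (- \<delta> * Re (p u)) \<le> M + \<epsilon>" if \<delta>: "\<delta> > 0" and \<epsilon>: "\<epsilon> > 0" for \<delta> \<epsilon> :: real
  proof -
    have "((\<lambda>R. C * exp (\<bar>A\<bar> * R\<^sup>2 - \<delta> * (R / 2) ^ 3)) \<longlongrightarrow> 0) at_top"
      using \<delta> by real_asymp
    moreover have "M + \<epsilon> > 0" using M0 \<epsilon> by simp
    ultimately have "\<forall>\<^sub>F R in at_top. C * exp (\<bar>A\<bar> * R\<^sup>2 - \<delta> * (R / 2) ^ 3) < M + \<epsilon>"
      by (rule order_tendstoD)
    then have "\<forall>\<^sub>F R in at_top. C * exp (\<bar>A\<bar> * R\<^sup>2 - \<delta> * (R / 2) ^ 3) < M + \<epsilon> \<and> R \<ge> norm u"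
      by (intro eventually_conj eventually_ge_at_top)
    then obtain R where R: "C * exp (\<bar>A\<bar> * R\<^sup>2 - \<delta> * (R / 2) ^ 3) < M + \<epsilon>" "R \<ge> norm u"
      by (auto simp: eventually_at_top_linorder)
    define S where "S = {w. 0 \<le> Im w} \<inter> {w. Im w \<le> Re w} \<inter> cball 0 R"
    define T where "T = {w. 0 < Im w} \<inter> {w. Im w < Re w} \<inter> ball 0 R"
    have "closed S" unfolding S_def
      by (intro closed_Int closed_Collect_le closed_cball continuous_intros)
    have "open T" unfolding T_def
      by (intro open_Int open_Collect_less open_ball continuous_intros)
    then have TS: "T \<subseteq> interior S"
      by (intro interior_maximal) (auto simp: S_def T_def)
    have "norm (f (u\<^sup>2) * exp (- of_real \<delta> * p u)) \<le> M + \<epsilon>"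
    proof (rule maximum_modulus_frontier[where S = S and f = "\<lambda>u. f (u\<^sup>2) * exp (- of_real \<delta> * p u)"])
      have "(\<lambda>u. f (u\<^sup>2)) holomorphic_on UNIV"
        by (intro holomorphic_compose_UNIV[OF f] holomorphic_intros)
      then have h: "(\<lambda>u. f (u\<^sup>2) * exp (- of_real \<delta> * p u)) holomorphic_on UNIV"
        unfolding p_def by (intro holomorphic_intros)
      then show "(\<lambda>u. f (u\<^sup>2) * exp (- of_real \<delta> * p u)) holomorphic_on interior S"
        by (rule holomorphic_on_subset) auto
      show "continuous_on (closure S) (\<lambda>u. f (u\<^sup>2) * exp (- of_real \<delta> * p u))"
        using h by (intro holomorphic_on_imp_continuous_on) (auto intro: holomorphic_on_subset)
      show "bounded S" by (rule bounded_subset[OF bounded_cball[of 0 R]]) (auto simp: S_def)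
      show "u \<in> S" using u R by (auto simp: S_def)
      fix w assume "w \<in> frontier S"
      then have wS: "w \<in> S" and wT: "w \<notin> T"
        using TS \<open>closed S\<close> by (auto simp: frontier_def closure_closed)
      then have w: "0 \<le> Im w" "Im w \<le> Re w" "norm w \<le> R" by (auto simp: S_def)
      have nw: "norm w \<le> 2 * Re w" using cmod_le[of w] w by auto
      have cube: "Re (p w) \<ge> (norm w / 2) ^ 3"
        using Rp[OF w(1,2)] power_mono[of "norm w / 2" "Re w" 3] nw by auto
      then have cube0: "Re (p w) \<ge> 0" by (meson divide_nonneg_nonneg norm_ge_zero order_trans zero_le_numeral zero_le_power)
      have E: "norm (exp (- of_real \<delta> * p w)) = exp (- \<delta> * Re (p w))" by simp
      have E1: "exp (- \<delta> * Re (p w)) \<le> 1" using cube0 \<delta> by simp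
      have *: "norm (f (w\<^sup>2)) * exp (- \<delta> * Re (p w)) \<le> M + \<epsilon>"
      proof -
        \<comment> \<open>Squaring maps the two sides of the sector onto the half-axes, where the
          hypotheses apply; on the arc the damping beats the growth by the choice of
          \<open>R\<close>.\<close>
        consider "Im w = 0" | "Im w = Re w" | "norm w = R" using wT w by (auto simp: T_def)
        then show ?thesis
        proof cases
          case 1
          then have "w\<^sup>2 = of_real ((Re w)\<^sup>2)" by (simp add: complex_eq_iff power2_eq_square)
          then have "norm (f (w\<^sup>2)) \<le> M" using real[of "(Re w)\<^sup>2"] by simp
          then have "norm (f (w\<^sup>2)) * exp (- \<delta> * Re (p w)) \<le> M * 1" using E1 M0 by (intro mult_mono) auto
          then show ?thesis using \<epsilon> by simp
        next
          case 2
          then have "w\<^sup>2 = \<i> * of_real (2 * (Re w)\<^sup>2)" by (simp add: complex_eq_iff power2_eq_square)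
          then have "norm (f (w\<^sup>2)) \<le> M" using imag[of "2 * (Re w)\<^sup>2"] by simp
          then have "norm (f (w\<^sup>2)) * exp (- \<delta> * Re (p w)) \<le> M * 1" using E1 M0 by (intro mult_mono) auto
          then show ?thesis using \<epsilon> by simp
        next
          case 3
          have "norm (f (w\<^sup>2)) \<le> C * exp (A * norm (w\<^sup>2))" by (rule growth)
          also have "\<dots> \<le> C * exp (\<bar>A\<bar> * R\<^sup>2)"
            using C0 3 by (intro mult_left_mono) (auto simp: norm_power intro!: mult_right_mono)
          finally have "norm (f (w\<^sup>2)) * exp (- \<delta> * Re (p w)) \<le> (C * exp (\<bar>A\<bar> * R\<^sup>2)) * exp (- \<delta> * (R / 2) ^ 3)"
            using cube 3 \<delta> C0 by (intro mult_mono) auto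
          also have "\<dots> = C * exp (\<bar>A\<bar> * R\<^sup>2 - \<delta> * (R / 2) ^ 3)"
            by (simp add: mult.assoc flip: exp_add)
          finally show ?thesis using R by simp
        qed
      qed
      then show "norm (f (w\<^sup>2) * exp (- of_real \<delta> * p w)) \<le> M + \<epsilon>"
        unfolding norm_mult E .
    qed
    then show ?thesis by (simp add: norm_mult uz)
  qed
  have "norm (f z) \<le> M + \<epsilon>" if \<epsilon>: "\<epsilon> > 0" for \<epsilon>
  proof (rule tendsto_upperbound)
    show "((\<lambda>\<delta>. norm (f z) * exp (- \<delta> * Re (p u))) \<longlongrightarrow> norm (f z)) (at_right 0)"
      by (auto intro!: tendsto_eq_intros)
    show "\<forall>\<^sub>F \<delta> in at_right 0. norm (f z) * exp (- \<delta> * Re (p u)) \<le> M + \<epsilon>"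
      using eventually_at_right_less[of "0::real"] by eventually_elim (rule step[OF _ \<epsilon>])
  qed auto
  then show ?thesis by (rule field_le_epsilon)
qed

text \<open>Upgrades some bound \<open>K\<close> to the boundary bound \<open>M\<close>. The divisor
  \<open>1 - \<i> * \<eta> * z\<close> has modulus at least 1 on the half plane and forces decay at
  infinity, so the maximum principle applies to half discs; then \<open>\<eta>\<close> tends to
  0.\<close>

lemma bounded_half_plane:
  assumes f: "f holomorphic_on UNIV"
    and bounded: "\<And>z. Im z \<ge> 0 \<Longrightarrow> norm (f z) \<le> K"
    and real: "\<And>x. norm (f (of_real x)) \<le> M"
    and z: "Im z \<ge> 0"
  shows "norm (f z) \<le> M"
proof -
  have M0: "M \<ge> 0" using real[of 0] by (auto intro: order_trans[OF norm_ge_zero])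
  have step: "norm (f z) \<le> (M + \<epsilon>) * norm (1 - \<i> * of_real \<eta> * z)" if \<eta>: "\<eta> > 0" and \<epsilon>: "\<epsilon> > 0" for \<eta> \<epsilon> :: real
  proof -
    have den: "norm (1 - \<i> * of_real \<eta> * w) \<ge> max 1 (\<eta> * norm w)" if "Im w \<ge> 0" for w
    proof -
      have sq: "(norm (1 - \<i> * of_real \<eta> * w))\<^sup>2 = 1 + 2 * \<eta> * Im w + (\<eta> * norm w)\<^sup>2"
        unfolding power_mult_distrib cmod_power2 by (simp add: power2_eq_square algebra_simps)
      have "norm (1 - \<i> * of_real \<eta> * w) \<ge> 1"
        by (rule power2_le_imp_le) (use sq that \<eta> in auto)
      moreover have "norm (1 - \<i> * of_real \<eta> * w) \<ge> \<eta> * norm w"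
        by (rule power2_le_imp_le) (use sq that \<eta> in auto)
      ultimately show ?thesis by simp
    qed
    have nz: "1 - \<i> * of_real \<eta> * w \<noteq> 0" if "Im w \<ge> 0" for w
      using den[OF that] by auto
    \<comment> \<open>On the arc the divisor has modulus at least \<open>\<eta> * R\<close>, and
      this radius makes \<open>\<bar>K\<bar> / (\<eta> * R)\<close> at most
      \<open>\<epsilon>\<close>.\<close>
    define R where "R = max (norm z) (\<bar>K\<bar> / (\<eta> * \<epsilon>))"
    define S where "S = {w. 0 \<le> Im w} \<inter> cball 0 R"
    define T where "T = {w. 0 < Im w} \<inter> ball 0 R"
    have "closed S" unfolding S_def
      by (intro closed_Int closed_Collect_le closed_cball continuous_intros)
    have "open T" unfolding T_def
      by (intro open_Int open_Collect_less open_ball continuous_intros)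
    then have TS: "T \<subseteq> interior S"
      by (intro interior_maximal) (auto simp: S_def T_def)
    have hS: "(\<lambda>w. f w / (1 - \<i> * of_real \<eta> * w)) holomorphic_on S"
      by (intro holomorphic_intros holomorphic_on_subset[OF f]) (auto simp: S_def dest: nz)
    have "norm (f z / (1 - \<i> * of_real \<eta> * z)) \<le> M + \<epsilon>"
    proof (rule maximum_modulus_frontier[where S = S and f = "\<lambda>w. f w / (1 - \<i> * of_real \<eta> * w)"])
      show "(\<lambda>w. f w / (1 - \<i> * of_real \<eta> * w)) holomorphic_on interior S"
        by (rule holomorphic_on_subset[OF hS interior_subset])
      show "continuous_on (closure S) (\<lambda>w. f w / (1 - \<i> * of_real \<eta> * w))"
        using hS \<open>closed S\<close> by (simp add: closure_closed holomorphic_on_imp_continuous_on)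
      show "bounded S" by (rule bounded_subset[OF bounded_cball[of 0 R]]) (auto simp: S_def)
      show "z \<in> S" using z by (auto simp: S_def R_def)
      fix w assume "w \<in> frontier S"
      then have wS: "w \<in> S" and wT: "w \<notin> T"
        using TS \<open>closed S\<close> by (auto simp: frontier_def closure_closed)
      then have w: "0 \<le> Im w" "norm w \<le> R" by (auto simp: S_def)
      consider "Im w = 0" | "norm w = R" using wT w by (auto simp: T_def)
      then show "norm (f w / (1 - \<i> * of_real \<eta> * w)) \<le> M + \<epsilon>"
      proof cases
        case 1
        then have "w = of_real (Re w)" by (simp add: complex_eq_iff)
        then have "norm (f w) \<le> M" using real[of "Re w"] by simp
        then have "norm (f w) / norm (1 - \<i> * of_real \<eta> * w) \<le> M / 1"
          using den[OF w(1)] M0 by (intro frac_le) auto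
        then show ?thesis using \<epsilon> by (simp add: norm_divide)
      next
        case 2
        have "norm (f w) \<le> \<bar>K\<bar>" using bounded[OF w(1)] by simp
        also have "\<bar>K\<bar> \<le> \<epsilon> * (\<eta> * R)"
        proof -
          have "\<bar>K\<bar> / (\<eta> * \<epsilon>) \<le> R" by (simp add: R_def)
          then show ?thesis using \<eta> \<epsilon> by (simp add: field_simps)
        qed
        also have "\<dots> \<le> \<epsilon> * norm (1 - \<i> * of_real \<eta> * w)"
          using den[OF w(1)] 2 \<epsilon> by (intro mult_left_mono) auto
        finally have "norm (f w) / norm (1 - \<i> * of_real \<eta> * w) \<le> \<epsilon>"
          using nz[OF w(1)] by (simp add: field_simps)
        then show ?thesis using M0 by (simp add: norm_divide)
      qed
    qed
    then show ?thesis using nz[OF z] by (simp add: norm_divide field_simps)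
  qed
  have "norm (f z) \<le> M + \<epsilon>" if \<epsilon>: "\<epsilon> > 0" for \<epsilon>
  proof (rule tendsto_lowerbound)
    show "((\<lambda>\<eta>. (M + \<epsilon>) * norm (1 - \<i> * of_real \<eta> * z)) \<longlongrightarrow> M + \<epsilon>) (at_right 0)"
      by (auto intro!: tendsto_eq_intros)
    show "\<forall>\<^sub>F \<eta> in at_right 0. norm (f z) \<le> (M + \<epsilon>) * norm (1 - \<i> * of_real \<eta> * z)"
      using eventually_at_right_less[of "0::real"] by eventually_elim (rule step[OF _ \<epsilon>])
  qed auto
  then show ?thesis by (rule field_le_epsilon)
qed

text \<open>The factor \<open>exp (\<i> * (1 + \<epsilon>) * z)\<close> has modulus 1 on the real
  axis and absorbs the growth on the positive imaginary axis, so the quadrant principle applies to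
  both upper quadrants, to the second one after a rotation. It yields a bound depending on
  \<open>\<epsilon>\<close> through \<open>C\<close>; \<open>bounded_half_plane\<close> replaces it
  by \<open>M\<close> before \<open>\<epsilon>\<close> tends to 0.\<close>

lemma exponential_type_upper_bound:
  assumes D: "D holomorphic_on UNIV"
    and growth: "\<And>\<epsilon>. \<epsilon> > 0 \<Longrightarrow> \<exists>C. \<forall>z. norm (D z) \<le> C * exp ((1 + \<epsilon>) * norm z)"
    and real: "\<And>x. norm (D (of_real x)) \<le> M"
    and z: "Im z \<ge> 0"
  shows "norm (D z) \<le> M * exp (Im z)"
proof -
  have step: "norm (D z) \<le> M * exp ((1 + \<epsilon>) * Im z)" if \<epsilon>: "\<epsilon> > 0" for \<epsilon> :: real
  proof -
    obtain C where C: "\<And>z. norm (D z) \<le> C * exp ((1 + \<epsilon>) * norm z)" using growth[OF \<epsilon>] by blast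
    have C0: "C \<ge> 0" using C[of 0] by (auto intro: order_trans[OF norm_ge_zero])
    define F where "F = (\<lambda>z. D z * exp (\<i> * of_real (1 + \<epsilon>) * z))"
    have nF: "norm (F z) = norm (D z) * exp (- ((1 + \<epsilon>) * Im z))" for z
      by (simp add: F_def norm_mult)
    have F: "F holomorphic_on UNIV" unfolding F_def by (intro holomorphic_intros D)
    \<comment> \<open>Any finite type is admissible in the quadrant principle, so the crude factor 2
      does no harm.\<close>
    have gF: "norm (F z) \<le> C * exp (2 * (1 + \<epsilon>) * norm z)" for z
    proof -
      have "- ((1 + \<epsilon>) * Im z) \<le> (1 + \<epsilon>) * norm z"
        using abs_Im_le_cmod[of z] \<epsilon> mult_left_mono[of "- Im z" "norm z" "1 + \<epsilon>"] by auto
      then have "norm (F z) \<le> (C * exp ((1 + \<epsilon>) * norm z)) * exp ((1 + \<epsilon>) * norm z)"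
        unfolding nF using C0 by (intro mult_mono C) auto
      then show ?thesis by (simp add: algebra_simps flip: exp_add)
    qed
    have rF: "norm (F (of_real x)) \<le> max M C" for x using real[of x] by (simp add: nF)
    have iF: "norm (F (\<i> * of_real y)) \<le> max M C" if "y \<ge> 0" for y
    proof -
      have "norm (F (\<i> * of_real y)) \<le> C * exp ((1 + \<epsilon>) * y) * exp (- ((1 + \<epsilon>) * y))"
        unfolding nF using C[of "\<i> * of_real y"] that C0 by (intro mult_mono) (auto simp: norm_mult)
      also have "\<dots> = C" by (simp add: mult.assoc flip: exp_add)
      finally show ?thesis by simp
    qed
    have Fi: "(\<lambda>w. F (\<i> * w)) holomorphic_on UNIV"
      by (intro holomorphic_compose_UNIV[OF F] holomorphic_intros)
    have "norm (F z) \<le> max M C" if "Im z \<ge> 0" for z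
    proof (cases "Re z \<ge> 0")
      case True
      then show ?thesis using that by (intro phragmen_lindelof_quadrant[OF F gF rF iF]) auto
    next
      case False
      have "norm (F (\<i> * (- \<i> * z))) \<le> max M C"
      proof (rule phragmen_lindelof_quadrant[OF Fi, where z = "- \<i> * z"])
        show "norm (F (\<i> * w)) \<le> C * exp (2 * (1 + \<epsilon>) * norm w)" for w
          using gF[of "\<i> * w"] by (simp add: norm_mult)
        show "norm (F (\<i> * (\<i> * of_real y))) \<le> max M C" if "y \<ge> 0" for y
          using rF[of "- y"] by (simp flip: mult.assoc)
      qed (use False that iF in auto)
      then show ?thesis by (simp flip: mult.assoc)
    qed
    then have "norm (F z) \<le> M"
      by (rule bounded_half_plane[OF F]) (use z real in \<open>auto simp: nF\<close>)
    then have "norm (D z) * exp (- ((1 + \<epsilon>) * Im z)) * exp ((1 + \<epsilon>) * Im z) \<le> M * exp ((1 + \<epsilon>) * Im z)"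
      unfolding nF by (intro mult_right_mono) auto
    then show ?thesis by (simp add: mult.assoc flip: exp_add)
  qed
  show ?thesis
  proof (rule tendsto_lowerbound)
    show "((\<lambda>\<epsilon>. M * exp ((1 + \<epsilon>) * Im z)) \<longlongrightarrow> M * exp (Im z)) (at_right 0)"
      by (auto intro!: tendsto_eq_intros)
    show "\<forall>\<^sub>F \<epsilon> in at_right 0. norm (D z) \<le> M * exp ((1 + \<epsilon>) * Im z)"
      using eventually_at_right_less[of "0::real"] by eventually_elim (rule step)
  qed auto
qed

lemma exponential_type_bound:
  assumes D: "D holomorphic_on UNIV"
    and growth: "\<And>\<epsilon>. \<epsilon> > 0 \<Longrightarrow> \<exists>C. \<forall>z. norm (D z) \<le> C * exp ((1 + \<epsilon>) * norm z)"
    and real: "\<And>x. norm (D (of_real x)) \<le> M"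
  shows "norm (D z) \<le> M * exp \<bar>Im z\<bar>"
proof (cases "Im z \<ge> 0")
  case True
  then show ?thesis using exponential_type_upper_bound[OF D growth real, of z] by simp
next
  case False
  have "(\<lambda>w. D (- w)) holomorphic_on UNIV"
    by (intro holomorphic_compose_UNIV[OF D] holomorphic_intros)
  then have "norm (D (- (- z))) \<le> M * exp (Im (- z))"
  proof (rule exponential_type_upper_bound)
    fix \<epsilon> :: real assume "\<epsilon> > 0"
    then obtain C where "\<And>z. norm (D z) \<le> C * exp ((1 + \<epsilon>) * norm z)" using growth by blast
    then show "\<exists>C. \<forall>z. norm (D (- z)) \<le> C * exp ((1 + \<epsilon>) * norm z)"
      by (metis norm_minus_cancel)
  next
    show "norm (D (- of_real x)) \<le> M" for x using real[of "- x"] by simp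
  qed (use False in auto)
  then show ?thesis using False by simp
qed

section \<open>Division by the sine and Liouville's theorem\<close>

lemma norm_sin_ge:
  fixes z :: complex
  assumes "\<bar>Im z\<bar> \<ge> 1"
  shows "norm (sin z) \<ge> exp \<bar>Im z\<bar> / 4"
proof -
  have "exp \<bar>Im z\<bar> - exp (- \<bar>Im z\<bar>) \<le> norm (exp (\<i> * z) - exp (- (\<i> * z)))"
    using norm_triangle_ineq3[of "exp (\<i> * z)" "exp (- (\<i> * z))"] by (auto simp: abs_if split: if_splits)
  moreover have "norm (sin z) = norm (exp (\<i> * z) - exp (- (\<i> * z))) / 2"
    by (simp add: sin_exp_eq norm_divide norm_mult)
  moreover have "exp (- \<bar>Im z\<bar>) \<le> exp \<bar>Im z\<bar> / 2"
  proof -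
    have "2 \<le> 1 + 2 * \<bar>Im z\<bar>" using assms by simp
    also have "\<dots> \<le> exp (2 * \<bar>Im z\<bar>)" by (rule exp_ge_add_one_self)
    also have "\<dots> = exp \<bar>Im z\<bar> * exp \<bar>Im z\<bar>" by (simp flip: exp_add)
    finally show ?thesis by (simp add: exp_minus field_simps)
  qed
  ultimately show ?thesis by simp
qed

text \<open>On the vertical lines midway between consecutive zeros the modulus of the sine is the
  hyperbolic cosine of \<open>Im z\<close>.\<close>

lemma norm_sin_mid:
  fixes z :: complex and n :: int
  assumes "Re z = pi * of_int n + pi / 2 \<or> Re z = pi * of_int n - pi / 2"
  shows "norm (sin z) \<ge> 1"
proof -
  have "cos (Re z) = 0"
    using assms by (auto simp: cos_add cos_diff mult.commute)
  then have "(sin (Re z))\<^sup>2 = 1" using sin_cos_squared_add[of "Re z"] by simp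
  moreover have "norm (sin z) ^ 2 = (exp (2 * Im z) + inverse (exp (2 * Im z)) - 2 * cos (2 * Re z)) / 4"
    by (rule norm_sin_squared)
  moreover have "cos (2 * Re z) = -1"
    using cos_double_sin[of "Re z"] calculation(1) by simp
  moreover have "exp (2 * Im z) + inverse (exp (2 * Im z)) \<ge> 2"
  proof -
    have "a + inverse a \<ge> 2" if "a > 0" for a :: real
      using that sum_squares_ge_zero[of "a - 1" 0] by (simp add: field_simps power2_eq_square)
    then show ?thesis by simp
  qed
  ultimately have "(norm (sin z))\<^sup>2 \<ge> 1" by simp
  then show ?thesis by (metis norm_ge_zero power2_le_imp_le power_one)
qed

text \<open>The zeros of the sine are simple: near such a zero the quotient is a quotient of two
  difference quotients, and the lower one does not vanish there because its value at the zero is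
  \<open>cos z\<close>.\<close>

lemma holomorphic_quotient_sin:
  assumes D: "D holomorphic_on UNIV" and zero: "\<And>n::int. D (of_real (pi * of_int n)) = 0"
  obtains Q where "Q holomorphic_on UNIV" "\<And>z. D z = Q z * sin z"
proof -
  define Q where "Q = (\<lambda>z. if sin z = 0 then deriv D z / deriv sin z else D z / sin z)"
  have D0: "D z = 0" if "sin z = 0" for z
    using that zero by (auto simp: sin_eq_0 mult.commute)
  have dsin: "deriv sin z = cos z" for z :: complex
    by (rule DERIV_imp_deriv) (auto intro!: derivative_eq_intros)
  have "Q field_differentiable at z" for z
  proof (cases "sin z = 0")
    case False
    have "open {w::complex. sin w \<noteq> 0}"
      by (intro open_Collect_neq continuous_intros)
    moreover have "Q holomorphic_on {w. sin w \<noteq> 0}"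
    proof (rule holomorphic_transform)
      show "(\<lambda>w. D w / sin w) holomorphic_on {w. sin w \<noteq> 0}"
        by (intro holomorphic_intros holomorphic_on_subset[OF D]) auto
    qed (auto simp: Q_def)
    ultimately show ?thesis
      using False by (intro holomorphic_on_imp_differentiable_at) auto
  next
    case True
    have iso: "sin w \<noteq> 0" if "w \<in> ball z 1" "w \<noteq> z" for w
    proof
      assume "sin w = 0"
      with True obtain m n :: int where "w = of_real (of_int m * pi)" "z = of_real (of_int n * pi)"
        by (auto simp: sin_eq_0)
      then have "z - w = of_real (of_int (n - m) * pi)" "n \<noteq> m"
        using that by (auto simp: left_diff_distrib)
      then have "dist z w = \<bar>of_int (n - m)\<bar> * pi" "n \<noteq> m"
        by (simp_all add: dist_norm abs_mult del: of_real_mult of_real_of_int_eq)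
      then have "dist z w \<ge> 1 * pi"
        by (simp only:) (intro mult_right_mono, auto)
      then show False using that pi_gt3 by simp
    qed
    have h1: "(\<lambda>w. if w = z then deriv D z else (D w - D z) / (w - z)) holomorphic_on ball z 1"
      by (rule pole_lemma_open[OF holomorphic_on_subset[OF D]]) auto
    have h2: "(\<lambda>w. if w = z then deriv sin z else (sin w - sin z) / (w - z)) holomorphic_on ball z 1"
      by (rule pole_lemma_open) (auto intro!: holomorphic_intros)
    have cz: "cos z \<noteq> 0" using True sin_cos_squared_add[of z] by auto
    have "Q holomorphic_on ball z 1"
    proof (rule holomorphic_transform[OF holomorphic_on_divide[OF h1 h2]])
      show "(if w = z then deriv sin z else (sin w - sin z) / (w - z)) \<noteq> 0" if "w \<in> ball z 1" for w
        using iso[OF that] True cz by (auto simp: dsin)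
      show "(if w = z then deriv D z else (D w - D z) / (w - z)) /
           (if w = z then deriv sin z else (sin w - sin z) / (w - z)) = Q w" if "w \<in> ball z 1" for w
        using iso[OF that] True D0 by (auto simp: Q_def)
    qed
    then show ?thesis by (intro holomorphic_on_imp_differentiable_at[of Q "ball z 1"]) auto
  qed
  then have "Q holomorphic_on UNIV" by (simp add: holomorphic_on_def field_differentiable_at_within)
  then show ?thesis by (rule that) (auto simp: Q_def D0)
qed

text \<open>The quotient by the sine is bounded: for \<open>\<bar>Im z\<bar> \<ge> 1\<close> the
  sine is comparable to \<open>exp \<bar>Im z\<bar>\<close>, and between these half planes the
  maximum principle on rectangles with sides on the midlines avoids the zeros of the sine.\<close>

lemma sine_type_multiple:
  assumes D: "D holomorphic_on UNIV" and zero: "\<And>n::int. D (of_real (pi * of_int n)) = 0"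
    and bound: "\<And>z. norm (D z) \<le> M * exp \<bar>Im z\<bar>"
  shows "\<exists>c. \<forall>z. D z = c * sin z"
proof -
  obtain Q where Q: "Q holomorphic_on UNIV" and DQ: "\<And>z. D z = Q z * sin z"
    using holomorphic_quotient_sin[OF D zero] by metis
  have M0: "M \<ge> 0" using bound[of 0] by (auto intro: order_trans[OF norm_ge_zero])
  have far: "norm (Q z) \<le> 4 * M" if "\<bar>Im z\<bar> \<ge> 1" for z
  proof -
    have s: "norm (sin z) \<ge> exp \<bar>Im z\<bar> / 4" by (rule norm_sin_ge[OF that])
    then have "sin z \<noteq> 0" by auto
    then have "norm (Q z) = norm (D z) / norm (sin z)" by (simp add: DQ norm_mult)
    also have "\<dots> \<le> (M * exp \<bar>Im z\<bar>) / (exp \<bar>Im z\<bar> / 4)"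
      using s M0 by (intro frac_le bound) auto
    finally show ?thesis by simp
  qed
  have side: "norm (Q z) \<le> M * exp 1" if "Re z = pi * of_int n + pi / 2 \<or> Re z = pi * of_int n - pi / 2" "\<bar>Im z\<bar> \<le> 1" for z and n :: int
  proof -
    have s: "norm (sin z) \<ge> 1" by (rule norm_sin_mid[OF that(1)])
    then have "sin z \<noteq> 0" by auto
    then have "norm (Q z) = norm (D z) / norm (sin z)" by (simp add: DQ norm_mult)
    also have "\<dots> \<le> (M * exp 1) / 1"
      using s M0 that by (intro frac_le order_trans[OF bound] mult_left_mono) auto
    finally show ?thesis by simp
  qed
  have "norm (Q z) \<le> max (4 * M) (M * exp 1)" for z
  proof (cases "\<bar>Im z\<bar> \<ge> 1")
    case True
    then show ?thesis using far[of z] by simp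
  next
    case False
    \<comment> \<open>Rounding to the nearest integer puts \<open>Re z\<close> within pi/2 of
      \<open>pi * n\<close>, so \<open>z\<close> lies in the rectangle between the adjacent
      midlines.\<close>
    define n where "n = \<lfloor>Re z / pi + 1 / 2\<rfloor>"
    define a where "a = Complex (pi * of_int n - pi / 2) (-1)"
    define b where "b = Complex (pi * of_int n + pi / 2) 1"
    have n: "of_int n \<le> Re z / pi + 1 / 2" "Re z / pi + 1 / 2 < of_int n + 1"
      unfolding n_def by linarith+
    have zb: "z \<in> cbox a b"
      using False n by (auto simp: in_cbox_complex_iff a_def b_def field_simps)
    show ?thesis
    proof (rule maximum_modulus_frontier[where S = "cbox a b" and f = Q])
      fix w assume "w \<in> frontier (cbox a b)"
      then have "w \<in> cbox a b" "w \<notin> box a b"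
        by (auto simp: frontier_cbox)
      then have "\<bar>Im w\<bar> \<le> 1" "\<bar>Im w\<bar> = 1 \<or> Re w = pi * of_int n + pi / 2 \<or> Re w = pi * of_int n - pi / 2"
        by (auto simp: in_cbox_complex_iff in_box_complex_iff a_def b_def)
      then show "norm (Q w) \<le> max (4 * M) (M * exp 1)"
        using far[of w] side[of w n] by fastforce
    qed (use zb Q in \<open>auto intro!: holomorphic_on_imp_continuous_on intro: holomorphic_on_subset\<close>)
  qed
  then have "bounded (range Q)" by (auto simp: bounded_iff)
  then obtain c where "\<And>z. Q z = c"
    using Liouville_theorem[OF Q] by (auto simp: constant_on_def)
  then show ?thesis using DQ by auto
qed

section \<open>Termwise integration of the partial fractions\<close>

text \<open>The kernel \<open>h\<close> at complex arguments, since the resummation evaluates it at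
  plus and minus \<open>2 * \<i> * y\<close>.\<close>

definition hker :: "nat \<Rightarrow> real \<Rightarrow> complex \<Rightarrow> complex" where
  "hker k v t = exp ((1 - of_real v) * t) / (exp t - (-1) ^ k)"

text \<open>
  The deviation of the limit in \<open>psum_tendsto\<close> from \<open>hker\<close>.
\<close>
definition corr :: "nat \<Rightarrow> real \<Rightarrow> complex" where
  "corr k v = (if v = 1 then (-1) ^ k / 2 else 0)"

abbreviation (input) mhker :: "nat \<Rightarrow> real \<Rightarrow> complex \<Rightarrow> real \<Rightarrow> complex" where
  "mhker k v s t \<equiv> complex_of_real t powr (s - 1) * hker k v (of_real t)"

abbreviation (input) mkern :: "nat \<Rightarrow> real \<Rightarrow> complex \<Rightarrow> real \<Rightarrow> real \<Rightarrow> complex" where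
  "mkern k v s y t \<equiv> mhker k v s t * of_real ((2 * y)\<^sup>2 / (t\<^sup>2 + (2 * y)\<^sup>2))"

abbreviation (input) mhquad :: "nat \<Rightarrow> real \<Rightarrow> complex \<Rightarrow> real \<Rightarrow> real \<Rightarrow> complex" where
  "mhquad k v s a t \<equiv> complex_of_real t powr (s - 1) * (hker k v (of_real t) * (1 / (of_real t ^ 2 + of_real a ^ 2)))"

abbreviation (input) mpsum :: "nat \<Rightarrow> real \<Rightarrow> complex \<Rightarrow> real \<Rightarrow> nat \<Rightarrow> real \<Rightarrow> complex" where
  "mpsum k v s a n t \<equiv> complex_of_real t powr (s - 1) * ((psum k (of_real v) (of_real t) n - corr k v) * (1 / (of_real t ^ 2 + of_real a ^ 2)))"

lemma exp_real_neq:
  assumes "t > 0"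
  shows "exp (complex_of_real t) \<noteq> (-1) ^ k"
proof
  assume "exp (complex_of_real t) = (-1) ^ k"
  then have "norm (exp (complex_of_real t)) = 1" by (simp add: norm_power)
  then show False using assms by simp
qed

lemma hker_continuous: "continuous_on {0<..} (\<lambda>t. hker k v (complex_of_real t))"
  unfolding hker_def using exp_real_neq by (intro continuous_intros) auto

lemma norm_hker:
  assumes "t > 0"
  shows "norm (hker k v (of_real t)) = exp ((1 - v) * t) / (exp t - (-1) ^ k)"
proof -
  have "norm (exp (complex_of_real t) - (-1) ^ k) = \<bar>exp t - (-1) ^ k\<bar>" for k
  proof -
    have "exp (complex_of_real t) - (-1) ^ k = of_real (exp t - (-1) ^ k)" by (simp add: exp_of_real)
    then show ?thesis by (simp only: norm_of_real)
  qed
  moreover have "\<bar>exp t - (-1) ^ k\<bar> = exp t - (-1) ^ k" for k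
    using assms by (cases "even k") (auto simp: abs_of_nonneg intro!: add_nonneg_nonneg)
  ultimately show ?thesis by (simp add: hker_def norm_divide)
qed

text \<open>At 0 the kernel has a simple pole for \<open>k = 0\<close> and none for
  \<open>k = 1\<close>; at infinity it is of order \<open>exp (- v * t)\<close>, which beats every
  power.\<close>

lemma hker_bound:
  assumes k: "k \<le> 1" and v: "0 < v" "v \<le> 1"
  shows "\<exists>C\<ge>0. \<forall>t>0. (t \<le> 1 \<longrightarrow> norm (hker k v (of_real t)) \<le> C * t powr - (1 - real k))
                     \<and> (1 \<le> t \<longrightarrow> norm (hker k v (of_real t)) \<le> C * t powr - d)"
proof -
  have "((\<lambda>t. 2 * exp (- v * t) * t powr d) \<longlongrightarrow> 0) at_top" using v by real_asymp
  then have "\<forall>\<^sub>F t in at_top. 2 * exp (- v * t) * t powr d < 1" by (rule order_tendstoD) simp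
  then obtain T where T: "\<And>t. t \<ge> T \<Longrightarrow> 2 * exp (- v * t) * t powr d < 1" by (auto simp: eventually_at_top_linorder)
  have "compact ((\<lambda>t. 2 * exp (- v * t) * t powr d) ` {1..max 1 T})"
    by (intro compact_continuous_image continuous_intros) auto
  then obtain B where "\<forall>t\<in>{1..max 1 T}. norm (2 * exp (- v * t) * t powr d) \<le> B"
    by (auto dest!: compact_imp_bounded simp: bounded_iff)
  then have B: "\<And>t. t \<in> {1..max 1 T} \<Longrightarrow> \<bar>2 * exp (- v * t) * t powr d\<bar> \<le> B"
    by simp
  have all: "2 * exp (- v * t) * t powr d \<le> max 1 B" if "t \<ge> 1" for t
    using T[of t] B[of t] that by (cases "t \<ge> T") auto
  define C where "C = max (exp 1) (max 1 B)"
  have k01: "k = 0 \<or> k = 1" using k by auto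
  show ?thesis
  proof (intro exI[of _ C] conjI allI impI)
    show "C \<ge> 0" by (simp add: C_def le_max_iff_disj)
  next
    fix t :: real assume t: "t > 0" "t \<le> 1"
    have e: "exp ((1 - v) * t) \<le> exp 1"
      using t v mult_mono[of "1 - v" 1 t 1] by simp
    have "norm (hker k v (of_real t)) \<le> exp 1 * t powr - (1 - real k)"
    proof (cases "k = 0")
      case True
      have "t \<le> exp t - 1" using exp_ge_add_one_self[of t] by linarith
      then have "exp ((1 - v) * t) / (exp t - 1) \<le> exp 1 / t" using e t by (intro frac_le) auto
      then show ?thesis using norm_hker[OF t(1), of k v] True t by (simp add: powr_minus divide_inverse)
    next
      case False
      then have "k = 1" using k01 by auto
      have "exp ((1 - v) * t) / (exp t + 1) \<le> exp 1 / 1" using e t by (intro frac_le) auto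
      then show ?thesis using norm_hker[OF t(1), of k v] \<open>k = 1\<close> t by simp
    qed
    also have "\<dots> \<le> C * t powr - (1 - real k)" by (intro mult_right_mono) (auto simp: C_def)
    finally show "norm (hker k v (of_real t)) \<le> C * t powr - (1 - real k)" .
  next
    fix t :: real assume t: "t > 0" "1 \<le> t"
    have "2 \<le> exp t" using exp_ge_add_one_self[of t] t by linarith
    then have d: "exp t / 2 \<le> exp t - (-1) ^ k" using k01 by auto
    have "norm (hker k v (of_real t)) \<le> exp ((1 - v) * t) / (exp t / 2)"
      unfolding norm_hker[OF t(1), of k v] by (intro frac_le d) auto
    also have "\<dots> = 2 * exp (- v * t)" by (simp add: exp_diff left_diff_distrib exp_minus field_simps)
    also have "\<dots> = (2 * exp (- v * t) * t powr d) * t powr - d" using t by (simp add: powr_minus)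
    also have "\<dots> \<le> C * t powr - d" using all[OF t(2)] by (intro mult_right_mono) (auto simp: C_def)
    finally show "norm (hker k v (of_real t)) \<le> C * t powr - d" .
  qed
qed

text \<open>Collects the bounds of both cases in \<open>v\<close>. The exponent \<open>e\<close> is
  the decay exploited at infinity: order 1 is required only for \<open>k = 0\<close>,
  \<open>v < 1\<close>, where \<open>Re s\<close> may exceed 2, and at \<open>v = 1\<close> the
  constant \<open>corr k v\<close> rules it out.\<close>

lemma psum_dominated:
  assumes k: "k \<le> 1" and v: "0 < v" "v \<le> 1"
  defines "e \<equiv> (if k = 0 \<and> v < 1 then 1 else 0 :: real)"
  shows "\<exists>C\<ge>0. \<forall>t>0. \<forall>n. (t \<le> 1 \<longrightarrow> norm (psum k (of_real v) (of_real t) n - corr k v) \<le> C * t powr - (1 - real k))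
                     \<and> (1 \<le> t \<longrightarrow> norm (psum k (of_real v) (of_real t) n - corr k v) \<le> C * t powr - e)"
proof -
  have k01: "k = 0 \<or> k = 1" using k by auto
  have c: "norm ((1 - of_nat k) / complex_of_real t) = (1 - real k) / t" if "t > 0" for t
    using k01 that by (auto simp: norm_divide)
  show ?thesis
  proof (cases "v < 1")
    case True
    obtain C where C: "\<And>t n. t > 0 \<Longrightarrow> norm (psum k (of_real v) (of_real t) n - (1 - of_nat k) / of_real t) \<le> C / (t + 1)"
      using psum_bound_interior[OF k v(1) True] by blast
    have C0: "C \<ge> 0" using order_trans[OF norm_ge_zero C[of 1 0]] by simp
    have main: "norm (psum k (of_real v) (of_real t) n - corr k v) \<le> (1 - real k) / t + C / (t + 1)" if "t > 0" for t n
    proof -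
      have "norm (psum k (of_real v) (of_real t) n - corr k v) \<le> norm ((1 - of_nat k) / complex_of_real t) + norm (psum k (of_real v) (of_real t) n - (1 - of_nat k) / of_real t)"
        using True norm_triangle_ineq[of "(1 - of_nat k) / complex_of_real t" "psum k (of_real v) (of_real t) n - (1 - of_nat k) / of_real t"]
        by (simp add: corr_def)
      then show ?thesis using C[OF that, of n] c[OF that] by linarith
    qed
    show ?thesis
    proof (intro exI[of _ "1 + C"] conjI allI impI)
      fix t :: real and n assume t: "t > 0" "t \<le> 1"
      have "C / (t + 1) \<le> C / 1" using C0 t by (intro divide_left_mono) auto
      then have C1: "C / (t + 1) \<le> C" by simp
      have "C * 1 \<le> C * (1 / t)" using C0 t by (intro mult_left_mono) auto
      then have C2: "C \<le> C / t" by simp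
      have "(1 - real k) / t + C / (t + 1) \<le> (1 + C) * t powr - (1 - real k)"
        using k01 C1 C2 t by (auto simp: powr_minus divide_inverse algebra_simps)
      then show "norm (psum k (of_real v) (of_real t) n - corr k v) \<le> (1 + C) * t powr - (1 - real k)"
        using main[OF t(1), of n] by linarith
    next
      fix t :: real and n assume t: "t > 0" "1 \<le> t"
      have "C / (t + 1) \<le> C / t" using C0 t by (intro divide_left_mono) auto
      moreover have "C / t \<le> C / 1" using C0 t by (intro divide_left_mono) auto
      ultimately have "(1 - real k) / t + C / (t + 1) \<le> (1 + C) * t powr - e"
        using k01 t True by (auto simp: powr_minus divide_inverse algebra_simps e_def)
      then show "norm (psum k (of_real v) (of_real t) n - corr k v) \<le> (1 + C) * t powr - e"
        using main[OF t(1), of n] by linarith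
    qed (use C0 in auto)
  next
    case False
    then have v1: "v = 1" using v by simp
    obtain C where C: "\<And>t n. t > 0 \<Longrightarrow> norm (psum k (of_real v) (of_real t) n - (1 - of_nat k) / of_real t) \<le> C"
      using psum_bound_endpoint[OF k] v1 by auto
    have C0: "C \<ge> 0" using order_trans[OF norm_ge_zero C[of 1 0]] by simp
    have main: "norm (psum k (of_real v) (of_real t) n - corr k v) \<le> (1 - real k) / t + C + 1/2" if "t > 0" for t n
    proof -
      have "norm (corr k v) = 1/2" using v1 by (simp add: corr_def norm_divide norm_power)
      moreover have "norm (psum k (of_real v) (of_real t) n - corr k v) \<le> norm ((1 - of_nat k) / complex_of_real t) + norm (psum k (of_real v) (of_real t) n - (1 - of_nat k) / of_real t) + norm (corr k v)"
        using norm_triangle_ineq[of "(1 - of_nat k) / complex_of_real t" "psum k (of_real v) (of_real t) n - (1 - of_nat k) / of_real t"]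
          norm_triangle_ineq4[of "psum k (of_real v) (of_real t) n" "corr k v"] by simp
      ultimately show ?thesis using C[OF that, of n] c[OF that] by linarith
    qed
    show ?thesis
    proof (intro exI[of _ "2 + C"] conjI allI impI)
      fix t :: real and n assume t: "t > 0" "t \<le> 1"
      have "C * 1 \<le> C * (1 / t)" "1/2 * 1 \<le> 1/2 * (1 / t)" using C0 t by (intro mult_left_mono; auto)+
      then have C2: "C \<le> C / t" "1/2 \<le> 1/2 * (1 / t)" by simp_all
      have "(1 - real k) / t + C + 1/2 \<le> (2 + C) * t powr - (1 - real k)"
      proof (cases "k = 0")
        case True
        have "(2 + C) * t powr - (1 - real k) = 2 / t + C / t" using True t by (simp add: powr_minus divide_inverse algebra_simps)
        moreover have "1 / t + 1/2 * (1/t) \<le> 2 / t" using t by (simp add: field_simps)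
        ultimately show ?thesis using C2 True by simp
      next
        case False
        then show ?thesis using k01 t by auto
      qed
      then show "norm (psum k (of_real v) (of_real t) n - corr k v) \<le> (2 + C) * t powr - (1 - real k)"
        using main[OF t(1), of n] by linarith
    next
      fix t :: real and n assume t: "t > 0" "1 \<le> t"
      have "t powr - e = 1" using t v1 by (simp add: e_def)
      moreover have "(1 - real k) / t \<le> 1" using k01 t by auto
      ultimately have "(1 - real k) / t + C + 1/2 \<le> (2 + C) * t powr - e"
        by (simp only: mult_1_right)
      then show "norm (psum k (of_real v) (of_real t) n - corr k v) \<le> (2 + C) * t powr - e"
        using main[OF t(1), of n] by linarith
    qed (use C0 in auto)
  qed
qed

text \<open>Factoring out \<open>exp (\<i> * y)\<close> leaves \<open>2 * \<i> * sin y\<close> for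
  \<open>k = 0\<close> and \<open>2 * cos y\<close> for \<open>k = 1\<close>. The denominator of the
  kernel at \<open>2 * \<i> * y\<close> is thus cancelled by the sine that vanishes at the
  nodes.\<close>

lemma sin_shift_eq:
  assumes "k \<le> 1"
  shows "exp (2 * \<i> * of_real y) - (-1) ^ k = 2 * (if k = 0 then \<i> else 1) * exp (\<i> * of_real y) * of_real (sin (y + pi * of_nat k / 2))"
proof -
  have e2: "exp (2 * \<i> * of_real y) = exp (\<i> * of_real y) * exp (\<i> * of_real y)" by (simp add: mult.assoc flip: exp_add)
  have e1: "exp (\<i> * of_real y) * exp (- (\<i> * of_real y)) = 1" by (simp flip: exp_add)
  have k01: "k = 0 \<or> k = 1" using assms by auto
  show ?thesis
  proof (cases "k = 0")
    case True
    have "complex_of_real (sin y) = (exp (\<i> * of_real y) - exp (- (\<i> * of_real y))) / (2 * \<i>)"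
      by (simp add: sin_exp_eq flip: sin_of_real)
    then have "2 * \<i> * exp (\<i> * of_real y) * complex_of_real (sin y) = exp (\<i> * of_real y) * (exp (\<i> * of_real y) - exp (- (\<i> * of_real y)))"
      by (simp only:) (simp add: field_simps)
    then show ?thesis using True e1 e2 by (simp add: right_diff_distrib)
  next
    case False
    then have "k = 1" using k01 by auto
    have "complex_of_real (cos y) = (exp (\<i> * of_real y) + exp (- (\<i> * of_real y))) / 2"
      by (simp add: cos_exp_eq flip: cos_of_real)
    then have "2 * exp (\<i> * of_real y) * complex_of_real (cos y) = exp (\<i> * of_real y) * (exp (\<i> * of_real y) + exp (- (\<i> * of_real y)))"
      by (simp only:) (simp add: field_simps)
    then show ?thesis using \<open>k = 1\<close> e1 e2 by (simp add: distrib_left sin_add)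
  qed
qed

lemma hker_imag:
  assumes "k \<le> 1" "sin (y + pi * of_nat k / 2) \<noteq> 0"
  shows "of_real (sin (y + pi * of_nat k / 2)) * hker k v (2 * \<i> * of_real y)
     = exp (- (\<i> * of_real ((2 * v - 1) * y))) / (2 * (if k = 0 then \<i> else 1))"
proof -
  have "exp ((1 - of_real v) * (2 * \<i> * of_real y)) = exp (- (\<i> * of_real ((2 * v - 1) * y))) * exp (\<i> * of_real y)"
    unfolding exp_add[symmetric] by (simp add: algebra_simps)
  then show ?thesis
    unfolding hker_def sin_shift_eq[OF assms(1)] using assms(2) by simp
qed

text \<open>The odd and even parts of the kernel in \<open>y\<close>; they give rise to the cosine
  and the sine in \<open>f_fun\<close>.\<close>

lemma hker_imag_combine:
  assumes "k \<le> 1" "sin (y + pi * of_nat k / 2) \<noteq> 0"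
  shows "of_real (sin (y + pi * of_nat k / 2)) * ((hker k v (2 * \<i> * of_real y) - hker k v (- (2 * \<i> * of_real y))) / (4 * \<i>))
      = - of_real (cos ((2 * v - 1) * y - pi * of_nat k / 2)) / 4"
    and "of_real (sin (y + pi * of_nat k / 2)) * ((hker k v (2 * \<i> * of_real y) + hker k v (- (2 * \<i> * of_real y))) / 4)
      = - of_real (sin ((2 * v - 1) * y - pi * of_nat k / 2)) / 4"
proof -
  define \<theta> where "\<theta> = (2 * v - 1) * y"
  let ?s = "complex_of_real (sin (y + pi * of_nat k / 2))"
  have k01: "k = 0 \<or> k = 1" using assms by auto
  have s': "sin (- y + pi * of_nat k / 2) = - ((-1) ^ k) * sin (y + pi * of_nat k / 2)"
    using k01 by (auto simp: sin_add sin_diff)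
  have A: "?s * hker k v (2 * \<i> * of_real y) = exp (- (\<i> * of_real \<theta>)) / (2 * (if k = 0 then \<i> else 1))"
    using hker_imag[OF assms] by (simp add: \<theta>_def)
  have "of_real (sin (- y + pi * of_nat k / 2)) * hker k v (2 * \<i> * of_real (- y)) = exp (- (\<i> * of_real ((2 * v - 1) * - y))) / (2 * (if k = 0 then \<i> else 1))"
    by (rule hker_imag[OF assms(1)]) (use s' assms(2) in auto)
  moreover have "exp (- (\<i> * of_real ((2 * v - 1) * - y))) = exp (\<i> * of_real \<theta>)" by (simp add: \<theta>_def)
  moreover have "2 * \<i> * complex_of_real (- y) = - (2 * \<i> * of_real y)" by simp
  moreover have "complex_of_real (sin (- y + pi * of_nat k / 2)) = - ((-1) ^ k) * ?s" unfolding s' by simp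
  ultimately have "- ((-1) ^ k) * ?s * hker k v (- (2 * \<i> * of_real y)) = exp (\<i> * of_real \<theta>) / (2 * (if k = 0 then \<i> else 1))"
    by metis
  then have B: "?s * hker k v (- (2 * \<i> * of_real y)) = - ((-1) ^ k) * (exp (\<i> * of_real \<theta>) / (2 * (if k = 0 then \<i> else 1)))"
    using k01 by (auto simp: minus_equation_iff)
  have sn: "complex_of_real (sin \<theta>) = (exp (\<i> * of_real \<theta>) - exp (- (\<i> * of_real \<theta>))) / (2 * \<i>)"
    by (simp add: sin_exp_eq flip: sin_of_real)
  have cn: "complex_of_real (cos \<theta>) = (exp (\<i> * of_real \<theta>) + exp (- (\<i> * of_real \<theta>))) / 2"
    by (simp add: cos_exp_eq flip: cos_of_real)
  have C: "cos (\<theta> - pi * of_nat k / 2) = (if k = 0 then cos \<theta> else sin \<theta>)"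
    "sin (\<theta> - pi * of_nat k / 2) = (if k = 0 then sin \<theta> else - cos \<theta>)"
    using k01 by (auto simp: cos_diff sin_diff)
  show "?s * ((hker k v (2 * \<i> * of_real y) - hker k v (- (2 * \<i> * of_real y))) / (4 * \<i>))
      = - of_real (cos ((2 * v - 1) * y - pi * of_nat k / 2)) / 4"
    unfolding times_divide_eq_right right_diff_distrib A B \<theta>_def[symmetric] C
    using k01 by (auto simp: sn cn field_simps)
  show "?s * ((hker k v (2 * \<i> * of_real y) + hker k v (- (2 * \<i> * of_real y))) / 4)
      = - of_real (sin ((2 * v - 1) * y - pi * of_nat k / 2)) / 4"
    unfolding times_divide_eq_right distrib_left A B \<theta>_def[symmetric] C
    using k01 by (auto simp: sn cn field_simps)
qed

text \<open>Algebra for one term of the integrand; \<open>P\<close> stands for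
  \<open>t powr (s - 2)\<close> and \<open>Q\<close> for
  \<open>1 / (t\<^sup>2 + a\<^sup>2)\<close>.\<close>

lemma psum_integrand_aux:
  fixes P t Q c d w q D X :: complex
  shows "t \<noteq> 0 \<Longrightarrow> P * t * ((c / t + X - d) * Q) = c * (P * Q) - d * (P * t * Q) + P * t * Q * X"
    and "P * t * Q * ((2 * t * c + 2 * w * q) / D) = 2 * c * (P * t * t * (1 / D * Q)) + 2 * w * q * (P * t * (1 / D * Q))"
  by (simp_all add: divide_inverse algebra_simps)

text \<open>The head 1/t of \<open>psum\<close> shifts the exponent to \<open>s - 1\<close>, the
  factor \<open>t\<close> before the cosines to \<open>s + 1\<close>. For \<open>k = 0\<close> the
  head demands \<open>1 < Re s < 3\<close>, and for \<open>v = 1\<close> the constant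
  \<open>corr k v\<close> demands \<open>Re s < 2\<close>; otherwise these two integrals carry the
  coefficient 0.\<close>

lemma psum_integral:
  assumes k: "k \<le> 1" and v: "0 < v" "v \<le> 1" and a: "a > 0"
    and s: "k = 0 \<Longrightarrow> 1 < Re s \<and> Re s < 3" "k = 1 \<Longrightarrow> 0 < Re s \<and> Re s < 2" "v = 1 \<Longrightarrow> Re s < 2"
  shows "mint (mpsum k v s a n)
     = (1 - of_nat k) * mint (mquad (s - 1) a)
       - corr k v * mint (mquad s a)
       + (\<Sum>i<n. 2 * cos (of_real (freq k i) * of_real v) * mint (mquart (s + 1) (freq k i) a)
          + 2 * of_real (freq k i) * sin (of_real (freq k i) * of_real v) * (mint (mquart s (freq k i) a)))"
proof -
  let ?K = "\<lambda>s t. mquad s a t"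
  let ?M = "\<lambda>s i t. mquart s (freq k i) a t"
  have k01: "k = 0 \<or> k = 1" using k by auto
  have s': "0 < Re s" "Re s < 3" using s k01 by auto
  have i1: "set_integrable lborel {0<..} (\<lambda>t. (1 - of_nat k) * ?K (s - 1) t)"
  proof (rule set_integrable_mult_right)
    assume "1 - of_nat k \<noteq> (0 :: complex)"
    then have "k = 0" using k01 by auto
    then show "set_integrable lborel {0<..} (?K (s - 1))"
      by (intro mellin_quadratic_integrable) (use s a in auto)
  qed
  have i2: "set_integrable lborel {0<..} (\<lambda>t. corr k v * ?K s t)"
  proof (rule set_integrable_mult_right)
    assume "corr k v \<noteq> 0"
    then have "v = 1" by (auto simp: corr_def split: if_splits)
    then show "set_integrable lborel {0<..} (?K s)"
      by (intro mellin_quadratic_integrable) (use s s' a in auto)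
  qed
  have f: "freq k i > 0" for i by (rule freq_pos[OF k])
  have i3: "set_integrable lborel {0<..} (\<lambda>t. 2 * cos (of_real (freq k i) * of_real v) * ?M (s + 1) i t)" for i
    using mellin_quartic_integrable[of "s + 1" "freq k i" a] s' f[of i] a by (intro set_integrable_mult_right) auto
  have i4: "set_integrable lborel {0<..} (\<lambda>t. 2 * of_real (freq k i) * sin (of_real (freq k i) * of_real v) * ?M s i t)" for i
    using mellin_quartic_integrable[of s "freq k i" a] s' f[of i] a by (intro set_integrable_mult_right) auto
  have i34: "set_integrable lborel {0<..} (\<lambda>t. \<Sum>i<n. 2 * cos (of_real (freq k i) * of_real v) * ?M (s + 1) i t
      + 2 * of_real (freq k i) * sin (of_real (freq k i) * of_real v) * ?M s i t)"
    unfolding set_integrable_def scaleR_sum_right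
    by (intro Bochner_Integration.integrable_sum) (use set_integral_add(1)[OF i3 i4] in \<open>simp add: set_integrable_def\<close>)
  have "mint (mpsum k v s a n)
    = (LINT t:{0<..}|lborel. (1 - of_nat k) * ?K (s - 1) t - corr k v * ?K s t
        + (\<Sum>i<n. 2 * cos (of_real (freq k i) * of_real v) * ?M (s + 1) i t
                + 2 * of_real (freq k i) * sin (of_real (freq k i) * of_real v) * ?M s i t))"
  proof (intro set_lebesgue_integral_cong allI impI)
    fix t :: real assume t: "t \<in> {0<..}"
    define P where "P = complex_of_real t powr (s - 1 - 1)"
    define Q where "Q = 1 / ((complex_of_real t) ^ 2 + of_real a ^ 2)"
    have p1: "complex_of_real t powr (s - 1) = P * of_real t"
      unfolding P_def using t by (intro powr_shift_one) auto
    have p2: "complex_of_real t powr (s + 1 - 1) = P * of_real t * of_real t"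
      unfolding p1[symmetric] using powr_shift_one[of t s] t by simp
    have q: "1 / ((of_real t ^ 2 + of_real (freq k i) ^ 2) * (of_real t ^ 2 + of_real a ^ 2)) = 1 / (of_real t ^ 2 + of_real (freq k i) ^ 2) * Q" for i
      by (simp add: Q_def)
    have t0: "complex_of_real t \<noteq> 0" using t by auto
    show "mpsum k v s a n t
       = (1 - of_nat k) * ?K (s - 1) t - corr k v * ?K s t
        + (\<Sum>i<n. 2 * cos (of_real (freq k i) * of_real v) * ?M (s + 1) i t
                + 2 * of_real (freq k i) * sin (of_real (freq k i) * of_real v) * ?M s i t)"
      unfolding p1 p2 q unfolding P_def[symmetric] Q_def[symmetric] psum_def
    proof -
      let ?w = "\<lambda>i. complex_of_real (freq k i)"
      show "P * of_real t * (((1 - of_nat k) / of_real t + (\<Sum>i<n. (2 * of_real t * cos (?w i * of_real v) + 2 * ?w i * sin (?w i * of_real v)) / ((of_real t)\<^sup>2 + (?w i)\<^sup>2)) - corr k v) * Q)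
         = (1 - of_nat k) * (P * Q) - corr k v * (P * of_real t * Q)
           + (\<Sum>i<n. 2 * cos (?w i * of_real v) * (P * of_real t * of_real t * (1 / ((of_real t)\<^sup>2 + (?w i)\<^sup>2) * Q))
           + 2 * ?w i * sin (?w i * of_real v) * (P * of_real t * (1 / ((of_real t)\<^sup>2 + (?w i)\<^sup>2) * Q)))"
        unfolding psum_integrand_aux(1)[OF t0] sum_distrib_left psum_integrand_aux(2) ..
    qed
  qed auto
  also have "\<dots> = (1 - of_nat k) * (LINT t:{0<..}|lborel. ?K (s - 1) t) - corr k v * (LINT t:{0<..}|lborel. ?K s t)
     + (LINT t:{0<..}|lborel. (\<Sum>i<n. 2 * cos (of_real (freq k i) * of_real v) * ?M (s + 1) i t
                + 2 * of_real (freq k i) * sin (of_real (freq k i) * of_real v) * ?M s i t))"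
    by (subst set_integral_add(2)[OF set_integral_diff(1)[OF i1 i2] i34], subst set_integral_diff(2)[OF i1 i2]) (simp only: set_integral_mult_right)
  also have "(LINT t:{0<..}|lborel. (\<Sum>i<n. 2 * cos (of_real (freq k i) * of_real v) * ?M (s + 1) i t
                + 2 * of_real (freq k i) * sin (of_real (freq k i) * of_real v) * ?M s i t))
     = (\<Sum>i<n. LINT t:{0<..}|lborel. 2 * cos (of_real (freq k i) * of_real v) * ?M (s + 1) i t
                + 2 * of_real (freq k i) * sin (of_real (freq k i) * of_real v) * ?M s i t)"
    by (rule LINT_sum) (rule set_integral_add(1)[OF i3 i4])
  also have "\<dots> = (\<Sum>i<n. 2 * cos (of_real (freq k i) * of_real v) * (LINT t:{0<..}|lborel. ?M (s + 1) i t)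
                + 2 * of_real (freq k i) * sin (of_real (freq k i) * of_real v) * (LINT t:{0<..}|lborel. ?M s i t))"
    by (intro sum.cong refl, subst set_integral_add(2)[OF i3 i4]) (simp only: set_integral_mult_right)
  finally show ?thesis .
qed

lemma psum_integral_tendsto:
  assumes k: "k \<le> 1" and v: "0 < v" "v \<le> 1" and a: "a > 0"
    and s: "k = 0 \<Longrightarrow> 1 < Re s \<and> Re s < 3" "k = 1 \<Longrightarrow> 0 < Re s \<and> Re s < 2" "v = 1 \<Longrightarrow> Re s < 2"
  shows "(\<lambda>n. mint (mpsum k v s a n))
     \<longlonglongrightarrow> mint (mhquad k v s a)"
proof -
  have k01: "k = 0 \<or> k = 1" using k by auto
  define e where "e = (if k = 0 \<and> v < 1 then 1 else 0 :: real)"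
  obtain C where C0: "C \<ge> 0" and C: "\<And>t n. t > 0 \<Longrightarrow> t \<le> 1 \<Longrightarrow> norm (psum k (of_real v) (of_real t) n - corr k v) \<le> C * t powr - (1 - real k)"
     "\<And>t n. 1 \<le> t \<Longrightarrow> norm (psum k (of_real v) (of_real t) n - corr k v) \<le> C * t powr - e"
    using psum_dominated[OF k v] unfolding e_def by (metis less_le_trans zero_less_one)
  have nz: "complex_of_real t ^ 2 + of_real a ^ 2 \<noteq> 0" for t by (rule of_real_square_add_nonzero[OF a])
  have f: "freq k i > 0" for i by (rule freq_pos[OF k])
  have nzf: "complex_of_real t ^ 2 + of_real (freq k i) ^ 2 \<noteq> 0" for t i by (rule of_real_square_add_nonzero[OF f])
  show ?thesis
  proof (rule mellin_dominated_convergence[where \<alpha> = "Re s - (1 - real k)" and \<beta> = "2 + e - Re s" and C = "C * max 1 (1 / a\<^sup>2)"])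
    show "continuous_on {0<..} (mpsum k v s a n)" for n
      unfolding psum_def by (intro continuous_intros) (use nz nzf in auto)
    show "continuous_on {0<..} (mhquad k v s a)"
      by (intro continuous_intros hker_continuous) (use nz in auto)
    show "Re s - (1 - real k) > 0" "2 + e - Re s > 0" using s k01 v by (auto simp: e_def)
    fix t :: real assume "t \<in> {0<..}"
    then have t: "t > 0" by simp
    have "psum k (of_real v) (of_real t) \<longlonglongrightarrow> hker k v (of_real t) + corr k v"
      using psum_tendsto[OF k exp_real_neq[OF t] v] by (simp add: hker_def corr_def)
    then have "(\<lambda>n. psum k (of_real v) (of_real t) n - corr k v) \<longlonglongrightarrow> hker k v (of_real t) + corr k v - corr k v"
      by (intro tendsto_intros)
    then show "(\<lambda>n. mpsum k v s a n t)
      \<longlonglongrightarrow> mhquad k v s a t"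
      by (intro tendsto_mult tendsto_const) simp
    fix n
    let ?N = "norm (psum k (of_real v) (of_real t) n - corr k v)"
    let ?Q = "norm (1 / ((complex_of_real t)\<^sup>2 + (of_real a)\<^sup>2))"
    have "norm (mpsum k v s a n t)
      = t powr (Re s - 1) * (?N * ?Q)"
      by (simp only: norm_mult norm_powr_pos[OF t]) simp
    also have "\<dots> \<le> C * max 1 (1 / a\<^sup>2) * mdom (Re s - (1 - real k)) (2 + e - Re s) t"
    proof (cases "t \<le> 1")
      case True
      have "?N * ?Q \<le> (C * t powr - (1 - real k)) * max 1 (1 / a\<^sup>2)"
        using C0 norm_inverse_square_add_le(1)[OF a t] by (intro mult_mono C(1)[OF t True]) auto
      then have "t powr (Re s - 1) * (?N * ?Q) \<le> t powr (Re s - 1) * ((C * t powr - (1 - real k)) * max 1 (1 / a\<^sup>2))"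
        by (intro mult_left_mono) auto
      also have "\<dots> = C * max 1 (1 / a\<^sup>2) * (t powr (Re s - 1) * t powr - (1 - real k))" by simp
      also have "t powr (Re s - 1) * t powr - (1 - real k) = mdom (Re s - (1 - real k)) (2 + e - Re s) t"
        using True unfolding powr_add[symmetric] mdom_def by (simp add: algebra_simps)
      finally show ?thesis .
    next
      case False
      then have t1: "1 \<le> t" by simp
      have "?N * ?Q \<le> (C * t powr - e) * (max 1 (1 / a\<^sup>2) * t powr - 2)"
      proof (intro mult_mono C(2)[OF t1])
        show "?Q \<le> max 1 (1 / a\<^sup>2) * t powr - 2"
          using norm_inverse_square_add_le(2)[OF a t] mult_right_mono[of 1 "max 1 (1 / a\<^sup>2)" "t powr - 2"] by simp
      qed (use C0 in auto)
      then have "t powr (Re s - 1) * (?N * ?Q) \<le> t powr (Re s - 1) * ((C * t powr - e) * (max 1 (1 / a\<^sup>2) * t powr - 2))"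
        by (intro mult_left_mono) auto
      also have "\<dots> = C * max 1 (1 / a\<^sup>2) * (t powr (Re s - 1) * (t powr - e * t powr - 2))" by simp
      also have "t powr (Re s - 1) * (t powr - e * t powr - 2) = mdom (Re s - (1 - real k)) (2 + e - Re s) t"
        using False unfolding powr_add[symmetric] mdom_def by (simp add: algebra_simps)
      finally show ?thesis .
    qed
    finally show "norm (mpsum k v s a n t)
       \<le> C * max 1 (1 / a\<^sup>2) * mdom (Re s - (1 - real k)) (2 + e - Re s) t" .
  qed auto
qed

lemma mellin_const_shift:
  shows "mellin_const (s + 1) = of_real pi / (2 * cos (of_real pi * s / 2))"
    and "mellin_const (s - 1) = - of_real pi / (2 * cos (of_real pi * s / 2))"
proof -
  have e: "of_real pi * (s + 1) / 2 = of_real pi * s / 2 + of_real pi / 2"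
    "of_real pi * (s - 1) / 2 = of_real pi * s / 2 - of_real pi / 2"
    by (simp_all add: distrib_left right_diff_distrib add_divide_distrib diff_divide_distrib)
  have p: "sin (complex_of_real pi / 2) = 1" "cos (complex_of_real pi / 2) = 0"
    using sin_of_real[of "pi / 2", where ?'a = complex] cos_of_real[of "pi / 2", where ?'a = complex] by simp_all
  show "mellin_const (s + 1) = of_real pi / (2 * cos (of_real pi * s / 2))"
    "mellin_const (s - 1) = - of_real pi / (2 * cos (of_real pi * s / 2))"
    unfolding mellin_const_def e by (simp_all add: sin_add sin_diff p)
qed

lemma partial_fraction_aux:
  fixes cv sv W2 w A1 A2 D c q p a2 w2 :: complex
  assumes "D \<noteq> 0" "c \<noteq> 0" "q \<noteq> 0" "a2 - w2 = - D"
  shows "2 * cv * (p / (2 * c) * ((w * W2 - A1) / (a2 - w2))) + 2 * w * sv * (p / (2 * q) * ((W2 - A2) / (a2 - w2)))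
    = - (p / (c * q)) * (w * W2 * (sv * c + cv * q) / D) + p * A1 / c * (cv / D) + p * A2 / q * (w * sv / D)"
  unfolding assms(4) using assms(1-3) by (simp add: field_simps)

text \<open>The algebra of \<open>series_partial_identity\<close>: \<open>J\<close> is
  \<open>1 - k\<close>, \<open>P\<close> and \<open>Pm\<close> are \<open>psum\<close> at
  \<open>\<i> * a\<close> and its negative, \<open>Cn\<close> and \<open>Sn\<close> their cosine and
  sine sums, \<open>R\<close> is \<open>corr k v\<close>, \<open>X\<close> the integrated partial
  sum, and \<open>A1\<close>, \<open>A2\<close>, \<open>A3\<close> are powers of
  \<open>a\<close>.\<close>

lemma partial_fraction_aux2:
  fixes J p A3 a c q A1 A2 Cn Sn R T X P Pm :: complex
  assumes "a \<noteq> 0" "c \<noteq> 0" "q \<noteq> 0" and A1: "A1 = A3 * a ^ 2"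
    and P: "P = J / (\<i> * a) + 2 * \<i> * a * Cn + 2 * Sn" and Pm: "Pm = - (J / (\<i> * a)) - 2 * \<i> * a * Cn + 2 * Sn"
    and X: "X = J * (A3 * (- p / (2 * c))) - R * (A2 * (p / (2 * q))) + (- (p / (c * q)) * T + p * A1 / c * Cn + p * A2 / q * Sn)"
  shows "p / (c * q) * T = p * A1 / c * ((P - Pm) / (4 * \<i> * a)) + p * A2 / q * ((P + Pm) / 4) - R * (A2 * (p / (2 * q))) - X"
proof -
  have f1: "(P - Pm) / (4 * \<i> * a) = - J / (2 * a ^ 2) + Cn"
    using assms(1) unfolding P Pm by (simp add: field_simps power2_eq_square)
  have f2: "(P + Pm) / 4 = Sn" unfolding P Pm by simp
  have f3: "p * A1 / c * (- J / (2 * a ^ 2)) = - (p * A3 / c * J / 2)"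
    using assms(1,2) unfolding A1 by (simp add: field_simps)
  have f4: "J * (A3 * (- p / (2 * c))) = - (p * A3 / c * J / 2)" by (simp add: mult_ac)
  show ?thesis
    unfolding X f1 f2 distrib_left f3 f4 by simp
qed

text \<open>Every quartic transform splits into a power of \<open>freq k i\<close> and a power of
  \<open>a\<close>. As \<open>w\<^sup>2 - a\<^sup>2 = w\<^sup>2 + (\<i> * a)\<^sup>2\<close>, the
  latter multiply exactly the partial sums at plus and minus \<open>\<i> * a\<close>, heads
  included. The identity is exact for each \<open>n\<close>, so the two families of powers need no
  separate convergence proofs.\<close>

lemma series_partial_identity:
  fixes a :: real
  assumes k: "k \<le> 1" and v: "0 < v" "v \<le> 1" and a: "a > 0"
    and s: "k = 0 \<Longrightarrow> 1 < Re s \<and> Re s < 3" "k = 1 \<Longrightarrow> 0 < Re s \<and> Re s < 2" "v = 1 \<Longrightarrow> Re s < 2"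
    and s12: "s \<noteq> 1" "s \<noteq> 2"
    and ne: "exp (\<i> * complex_of_real a) \<noteq> (-1) ^ k"
  defines "c \<equiv> cos (of_real pi * s / 2)" and "q \<equiv> sin (of_real pi * s / 2)"
  defines "T \<equiv> \<lambda>i. of_real (freq k i) powr (s - 1) * sin (of_real (freq k i) * of_real v + of_real pi * s / 2) / ((of_real (freq k i))\<^sup>2 - (of_real a)\<^sup>2)"
  shows "of_real pi / (c * q) * (\<Sum>i<n. T i) =
     of_real pi * of_real a powr (s - 1) / c * ((psum k (of_real v) (\<i> * of_real a) n - psum k (of_real v) (- (\<i> * of_real a)) n) / (4 * \<i> * of_real a))
   + of_real pi * of_real a powr (s - 2) / q * ((psum k (of_real v) (\<i> * of_real a) n + psum k (of_real v) (- (\<i> * of_real a)) n) / 4)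
   - corr k v * (of_real a powr (s - 2) * (of_real pi / (2 * q)))
   - mint (mpsum k v s a n)"
    and "c \<noteq> 0" "q \<noteq> 0"
proof -
  have k01: "k = 0 \<or> k = 1" using k by auto
  have s': "0 < Re s" "Re s < 3" using s k01 by auto
  show q: "q \<noteq> 0" unfolding q_def using s' s12 by (intro sin_half_nonzero) auto
  have "sin (of_real pi * (s + 1) / 2) \<noteq> 0" using s' s12 by (intro sin_half_nonzero) auto
  moreover have "sin (of_real pi * (s + 1) / 2) = c"
  proof -
    have e: "of_real pi * (s + 1) / 2 = of_real pi * s / 2 + of_real pi / 2"
      by (simp add: distrib_left add_divide_distrib)
    have p: "sin (complex_of_real pi / 2) = 1" "cos (complex_of_real pi / 2) = 0"
      using sin_of_real[of "pi / 2", where ?'a = complex] cos_of_real[of "pi / 2", where ?'a = complex] by simp_all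
    show ?thesis unfolding e c_def by (simp add: sin_add p)
  qed
  ultimately show c: "c \<noteq> 0" by simp
  have f: "freq k i > 0" for i by (rule freq_pos[OF k])
  let ?w = "\<lambda>i. complex_of_real (freq k i)"
  have D0: "(?w i)\<^sup>2 - (of_real a)\<^sup>2 \<noteq> 0" for i
    using exp_neq_imp_freq(1)[OF k ne, of i] by (simp add: power_mult_distrib)
  have fa: "freq k i \<noteq> a" for i using D0[of i] by auto
  define Cn where "Cn = (\<Sum>i<n. cos (?w i * of_real v) / ((?w i)\<^sup>2 - (of_real a)\<^sup>2))"
  define Sn where "Sn = (\<Sum>i<n. ?w i * sin (?w i * of_real v) / ((?w i)\<^sup>2 - (of_real a)\<^sup>2))"
  show "of_real pi / (c * q) * (\<Sum>i<n. T i) =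
     of_real pi * of_real a powr (s - 1) / c * ((psum k (of_real v) (\<i> * of_real a) n - psum k (of_real v) (- (\<i> * of_real a)) n) / (4 * \<i> * of_real a))
   + of_real pi * of_real a powr (s - 2) / q * ((psum k (of_real v) (\<i> * of_real a) n + psum k (of_real v) (- (\<i> * of_real a)) n) / 4)
   - corr k v * (of_real a powr (s - 2) * (of_real pi / (2 * q)))
   - mint (mpsum k v s a n)"
  proof (rule partial_fraction_aux2[where ?A3.0 = "of_real a powr (s - 3)" and J = "1 - of_nat k" and Cn = Cn and Sn = Sn])
    show "complex_of_real a \<noteq> 0" using a by simp
    show "c \<noteq> 0" "q \<noteq> 0" by fact+
    show "complex_of_real a powr (s - 1) = of_real a powr (s - 3) * of_real a ^ 2"
      using powr_shift_square[OF a, of s] by simp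
    have sp: "(\<Sum>i<n. (2 * t * x i + 2 * ?w i * y i) / (- ((of_real a)\<^sup>2) + (?w i)\<^sup>2)) =
       2 * t * (\<Sum>i<n. x i / ((?w i)\<^sup>2 - (of_real a)\<^sup>2)) + 2 * (\<Sum>i<n. ?w i * y i / ((?w i)\<^sup>2 - (of_real a)\<^sup>2))" for t x y
      unfolding sum_distrib_left sum.distrib[symmetric] by (intro sum.cong refl) (simp add: add_divide_distrib)
    have sq: "(\<i> * complex_of_real a)\<^sup>2 = - ((of_real a)\<^sup>2)" "(- (\<i> * complex_of_real a))\<^sup>2 = - ((of_real a)\<^sup>2)"
      by (simp_all add: power_mult_distrib)
    show "psum k (of_real v) (\<i> * of_real a) n = (1 - of_nat k) / (\<i> * of_real a) + 2 * \<i> * of_real a * Cn + 2 * Sn"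
      unfolding psum_def sq sp Cn_def Sn_def by simp
    show "psum k (of_real v) (- (\<i> * of_real a)) n = - ((1 - of_nat k) / (\<i> * of_real a)) - 2 * \<i> * of_real a * Cn + 2 * Sn"
      unfolding psum_def sq sp Cn_def Sn_def by simp
    let ?K = "\<lambda>s t. mquad s a t"
    have X1: "(1 - of_nat k) * (LINT t:{0<..}|lborel. ?K (s - 1) t) = (1 - of_nat k) * (of_real a powr (s - 3) * (- of_real pi / (2 * c)))"
    proof (cases "k = 0")
      case True
      then show ?thesis using mellin_quadratic[of "s - 1" a] s a by (simp add: mellin_const_shift c_def)
    qed (use k01 in auto)
    have X2: "corr k v * (LINT t:{0<..}|lborel. ?K s t) = corr k v * (of_real a powr (s - 2) * (of_real pi / (2 * q)))"
    proof (cases "v = 1")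
      case True
      then show ?thesis using mellin_quadratic[of s a] s s' a by (simp add: mellin_const_def q_def)
    qed (simp add: corr_def)
    have X3: "2 * cos (?w i * of_real v) * mint (mquart (s + 1) (freq k i) a)
          + 2 * ?w i * sin (?w i * of_real v) * mint (mquart s (freq k i) a)
      = - (of_real pi / (c * q)) * T i + of_real pi * of_real a powr (s - 1) / c * (cos (?w i * of_real v) / ((?w i)\<^sup>2 - (of_real a)\<^sup>2))
         + of_real pi * of_real a powr (s - 2) / q * (?w i * sin (?w i * of_real v) / ((?w i)\<^sup>2 - (of_real a)\<^sup>2))" for i
    proof -
      have M1: "mint (mquart (s + 1) (freq k i) a)
        = of_real pi / (2 * c) * ((?w i * ?w i powr (s - 2) - of_real a powr (s - 1)) / ((of_real a)\<^sup>2 - (?w i)\<^sup>2))"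
      proof -
        have "?w i powr (s + 1 - 2) = ?w i * ?w i powr (s - 2)"
          using powr_shift_one[OF f[of i], of "s - 1"] by simp
        moreover have "of_real a powr (s + 1 - 2) = complex_of_real a powr (s - 1)" by simp
        ultimately show ?thesis
          using mellin_quartic[of "s + 1" "freq k i" a] s' s12 f[of i] a fa[of i]
          by (simp only: mellin_const_shift c_def) auto
      qed
      have M2: "mint (mquart s (freq k i) a)
        = of_real pi / (2 * q) * ((?w i powr (s - 2) - of_real a powr (s - 2)) / ((of_real a)\<^sup>2 - (?w i)\<^sup>2))"
        using mellin_quartic[of s "freq k i" a] s' s12 f[of i] a fa[of i] by (simp add: mellin_const_def q_def)
      have w1: "?w i * ?w i powr (s - 2) = ?w i powr (s - 1)"
        using powr_shift_one[OF f[of i], of "s - 1"] by simp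
      have "T i = ?w i * ?w i powr (s - 2) * (sin (?w i * of_real v) * c + cos (?w i * of_real v) * q) / ((?w i)\<^sup>2 - (of_real a)\<^sup>2)"
        unfolding T_def sin_add w1 c_def q_def ..
      then show ?thesis unfolding M1 M2
        by (simp only:) (rule partial_fraction_aux, use D0 c q in auto)
    qed
    show "mint (mpsum k v s a n)
      = (1 - of_nat k) * (of_real a powr (s - 3) * (- of_real pi / (2 * c))) - corr k v * (of_real a powr (s - 2) * (of_real pi / (2 * q)))
        + (- (of_real pi / (c * q)) * (\<Sum>i<n. T i) + of_real pi * of_real a powr (s - 1) / c * Cn + of_real pi * of_real a powr (s - 2) / q * Sn)"
    proof (rule trans[OF psum_integral[OF k v a s]])
      show "(1 - of_nat k) * (LINT t:{0<..}|lborel. ?K (s - 1) t) - corr k v * (LINT t:{0<..}|lborel. ?K s t)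
         + (\<Sum>i<n. 2 * cos (?w i * of_real v) * mint (mquart (s + 1) (freq k i) a)
          + 2 * ?w i * sin (?w i * of_real v) * (mint (mquart s (freq k i) a)))
        = (1 - of_nat k) * (of_real a powr (s - 3) * (- of_real pi / (2 * c))) - corr k v * (of_real a powr (s - 2) * (of_real pi / (2 * q)))
        + (- (of_real pi / (c * q)) * (\<Sum>i<n. T i) + of_real pi * of_real a powr (s - 1) / c * Cn + of_real pi * of_real a powr (s - 2) / q * Sn)"
        unfolding X1 X2 X3 by (simp only: Cn_def Sn_def sum_distrib_left sum.distrib)
    qed
  qed
qed

text \<open>The constant \<open>corr k v\<close> enters twice, through the limits of
  \<open>psum\<close> at plus and minus \<open>\<i> * a\<close> and through the integral of
  \<open>corr k v\<close> itself. The contributions cancel, so interior \<open>v\<close> and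
  \<open>v = 1\<close> have the same limit formula.\<close>

lemma series_limit:
  fixes a :: real
  assumes k: "k \<le> 1" and v: "0 < v" "v \<le> 1" and a: "a > 0"
    and s: "k = 0 \<Longrightarrow> 1 < Re s \<and> Re s < 3" "k = 1 \<Longrightarrow> 0 < Re s \<and> Re s < 2" "v = 1 \<Longrightarrow> Re s < 2"
    and s12: "s \<noteq> 1" "s \<noteq> 2"
    and ne: "exp (\<i> * complex_of_real a) \<noteq> (-1) ^ k"
  defines "c \<equiv> cos (of_real pi * s / 2)" and "q \<equiv> sin (of_real pi * s / 2)"
  defines "T \<equiv> \<lambda>i. of_real (freq k i) powr (s - 1) * sin (of_real (freq k i) * of_real v + of_real pi * s / 2) / ((of_real (freq k i))\<^sup>2 - (of_real a)\<^sup>2)"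
  shows "(\<lambda>n. of_real pi / (c * q) * (\<Sum>i<n. T i)) \<longlonglongrightarrow>
     of_real pi * of_real a powr (s - 1) / c * ((hker k v (\<i> * of_real a) - hker k v (- (\<i> * of_real a))) / (4 * \<i> * of_real a))
   + of_real pi * of_real a powr (s - 2) / q * ((hker k v (\<i> * of_real a) + hker k v (- (\<i> * of_real a))) / 4)
   - mint (mhquad k v s a)"
proof -
  have z: "(-1) ^ k = (1::complex) \<or> (-1) ^ k = (-1::complex)" by (simp add: minus_one_power_iff)
  have ne': "exp (- (\<i> * complex_of_real a)) \<noteq> (-1) ^ k"
    using ne z by (metis exp_minus inverse_1 inverse_inverse_eq inverse_minus_eq)
  note P = psum_tendsto[OF k ne v, folded hker_def corr_def]
  note Pm = psum_tendsto[OF k ne' v, folded hker_def corr_def]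
  let ?A1 = "of_real pi * of_real a powr (s - 1) / c"
  let ?A2 = "of_real pi * of_real a powr (s - 2) / q"
  have "(\<lambda>n. ?A1 * ((psum k (of_real v) (\<i> * of_real a) n - psum k (of_real v) (- (\<i> * of_real a)) n) / (4 * \<i> * of_real a))
   + ?A2 * ((psum k (of_real v) (\<i> * of_real a) n + psum k (of_real v) (- (\<i> * of_real a)) n) / 4)
   - corr k v * (of_real a powr (s - 2) * (of_real pi / (2 * q)))
   - (mint (mpsum k v s a n)))
   \<longlonglongrightarrow> ?A1 * (((hker k v (\<i> * of_real a) + corr k v) - (hker k v (- (\<i> * of_real a)) + corr k v)) / (4 * \<i> * of_real a))
   + ?A2 * (((hker k v (\<i> * of_real a) + corr k v) + (hker k v (- (\<i> * of_real a)) + corr k v)) / 4)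
   - corr k v * (of_real a powr (s - 2) * (of_real pi / (2 * q)))
   - mint (mhquad k v s a)"
    using a by (intro tendsto_diff tendsto_add tendsto_mult tendsto_divide tendsto_const P Pm psum_integral_tendsto k v s) auto
  also have "(\<lambda>n. ?A1 * ((psum k (of_real v) (\<i> * of_real a) n - psum k (of_real v) (- (\<i> * of_real a)) n) / (4 * \<i> * of_real a))
   + ?A2 * ((psum k (of_real v) (\<i> * of_real a) n + psum k (of_real v) (- (\<i> * of_real a)) n) / 4)
   - corr k v * (of_real a powr (s - 2) * (of_real pi / (2 * q)))
   - (mint (mpsum k v s a n)))
   = (\<lambda>n. of_real pi / (c * q) * (\<Sum>i<n. T i))"
    unfolding c_def q_def T_def using series_partial_identity(1)[OF k v a s s12 ne, symmetric] by (intro ext) simp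
  also have "?A1 * (((hker k v (\<i> * of_real a) + corr k v) - (hker k v (- (\<i> * of_real a)) + corr k v)) / (4 * \<i> * of_real a))
   + ?A2 * (((hker k v (\<i> * of_real a) + corr k v) + (hker k v (- (\<i> * of_real a)) + corr k v)) / 4)
   - corr k v * (of_real a powr (s - 2) * (of_real pi / (2 * q)))
   = ?A1 * ((hker k v (\<i> * of_real a) - hker k v (- (\<i> * of_real a))) / (4 * \<i> * of_real a))
   + ?A2 * ((hker k v (\<i> * of_real a) + hker k v (- (\<i> * of_real a))) / 4)"
    by (simp add: add_divide_distrib distrib_left mult_ac)
  finally show ?thesis .
qed

lemma powr_pos_mult:
  "x > 0 \<Longrightarrow> y > 0 \<Longrightarrow> complex_of_real (x * y) powr s = of_real x powr s * of_real y powr s"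
  by (simp add: powr_times_real)

section \<open>The interpolation identity\<close>

lemma rescale_aux:
  fixes A S D c q p P :: complex
  assumes "c \<noteq> 0" "q \<noteq> 0" "p \<noteq> 0" "P \<noteq> 0"
  shows "A * S * (1 / D) = - (4 * c * q) / (p * P) * (p / (c * q) * (P * A * S / (- (4 * D))))"
  using assms by (cases "D = 0") (simp_all add: field_simps)

lemma cancel_aux:
  fixes a p B c X \<sigma> :: complex
  assumes "a \<noteq> 0"
  shows "\<sigma> * (a * a * (p * B / c * (X / (4 * \<i> * a)))) = p * (a * B) / c * (\<sigma> * (X / (4 * \<i>)))"
  using assms by (cases "c = 0") (simp_all add: field_simps)

text \<open>The case of \<open>s\<close> in the strip: \<open>series_limit\<close> at
  \<open>a = 2 * y\<close>, multiplied by the sine and by \<open>(2 * y)\<^sup>2\<close>.\<close>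

lemma interpolation_identity_base:
  fixes y :: real
  assumes k: "k \<le> 1" and v: "0 < v" "v \<le> 1" and y: "y > 0"
    and s: "k = 0 \<Longrightarrow> 1 < Re s \<and> Re s < 3" "k = 1 \<Longrightarrow> 0 < Re s \<and> Re s < 2" "v = 1 \<Longrightarrow> Re s < 2"
    and s12: "s \<noteq> 1" "s \<noteq> 2"
    and ne: "sin (y + pi * of_nat k / 2) \<noteq> 0"
  defines "\<alpha> \<equiv> \<lambda>i. freq k i / 2"
  defines "u \<equiv> \<lambda>i. of_real (\<alpha> i) powr (s - 1) * sin (of_real (freq k i) * of_real v + of_real pi * s / 2) * of_real (1 / (y\<^sup>2 - (\<alpha> i)\<^sup>2))"
  shows "summable u"
    and "f_fun k s v y - of_real (sin (y + pi * of_nat k / 2)) * (4 * of_real y ^ 2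
       * (mint (mhquad k v s (2 * y))))
      = - (of_real (sin (y + pi * of_nat k / 2)) * (of_real pi * 2 powr s * of_real y ^ 2 / sin (of_real pi * s)) * suminf u)"
proof -
  define a where "a = 2 * y"
  have a: "a > 0" using y by (simp add: a_def)
  define c where "c = cos (of_real pi * s / 2)"
  define q where "q = sin (of_real pi * s / 2)"
  let ?\<sigma> = "complex_of_real (sin (y + pi * of_nat k / 2))"
  have ia: "\<i> * complex_of_real a = 2 * \<i> * of_real y" by (simp add: a_def)
  have "exp (2 * \<i> * complex_of_real y) - (-1) ^ k \<noteq> 0"
    unfolding sin_shift_eq[OF k] using ne by simp
  then have nea: "exp (\<i> * complex_of_real a) \<noteq> (-1) ^ k" unfolding ia by simp
  define T where "T = (\<lambda>i. of_real (freq k i) powr (s - 1) * sin (of_real (freq k i) * of_real v + of_real pi * s / 2) / ((of_real (freq k i))\<^sup>2 - (complex_of_real a)\<^sup>2))"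
  define I where "I = mint (mhquad k v s a)"
  define E1 where "E1 = of_real pi * of_real a powr (s - 1) / c * ((hker k v (\<i> * of_real a) - hker k v (- (\<i> * of_real a))) / (4 * \<i> * of_real a))"
  define E2 where "E2 = of_real pi * of_real a powr (s - 2) / q * ((hker k v (\<i> * of_real a) + hker k v (- (\<i> * of_real a))) / 4)"
  note id = series_partial_identity(2,3)[OF k v a s s12 nea, folded c_def q_def]
  have lim: "(\<lambda>n. of_real pi / (c * q) * (\<Sum>i<n. T i)) \<longlonglongrightarrow> E1 + E2 - I"
    using series_limit[OF k v a s s12 nea] unfolding T_def E1_def E2_def I_def c_def q_def .
  \<comment> \<open>Passing from \<open>freq k i\<close> to the node \<open>\<alpha> i\<close>
    produces \<open>2 powr (s - 1)\<close> from the power and the factor -4 from the denominator,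
    whose difference is also reversed; the rest undoes the prefactor of \<open>lim\<close>.\<close>
  define \<mu> where "\<mu> = - (4 * c * q) / (of_real pi * 2 powr (s - 1))"
  have p2: "(2::complex) powr (s - 1) \<noteq> 0" by simp
  have f: "freq k i > 0" for i by (rule freq_pos[OF k])
  have u: "u i = \<mu> * (of_real pi / (c * q) * T i)" for i
  proof -
    have fr: "freq k i = 2 * \<alpha> i" by (simp add: \<alpha>_def)
    have "complex_of_real (freq k i) powr (s - 1) = 2 powr (s - 1) * of_real (\<alpha> i) powr (s - 1)"
      unfolding fr using f[of i] by (subst powr_pos_mult) (auto simp: \<alpha>_def)
    moreover have "(complex_of_real (freq k i))\<^sup>2 - (of_real a)\<^sup>2 = - (4 * of_real (y\<^sup>2 - (\<alpha> i)\<^sup>2))"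
      unfolding fr a_def by (simp add: power_mult_distrib)
    ultimately have "T i = 2 powr (s - 1) * of_real (\<alpha> i) powr (s - 1) * sin (of_real (freq k i) * of_real v + of_real pi * s / 2) / (- (4 * of_real (y\<^sup>2 - (\<alpha> i)\<^sup>2)))"
      unfolding T_def by simp
    then show ?thesis
      unfolding u_def \<mu>_def of_real_divide of_real_1 using id p2
      by (simp only:) (rule rescale_aux, auto)
  qed
  have "(\<lambda>n. \<mu> * (of_real pi / (c * q) * (\<Sum>i<n. T i))) \<longlonglongrightarrow> \<mu> * (E1 + E2 - I)"
    by (intro tendsto_mult tendsto_const lim)
  then have us: "u sums (\<mu> * (E1 + E2 - I))"
    unfolding sums_def u by (simp only: sum_distrib_left)
  then show "summable u" by (rule sums_summable)
  have S: "suminf u = \<mu> * (E1 + E2 - I)" using us by (rule sums_unique[symmetric])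
  have s2: "sin (of_real pi * s) = 2 * q * c"
    using sin_double[of "of_real pi * s / 2"] by (simp add: q_def c_def)
  have p2s: "(2::complex) powr s = 2 * 2 powr (s - 1)"
    using powr_shift_one[of 2 s] by simp
  have coeff: "(of_real pi * 2 powr s * of_real y ^ 2 / sin (of_real pi * s)) * (\<mu> * X) = - (4 * of_real y ^ 2 * X)" for X
    unfolding s2 p2s \<mu>_def using id p2 by simp
  have aa: "4 * complex_of_real y ^ 2 = of_real a * of_real a" by (simp add: a_def power2_eq_square)
  have ap1: "complex_of_real a powr s = of_real a * of_real a powr (s - 1)"
    using powr_shift_one[OF a, of s] by simp
  have ap2: "complex_of_real a powr s = of_real a * of_real a * of_real a powr (s - 2)"
    using powr_shift_square[OF a, of "s + 1"] by (simp add: power2_eq_square algebra_simps) 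
  have ap: "complex_of_real a powr s = 4 * 2 powr (s - 2) * of_real y powr s"
  proof -
    have "complex_of_real a powr s = 2 powr s * of_real y powr s"
      unfolding a_def using y by (subst powr_pos_mult) auto
    also have "(2::complex) powr s = 2 powr (s - 2) * 4"
      using powr_shift_square[of 2 "s + 1"] by simp
    finally show ?thesis by simp
  qed
  have g1: "?\<sigma> * (4 * of_real y ^ 2 * E1) = of_real pi * of_real a powr s / c * (- of_real (cos ((2 * v - 1) * y - pi * of_nat k / 2)) / 4)"
  proof -
    have "?\<sigma> * (4 * of_real y ^ 2 * E1) = of_real pi * (of_real a * of_real a powr (s - 1)) / c *
        (?\<sigma> * ((hker k v (\<i> * of_real a) - hker k v (- (\<i> * of_real a))) / (4 * \<i>)))"
      unfolding E1_def aa by (rule cancel_aux) (use a in simp)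
    then show ?thesis
      unfolding ia ap1[symmetric] hker_imag_combine(1)[OF k ne] .
  qed
  have g2: "?\<sigma> * (4 * of_real y ^ 2 * E2) = of_real pi * of_real a powr s / q * (- of_real (sin ((2 * v - 1) * y - pi * of_nat k / 2)) / 4)"
  proof -
    have "?\<sigma> * (4 * of_real y ^ 2 * E2) = of_real pi * (of_real a * of_real a * of_real a powr (s - 2)) / q *
        (?\<sigma> * ((hker k v (\<i> * of_real a) + hker k v (- (\<i> * of_real a))) / 4))"
      unfolding E2_def aa by simp
    then show ?thesis
      unfolding ia ap2[symmetric] hker_imag_combine(2)[OF k ne] .
  qed
  \<comment> \<open>\<open>E1\<close> and \<open>E2\<close> are the resummed powers of
    \<open>2 * y\<close>; multiplied by the sine they become the cosine and the sine part of
    \<open>f_fun\<close>.\<close>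
  have ff: "f_fun k s v y = ?\<sigma> * (4 * of_real y ^ 2 * E1) + ?\<sigma> * (4 * of_real y ^ 2 * E2)"
    unfolding g1 g2 ap f_fun_def c_def[symmetric] q_def[symmetric] using y
    by (simp add: distrib_left mult_ac)
  have "- (?\<sigma> * (of_real pi * 2 powr s * of_real y ^ 2 / sin (of_real pi * s)) * suminf u)
     = ?\<sigma> * (4 * of_real y ^ 2 * (E1 + E2 - I))"
    unfolding S mult.assoc[of ?\<sigma>] coeff by simp
  also have "\<dots> = f_fun k s v y - ?\<sigma> * (4 * of_real y ^ 2 * I)"
    unfolding ff by (simp add: algebra_simps)
  finally show "f_fun k s v y - ?\<sigma> * (4 * of_real y ^ 2
       * (mint (mhquad k v s (2 * y))))
      = - (?\<sigma> * (of_real pi * 2 powr s * of_real y ^ 2 / sin (of_real pi * s)) * suminf u)"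
    unfolding I_def a_def by simp
qed

section \<open>The Lerch integral and the kernel integral\<close>

lemma hker_mellin_integrable:
  assumes k: "k \<le> 1" and v: "0 < v" "v \<le> 1" and s: "Re s > 1 - real k"
  shows "set_integrable lborel {0<..} (mhker k v s)"
proof -
  obtain C where C0: "C \<ge> 0" and C: "\<And>t. t > 0 \<Longrightarrow> t \<le> 1 \<Longrightarrow> norm (hker k v (of_real t)) \<le> C * t powr - (1 - real k)"
     "\<And>t. t > 0 \<Longrightarrow> 1 \<le> t \<Longrightarrow> norm (hker k v (of_real t)) \<le> C * t powr - (Re s + 1)"
    using hker_bound[OF k v, of "Re s + 1"] by blast
  show ?thesis
  proof (rule set_integrable_mellin[of _ "Re s - (1 - real k)" 1 C])
    show "continuous_on {0<..} (mhker k v s)"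
      by (intro continuous_intros hker_continuous) auto
    fix t :: real assume t: "t > 0"
    have "norm (mhker k v s t) = t powr (Re s - 1) * norm (hker k v (of_real t))"
      by (simp only: norm_mult norm_powr_pos[OF t]) simp
    also have "\<dots> \<le> C * mdom (Re s - (1 - real k)) 1 t"
    proof (cases "t \<le> 1")
      case True
      have "t powr (Re s - 1) * norm (hker k v (of_real t)) \<le> t powr (Re s - 1) * (C * t powr - (1 - real k))"
        by (intro mult_left_mono C t True) auto
      also have "\<dots> = C * (t powr (Re s - 1) * t powr - (1 - real k))" by simp
      also have "t powr (Re s - 1) * t powr - (1 - real k) = mdom (Re s - (1 - real k)) 1 t"
        using True unfolding powr_add[symmetric] mdom_def by (simp add: algebra_simps)
      finally show ?thesis .
    next
      case False
      have "t powr (Re s - 1) * norm (hker k v (of_real t)) \<le> t powr (Re s - 1) * (C * t powr - (Re s + 1))"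
        using False by (intro mult_left_mono C t) auto
      also have "\<dots> = C * (t powr (Re s - 1) * t powr - (Re s + 1))" by simp
      also have "t powr (Re s - 1) * t powr - (Re s + 1) = mdom (Re s - (1 - real k)) 1 t"
        using False unfolding powr_add[symmetric] mdom_def by (simp add: algebra_simps)
      finally show ?thesis .
    qed
    finally show "norm (mhker k v s t) \<le> C * mdom (Re s - (1 - real k)) 1 t" .
  qed (use s in auto)
qed

lemma Gamma_lerch_phi:
  assumes "Re s > 0"
  shows "Gamma s * lerch_phi ((-1) ^ k) s v = mint (mhker k v s)"
proof -
  have "s \<notin> \<int>\<^sub>\<le>\<^sub>0" using assms by (auto elim!: nonpos_Ints_cases)
  then have "Gamma s \<noteq> 0" by (simp add: Gamma_eq_zero_iff)
  moreover have "complex_of_real (exp ((1 - v) * t)) / (of_real (exp t) - (-1) ^ k) = hker k v (of_real t)" for t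
    by (simp add: hker_def flip: exp_of_real)
  ultimately show ?thesis
    unfolding lerch_phi_def times_divide_eq_right[symmetric] by simp
qed

lemma abs_ratio_le_1:
  fixes x y :: real
  assumes "0 \<le> x" "0 \<le> y"
  shows "\<bar>y / (x + y)\<bar> \<le> 1"
  using assms by (cases "x + y = 0") (auto simp: abs_of_nonneg divide_le_eq_1)

text \<open>By \<open>interpolation_identity\<close> this is the quotient of \<open>f - g\<close> by
  the sine, off 0 and the nodes.\<close>

definition kernel_integral :: "nat \<Rightarrow> complex \<Rightarrow> real \<Rightarrow> real \<Rightarrow> complex" where
  "kernel_integral k s v y = mint (mkern k v s y)"

lemma kernel_integral_minus: "kernel_integral k s v (- y) = kernel_integral k s v y"
  by (simp add: kernel_integral_def)

lemma kernel_integrable: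
  assumes k: "k \<le> 1" and v: "0 < v" "v \<le> 1" and s: "Re s > 1 - real k"
  shows "set_integrable lborel {0<..} (mkern k v s y)"
proof (rule set_integrable_bound[OF hker_mellin_integrable[OF assms]])
  have nz: "t\<^sup>2 + (2 * y)\<^sup>2 \<noteq> 0" if "t > 0" for t
    using that by (metis less_irrefl sum_power2_eq_zero_iff)
  show "set_borel_measurable lborel {0<..} (mkern k v s y)"
    by (intro set_borel_measurable_continuous continuous_intros hker_continuous) (use nz in auto)
  show "AE t in lborel. t \<in> {0<..} \<longrightarrow> norm (mkern k v s y t)
     \<le> norm (mhker k v s t)"
  proof (intro AE_I2 impI)
    fix t :: real assume "t \<in> {0<..}"
    have "\<bar>(2 * y)\<^sup>2 / (t\<^sup>2 + (2 * y)\<^sup>2)\<bar> \<le> 1" by (rule abs_ratio_le_1) auto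
    then show "norm (mkern k v s y t)
     \<le> norm (mhker k v s t)"
      unfolding norm_mult[of "_ * _"] norm_of_real by (intro mult_left_le) auto
  qed
qed

text \<open>One step of the geometric expansion: for
  \<open>r = (2 * y)\<^sup>2 / (t\<^sup>2 + (2 * y)\<^sup>2)\<close> one has
  \<open>t\<^sup>2 * r = (2 * y)\<^sup>2 * (1 - r)\<close>, so lowering the exponent by 2 splits off
  a Lerch integral.\<close>

lemma kernel_integral_reduce:
  assumes k: "k \<le> 1" and v: "0 < v" "v \<le> 1" and y: "y > 0" and s: "Re s > 3 - real k"
  shows "kernel_integral k s v y = of_real ((2 * y)\<^sup>2) * mint (mhker k v (s - 2))
     - of_real ((2 * y)\<^sup>2) * kernel_integral k (s - 2) v y"
proof -
  let ?f = "\<lambda>t. mhker k v (s - 2) t"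
  have r: "Re (s - 2) > 1 - real k" using s by simp
  note i1 = hker_mellin_integrable[OF k v r] and i2 = kernel_integrable[OF k v r, of y]
  have "kernel_integral k s v y = (LINT t:{0<..}|lborel. of_real ((2 * y)\<^sup>2) * (?f t - ?f t * of_real ((2 * y)\<^sup>2 / (t\<^sup>2 + (2 * y)\<^sup>2))))"
    unfolding kernel_integral_def
  proof (intro set_lebesgue_integral_cong allI impI)
    fix t :: real assume t: "t \<in> {0<..}"
    have pos: "t\<^sup>2 + (2 * y)\<^sup>2 > 0" using t unfolding sum_power2_gt_zero_iff by simp
    have "t\<^sup>2 * ((2 * y)\<^sup>2 / (t\<^sup>2 + (2 * y)\<^sup>2)) = (2 * y)\<^sup>2 * (1 - (2 * y)\<^sup>2 / (t\<^sup>2 + (2 * y)\<^sup>2))"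
      using pos by (simp add: field_simps)
    from arg_cong[OF this, of complex_of_real]
    have N: "of_real t ^ 2 * of_real ((2 * y)\<^sup>2 / (t\<^sup>2 + (2 * y)\<^sup>2)) = complex_of_real ((2 * y)\<^sup>2) * (1 - of_real ((2 * y)\<^sup>2 / (t\<^sup>2 + (2 * y)\<^sup>2)))"
      by (simp only: of_real_mult of_real_power of_real_diff of_real_1)
    have p: "complex_of_real t powr (s - 1) = complex_of_real t powr (s - 2 - 1) * of_real t ^ 2"
      using t by (intro powr_shift_square) auto
    have "mkern k v s y t
       = ?f t * (of_real t ^ 2 * of_real ((2 * y)\<^sup>2 / (t\<^sup>2 + (2 * y)\<^sup>2)))"
      unfolding p by (simp only: mult_ac)
    also have "\<dots> = of_real ((2 * y)\<^sup>2) * (?f t - ?f t * of_real ((2 * y)\<^sup>2 / (t\<^sup>2 + (2 * y)\<^sup>2)))"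
      unfolding N right_diff_distrib by (simp only: mult_ac mult_1)
    finally show "mkern k v s y t
       = of_real ((2 * y)\<^sup>2) * (?f t - ?f t * of_real ((2 * y)\<^sup>2 / (t\<^sup>2 + (2 * y)\<^sup>2)))" .
  qed auto
  also have "\<dots> = of_real ((2 * y)\<^sup>2) * ((LINT t:{0<..}|lborel. ?f t) - kernel_integral k (s - 2) v y)"
    unfolding kernel_integral_def by (simp only: set_integral_mult_right set_integral_diff(2)[OF i1 i2])
  finally show ?thesis by (simp only: right_diff_distrib)
qed

text \<open>Iterates the reduction. The exponent stays above \<open>1 - k\<close> throughout, so
  each integral split off converges and is a Gamma factor times a Lerch value.\<close>

lemma kernel_integral_expand:
  assumes k: "k \<le> 1" and v: "0 < v" "v \<le> 1" and y: "y > 0" and s: "Re s - 2 * real m > 1 - real k"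
  shows "kernel_integral k s v y =
     (\<Sum>j=1..m. (-1) ^ (j - 1) * Gamma (s - 2 * of_nat j) * lerch_phi ((-1) ^ k) (s - 2 * of_nat j) v * of_real ((2 * y) ^ (2 * j)))
     + (-1) ^ m * of_real ((2 * y) ^ (2 * m)) * kernel_integral k (s - 2 * of_nat m) v y"
  using s
proof (induction m)
  case 0
  then show ?case by simp
next
  case (Suc m)
  have "real k \<le> 1" using k by simp
  then have r: "Re (s - 2 * of_nat (Suc m)) > 0" using Suc.prems by simp
  have e: "s - 2 * of_nat m - 2 = s - 2 * of_nat (Suc m)" by simp
  have "kernel_integral k (s - 2 * of_nat m) v y = of_real ((2 * y)\<^sup>2) * (Gamma (s - 2 * of_nat (Suc m)) * lerch_phi ((-1) ^ k) (s - 2 * of_nat (Suc m)) v)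
     - of_real ((2 * y)\<^sup>2) * kernel_integral k (s - 2 * of_nat (Suc m)) v y"
    using kernel_integral_reduce[OF k v y, of "s - 2 * of_nat m"] Suc.prems unfolding e Gamma_lerch_phi[OF r] by simp
  moreover have "(2 * y) ^ (2 * Suc m) = (2 * y) ^ (2 * m) * (2 * y)\<^sup>2" by (simp add: power_add power2_eq_square)
  moreover have "(-1) ^ m * P * (Y * G - Y * K) = (-1) ^ m * G * (P * Y) + (-1) ^ Suc m * (P * Y) * K" for P Y G K :: complex
    by (simp add: algebra_simps)
  moreover have "Re s - 2 * real m > 1 - real k" using Suc.prems by simp
  moreover note Suc.IH
  ultimately show ?case
    by (simp only: sum.cl_ivl_Suc if_False not_less le_simps diff_Suc_1 of_real_mult mult.assoc add.assoc) simp
qed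

section \<open>The entire extension\<close>

lemma has_exponential_type_const: "has_exponential_type (\<lambda>z. c) 0"
  unfolding has_exponential_type_def
proof (intro allI impI exI[of _ "norm c + 1"] conjI)
  fix \<epsilon> :: real and z :: complex assume "\<epsilon> > 0"
  then have "(norm c + 1) * 1 \<le> (norm c + 1) * exp ((0 + \<epsilon>) * norm z)" by (intro mult_left_mono) auto
  then show "norm c \<le> (norm c + 1) * exp ((0 + \<epsilon>) * norm z)" by simp
qed (simp add: add_nonneg_pos)

lemma has_exponential_type_ident: "has_exponential_type (\<lambda>z. z) 0"
  unfolding has_exponential_type_def
proof (intro allI impI)
  fix \<epsilon> :: real assume e: "\<epsilon> > 0"
  show "\<exists>C>0. \<forall>z::complex. norm z \<le> C * exp ((0 + \<epsilon>) * norm z)"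
  proof (intro exI[of _ "1 / \<epsilon>"] conjI allI)
    fix z :: complex
    have "\<epsilon> * norm z \<le> exp (\<epsilon> * norm z)" using exp_ge_add_one_self[of "\<epsilon> * norm z"] by linarith
    then show "norm z \<le> 1 / \<epsilon> * exp ((0 + \<epsilon>) * norm z)" using e by (simp add: field_simps)
  qed (use e in auto)
qed

lemma has_exponential_type_add:
  assumes "has_exponential_type f \<sigma>" "has_exponential_type g \<sigma>"
  shows "has_exponential_type (\<lambda>z. f z + g z) \<sigma>"
  unfolding has_exponential_type_def
proof (intro allI impI)
  fix \<epsilon> :: real assume e: "\<epsilon> > 0"
  obtain C where C: "C > 0" "\<And>z. norm (f z) \<le> C * exp ((\<sigma> + \<epsilon>) * norm z)"
    using assms(1) e unfolding has_exponential_type_def by blast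
  obtain D where D: "D > 0" "\<And>z. norm (g z) \<le> D * exp ((\<sigma> + \<epsilon>) * norm z)"
    using assms(2) e unfolding has_exponential_type_def by blast
  show "\<exists>C>0. \<forall>z. norm (f z + g z) \<le> C * exp ((\<sigma> + \<epsilon>) * norm z)"
  proof (intro exI[of _ "C + D"] conjI allI)
    show "norm (f z + g z) \<le> (C + D) * exp ((\<sigma> + \<epsilon>) * norm z)" for z
      using norm_triangle_ineq[of "f z" "g z"] C(2)[of z] D(2)[of z] by (simp add: distrib_right)
  qed (use C D in auto)
qed

lemma has_exponential_type_mult:
  assumes "has_exponential_type f \<sigma>" "has_exponential_type g \<tau>"
  shows "has_exponential_type (\<lambda>z. f z * g z) (\<sigma> + \<tau>)"
  unfolding has_exponential_type_def
proof (intro allI impI)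
  fix \<epsilon> :: real assume e: "\<epsilon> > 0"
  then have e2: "\<epsilon> / 2 > 0" by simp
  obtain C where C: "C > 0" "\<And>z. norm (f z) \<le> C * exp ((\<sigma> + \<epsilon> / 2) * norm z)"
    using assms(1) e2 unfolding has_exponential_type_def by blast
  obtain D where D: "D > 0" "\<And>z. norm (g z) \<le> D * exp ((\<tau> + \<epsilon> / 2) * norm z)"
    using assms(2) e2 unfolding has_exponential_type_def by blast
  show "\<exists>C>0. \<forall>z. norm (f z * g z) \<le> C * exp ((\<sigma> + \<tau> + \<epsilon>) * norm z)"
  proof (intro exI[of _ "C * D"] conjI allI)
    fix z
    have "norm (f z * g z) \<le> (C * exp ((\<sigma> + \<epsilon> / 2) * norm z)) * (D * exp ((\<tau> + \<epsilon> / 2) * norm z))"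
      unfolding norm_mult using C(1) by (intro mult_mono C D) auto
    also have "\<dots> = C * D * exp ((\<sigma> + \<epsilon> / 2) * norm z + (\<tau> + \<epsilon> / 2) * norm z)" by (simp add: exp_add)
    also have "(\<sigma> + \<epsilon> / 2) * norm z + (\<tau> + \<epsilon> / 2) * norm z = (\<sigma> + \<tau> + \<epsilon>) * norm z" by (simp add: algebra_simps)
    finally show "norm (f z * g z) \<le> C * D * exp ((\<sigma> + \<tau> + \<epsilon>) * norm z)" .
  qed (use C D in auto)
qed

lemma has_exponential_type_cmult:
  "has_exponential_type f \<sigma> \<Longrightarrow> has_exponential_type (\<lambda>z. c * f z) \<sigma>"
  using has_exponential_type_mult[OF has_exponential_type_const[of c], of f \<sigma>] by simp

lemma has_exponential_type_power: "has_exponential_type (\<lambda>z. z ^ n) 0"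
proof (induction n)
  case (Suc n)
  then show ?case using has_exponential_type_mult[OF has_exponential_type_ident Suc] by simp
qed (simp add: has_exponential_type_const)

lemma has_exponential_type_sum:
  "(\<And>i. i \<in> I \<Longrightarrow> has_exponential_type (f i) 0) \<Longrightarrow> has_exponential_type (\<lambda>z. \<Sum>i\<in>I. f i z) 0"
  by (induction I rule: infinite_finite_induct) (auto simp: has_exponential_type_const has_exponential_type_add)

lemma has_exponential_type_bounded_by_exp_Im:
  assumes "\<And>z. norm (f z) \<le> A * exp \<bar>Im z\<bar>"
  shows "has_exponential_type f 1"
  unfolding has_exponential_type_def
proof (intro allI impI exI[of _ "\<bar>A\<bar> + 1"] conjI)
  fix \<epsilon> :: real and z :: complex assume e: "\<epsilon> > 0"
  have "norm (f z) \<le> A * exp \<bar>Im z\<bar>" by (rule assms)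
  also have "\<dots> \<le> (\<bar>A\<bar> + 1) * exp ((1 + \<epsilon>) * norm z)"
  proof (rule mult_mono)
    have "\<bar>Im z\<bar> \<le> norm z" by (rule abs_Im_le_cmod)
    also have "\<dots> \<le> (1 + \<epsilon>) * norm z" using e by (simp add: distrib_right)
    finally show "exp \<bar>Im z\<bar> \<le> exp ((1 + \<epsilon>) * norm z)" by simp
  qed auto
  finally show "norm (f z) \<le> (\<bar>A\<bar> + 1) * exp ((1 + \<epsilon>) * norm z)" .
qed auto

lemma has_exponential_type_sin_shift: "has_exponential_type (\<lambda>z. sin (z + of_real b)) 1"
proof (rule has_exponential_type_bounded_by_exp_Im[of _ 1])
  show "norm (sin (z + of_real b)) \<le> 1 * exp \<bar>Im z\<bar>" for z
    using norm_sin_cos_le_exp(1)[of "z + of_real b"] by simp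
qed

text \<open>The entire function \<open>sin (z + \<pi>k/2) / (z\<^sup>2 - a\<^sup>2)\<close>, for a node \<open>a \<noteq> 0\<close>, by partial fractions.\<close>
definition csin_quot :: "nat \<Rightarrow> real \<Rightarrow> complex \<Rightarrow> complex" where
  "csin_quot k a z = (of_real (cos (a + pi * of_nat k / 2)) * csinc (z - of_real a)
      - of_real (cos (pi * of_nat k / 2 - a)) * csinc (z + of_real a)) / of_real (2 * a)"

lemma csin_quot_holomorphic [holomorphic_intros]: "csin_quot k a holomorphic_on A"
proof (cases "a = 0")
  case True
  then have "csin_quot k a = (\<lambda>z. 0)" by (simp add: csin_quot_def fun_eq_iff)
  then show ?thesis by simp
next
  case False
  then show ?thesis unfolding csin_quot_def[abs_def] by (intro holomorphic_intros) auto
qed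

lemma norm_csin_quot_le:
  assumes "a > 0"
  shows "norm (csin_quot k a z) \<le> exp \<bar>Im z\<bar> / a"
proof -
  have "norm (complex_of_real (cos b) * csinc w) \<le> 1 * exp \<bar>Im w\<bar>" for b w
    unfolding norm_mult norm_of_real by (intro mult_mono norm_csinc_le) auto
  from this[of "a + pi * of_nat k / 2" "z - of_real a"] this[of "pi * of_nat k / 2 - a" "z + of_real a"]
  have "norm (of_real (cos (a + pi * of_nat k / 2)) * csinc (z - of_real a)
      - of_real (cos (pi * of_nat k / 2 - a)) * csinc (z + of_real a)) \<le> exp \<bar>Im z\<bar> + exp \<bar>Im z\<bar>"
    by (intro order_trans[OF norm_triangle_ineq4] add_mono) auto
  then show ?thesis using assms by (simp add: csin_quot_def norm_divide field_simps)
qed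

lemma node_sin_zero: "sin (node k n + pi * of_nat k / 2) = 0" "sin (pi * of_nat k / 2 - node k n) = 0"
proof -
  have 1: "node k n + pi * of_nat k / 2 = of_int (n + int k) * pi" by (simp add: node_def algebra_simps)
  have 2: "pi * of_nat k / 2 - node k n = of_int (- n) * pi" by (simp add: node_def algebra_simps)
  show "sin (node k n + pi * of_nat k / 2) = 0" "sin (pi * of_nat k / 2 - node k n) = 0"
    unfolding 1 2 by (simp_all only: sin_zero_iff_int2) blast+
qed

text \<open>For a node \<open>a\<close> the shifted sine vanishes at \<open>a\<close> and
  \<open>-a\<close>, hence is a constant multiple of \<open>sin (z - a)\<close> and also of
  \<open>sin (z + a)\<close>, with the two cosines of \<open>csin_quot\<close> as factors.\<close>

lemma csin_quot_mult:
  assumes "node k n \<noteq> 0"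
  shows "csin_quot k (node k n) z * (z\<^sup>2 - (of_real (node k n))\<^sup>2) = sin (z + of_real (pi * of_nat k / 2))"
proof -
  define a where "a = node k n"
  define b where "b = pi * of_nat k / 2"
  have s: "sin (a + b) = 0" "sin (b - a) = 0" using node_sin_zero[of k n] by (simp_all add: a_def b_def)
  have 1: "sin (z + of_real b) = sin (z - of_real a) * of_real (cos (a + b))"
  proof -
    have "z + of_real b = (z - of_real a) + of_real (a + b)" by simp
    then show ?thesis unfolding \<open>z + of_real b = _\<close> sin_add using s by (simp only: sin_of_real cos_of_real) simp
  qed
  have 2: "sin (z + of_real b) = sin (z + of_real a) * of_real (cos (b - a))"
  proof -
    have "z + of_real b = (z + of_real a) + of_real (b - a)" by simp
    then show ?thesis unfolding \<open>z + of_real b = _\<close> sin_add using s by (simp only: sin_of_real cos_of_real) simp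
  qed
  have "csin_quot k a z * (z\<^sup>2 - (of_real a)\<^sup>2) = (of_real (cos (a + b)) * ((z - of_real a) * csinc (z - of_real a)) * (z + of_real a)
     - of_real (cos (b - a)) * ((z + of_real a) * csinc (z + of_real a)) * (z - of_real a)) / of_real (2 * a)"
    by (simp add: csin_quot_def b_def[symmetric] power2_eq_square algebra_simps)
  also have "\<dots> = (sin (z - of_real a) * of_real (cos (a + b)) * (z + of_real a) - sin (z + of_real a) * of_real (cos (b - a)) * (z - of_real a)) / of_real (2 * a)"
    unfolding csinc_mult by (simp only: mult.commute)
  also have "\<dots> = sin (z + of_real b) * (2 * of_real a) / of_real (2 * a)"
    unfolding 1[symmetric] 2[symmetric] by (simp add: algebra_simps)
  also have "\<dots> = sin (z + of_real b)" using assms by (simp add: a_def)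
  finally show ?thesis by (simp add: a_def b_def)
qed

lemma csinc_of_real: "csinc (of_real x) = of_real (if x = 0 then 1 else sin x / x)"
  by (simp add: csinc_def sin_of_real)

lemma csin_quot_real: "csin_quot k a (of_real x) = of_real (Re (csin_quot k a (of_real x)))"
proof -
  have "csin_quot k a (of_real x) \<in> \<real>"
    unfolding csin_quot_def of_real_diff[symmetric] of_real_add[symmetric] csinc_of_real
    by (intro Reals_divide Reals_diff Reals_mult Reals_of_real)
  then show ?thesis by (simp add: complex_is_Real_iff complex_eq_iff)
qed

text \<open>Identifies the limit in \<open>sin_quot\<close> with a value of the entire function:
  near \<open>y = a\<close> or \<open>y = -a\<close> the quotient agrees with
  \<open>csin_quot\<close> off \<open>y\<close> itself, because \<open>a \<noteq> 0\<close> keeps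
  the other zero \<open>-y\<close> of the denominator away.\<close>

lemma csin_quot_of_real:
  assumes "node k n \<noteq> 0"
  shows "csin_quot k (node k n) (of_real y) = of_real (sin_quot k (node k n) y)"
proof -
  define a where "a = node k n"
  define q where "q = (\<lambda>x. sin (x + pi * of_nat k / 2) / (x\<^sup>2 - a\<^sup>2))"
  have q: "q x = Re (csin_quot k a (of_real x))" if "x\<^sup>2 \<noteq> a\<^sup>2" for x
  proof -
    have "csin_quot k a (of_real x) * of_real (x\<^sup>2 - a\<^sup>2) = of_real (sin (x + pi * of_nat k / 2))"
      using csin_quot_mult[OF assms, of "of_real x"] by (simp add: a_def flip: sin_of_real)
    then have "Re (csin_quot k a (of_real x)) * (x\<^sup>2 - a\<^sup>2) = sin (x + pi * of_nat k / 2)"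
      by (metis Re_complex_of_real csin_quot_real of_real_mult)
    then show ?thesis using that by (simp add: q_def field_simps)
  qed
  have "sin_quot k a y = Re (csin_quot k a (of_real y))"
  proof (cases "y\<^sup>2 = a\<^sup>2")
    case False
    then show ?thesis using q[OF False] by (simp add: sin_quot_def q_def)
  next
    case True
    have a0: "a \<noteq> 0" using assms by (simp add: a_def)
    have "isCont (csin_quot k a) (of_real y)"
      using csin_quot_holomorphic[of k a UNIV] holomorphic_on_imp_continuous_on continuous_on_eq_continuous_at by blast
    then have "isCont (\<lambda>x. csin_quot k a (of_real x)) y"
      by (rule isCont_o2[rotated]) (intro continuous_intros)
    then have "((\<lambda>x. Re (csin_quot k a (of_real x))) \<longlongrightarrow> Re (csin_quot k a (of_real y))) (at y)"
      unfolding isCont_def by (rule tendsto_Re)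
    moreover have "\<forall>\<^sub>F x in at y. Re (csin_quot k a (of_real x)) = q x"
    proof -
      have "y \<noteq> - y" using True a0 by auto
      have "\<forall>\<^sub>F x in at y. x \<noteq> - y" 
        by (rule tendsto_imp_eventually_ne[OF tendsto_ident_at \<open>y \<noteq> - y\<close>])
      moreover have "\<forall>\<^sub>F x in at y. x \<noteq> y" by (simp add: eventually_at_filter)
      ultimately show ?thesis
      proof eventually_elim
        case (elim x)
        then have "x\<^sup>2 \<noteq> a\<^sup>2" unfolding True[symmetric] by (simp add: power2_eq_iff)
        then show ?case using q by simp
      qed
    qed
    ultimately have "(q \<longlongrightarrow> Re (csin_quot k a (of_real y))) (at y)"
      by (rule Lim_transform_eventually)
    then have "Lim (at y) q = Re (csin_quot k a (of_real y))"
      by (intro tendsto_Lim) auto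
    then show ?thesis using True by (simp add: sin_quot_def q_def)
  qed
  then show ?thesis using csin_quot_real[of k a y] by (simp add: a_def)
qed

lemma node_freq: "k \<le> 1 \<Longrightarrow> node k (int (i + (1 - k))) = freq k i / 2"
  by (auto simp: node_def freq_def field_simps of_nat_diff)

definition gcoef :: "nat \<Rightarrow> complex \<Rightarrow> real \<Rightarrow> nat \<Rightarrow> complex" where
  "gcoef k s v i = of_real (freq k i / 2) powr (s - 2 * of_nat (m_index k s) - 1)
     * sin (of_real (freq k i) * of_real v + of_real pi * s / 2)"

lemma g_term_eq:
  assumes "k \<le> 1"
  shows "g_term k s v y (i + (1 - k)) = gcoef k s v i * csin_quot k (freq k i / 2) (of_real y)"
proof -
  have n0: "node k (int (i + (1 - k))) \<noteq> 0"
    unfolding node_freq[OF assms] using freq_pos[OF assms, of i] by simp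
  have "pi * (2 * of_nat (i + (1 - k)) + of_nat k) = freq k i"
    using assms by (auto simp: freq_def algebra_simps of_nat_diff)
  then have "of_real (pi * (2 * of_nat (i + (1 - k)) + of_nat k) * v) = complex_of_real (freq k i) * of_real v"
    by simp
  then show ?thesis
    unfolding g_term_def csin_quot_of_real[OF n0, symmetric] unfolding node_freq[OF assms] gcoef_def
    by (simp only:)
qed

text \<open>The sine factor is bounded, since the imaginary part of its argument is the same for all
  \<open>i\<close>. The terms are of order \<open>Re s - 2 * m_index k s - 4 < -1\<close> in the
  node; with the square instead of the cube this would fail once the shifted real part reaches
  2.\<close>

lemma gcoef_summable:
  assumes k: "k \<le> 1" and s: "Re s - 2 * real (m_index k s) < 3"
  shows "summable (\<lambda>i. norm (gcoef k s v i) / (freq k i / 2) ^ 3)"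
proof -
  define p where "p = Re s - 2 * real (m_index k s) - 4"
  have p: "p < -1" using s by (simp add: p_def)
  define B where "B = exp \<bar>Im (of_real pi * s / 2)\<bar>"
  have \<alpha>: "freq k i / 2 \<ge> real (Suc i)" for i
  proof -
    have "real k \<le> 1" using k by simp
    then have "2 * real (Suc i) \<le> 3 * (2 * real i + 2 - real k)" by simp
    also have "\<dots> \<le> pi * (2 * real i + 2 - real k)"
      using pi_gt3 k by (intro mult_right_mono) auto
    finally show ?thesis by (simp add: freq_def)
  qed
  have "summable (\<lambda>i. real (Suc i) powr p)"
    using p summable_Suc_iff[of "\<lambda>n. real n powr p"] by (simp add: summable_real_powr_iff)
  then have "summable (\<lambda>i. B * real (Suc i) powr p)" by (rule summable_mult)
  then show ?thesis
  proof (rule summable_comparison_test[rotated], intro exI allI impI)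
    fix i
    have a0: "freq k i / 2 > 0" using freq_pos[OF k, of i] by simp
    have "norm (sin (of_real (freq k i) * of_real v + of_real pi * s / 2)) \<le> B"
      using norm_sin_cos_le_exp(1)[of "of_real (freq k i) * of_real v + of_real pi * s / 2"] by (simp add: B_def)
    moreover have "norm (complex_of_real (freq k i / 2) powr (s - 2 * of_nat (m_index k s) - 1)) = (freq k i / 2) powr (p + 3)"
      unfolding norm_powr_pos[OF a0] by (simp add: p_def)
    ultimately have "norm (gcoef k s v i) \<le> (freq k i / 2) powr (p + 3) * B"
      unfolding gcoef_def norm_mult by (simp add: mult_left_mono)
    also have "(freq k i / 2) powr (p + 3) = (freq k i / 2) powr p * (freq k i / 2) ^ 3"
      using a0 by (simp add: powr_add powr_numeral)
    finally have "norm (gcoef k s v i) / (freq k i / 2) ^ 3 \<le> B * (freq k i / 2) powr p"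
      using a0 by (simp add: pos_divide_le_eq mult_ac)
    also have "(freq k i / 2) powr p \<le> real (Suc i) powr p"
      using \<alpha>[of i] p by (intro powr_mono2') auto
    then have "B * (freq k i / 2) powr p \<le> B * real (Suc i) powr p" by (intro mult_left_mono) (auto simp: B_def)
    finally show "norm (norm (gcoef k s v i) / (freq k i / 2) ^ 3) \<le> B * real (Suc i) powr p"
      using a0 by simp
  qed
qed

text \<open>\<open>csin_quot\<close> gains a factor \<open>1 / a\<close>, so after division of the
  coefficients by the square of the node the series converges absolutely and locally uniformly, with
  growth \<open>exp \<bar>Im z\<bar>\<close>.\<close>

lemma csin_quot_series:
  fixes c :: "nat \<Rightarrow> complex"
  assumes k: "k \<le> 1" and c: "summable (\<lambda>i. norm (c i) / (freq k i / 2) ^ 3)"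
  defines "V \<equiv> \<lambda>z. \<Sum>i. c i / of_real (freq k i / 2) ^ 2 * csin_quot k (freq k i / 2) z"
  shows "summable (\<lambda>i. c i / of_real (freq k i / 2) ^ 2 * csin_quot k (freq k i / 2) z)"
    and "V holomorphic_on UNIV"
    and "norm (V z) \<le> (\<Sum>i. norm (c i) / (freq k i / 2) ^ 3) * exp \<bar>Im z\<bar>"
proof -
  let ?t = "\<lambda>i z. c i / of_real (freq k i / 2) ^ 2 * csin_quot k (freq k i / 2) z"
  have b: "norm (?t i z) \<le> norm (c i) / (freq k i / 2) ^ 3 * exp \<bar>Im z\<bar>" for i z
  proof -
    have a0: "freq k i / 2 > 0" using freq_pos[OF k, of i] by simp
    have "norm (?t i z) = norm (c i) / (freq k i / 2) ^ 2 * norm (csin_quot k (freq k i / 2) z)"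
      using a0 by (simp only: norm_mult norm_divide norm_power norm_of_real abs_of_pos)
    also have "\<dots> \<le> norm (c i) / (freq k i / 2) ^ 2 * (exp \<bar>Im z\<bar> / (freq k i / 2))"
      by (intro mult_left_mono norm_csin_quot_le a0) auto
    also have "\<dots> = norm (c i) / (freq k i / 2) ^ 3 * exp \<bar>Im z\<bar>"
    proof -
      have "x / a ^ 2 * (e / a) = x / a ^ 3 * e" for x a e :: real
        by (simp add: power3_eq_cube power2_eq_square)
      then show ?thesis .
    qed
    finally show ?thesis .
  qed
  have sm: "summable (\<lambda>i. norm (c i) / (freq k i / 2) ^ 3 * exp \<bar>Im z\<bar>)" for z
    by (rule summable_mult2[OF c])
  have ns: "summable (\<lambda>i. norm (?t i z))" for z
    by (rule summable_comparison_test[OF _ sm]) (use b in auto)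
  then show "summable (\<lambda>i. ?t i z)" by (rule summable_norm_cancel)
  have "norm (V z) \<le> (\<Sum>i. norm (?t i z))" unfolding V_def by (rule summable_norm[OF ns])
  also have "\<dots> \<le> (\<Sum>i. norm (c i) / (freq k i / 2) ^ 3 * exp \<bar>Im z\<bar>)" by (rule suminf_le[OF b ns sm])
  also have "\<dots> = (\<Sum>i. norm (c i) / (freq k i / 2) ^ 3) * exp \<bar>Im z\<bar>" by (rule suminf_mult2[OF c, symmetric])
  finally show "norm (V z) \<le> (\<Sum>i. norm (c i) / (freq k i / 2) ^ 3) * exp \<bar>Im z\<bar>" .
  show "V holomorphic_on UNIV"
  proof (rule holomorphic_uniform_sequence[where f = "\<lambda>n z. \<Sum>i<n. ?t i z"])
    show "(\<lambda>z. \<Sum>i<n. ?t i z) holomorphic_on UNIV" for n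
      by (intro holomorphic_intros)
    fix x :: complex
    have "uniform_limit (cball x 1) (\<lambda>n z. \<Sum>i<n. ?t i z) V sequentially"
      unfolding V_def
    proof (rule Weierstrass_m_test)
      show "summable (\<lambda>i. norm (c i) / (freq k i / 2) ^ 3 * exp (\<bar>Im x\<bar> + 1))" by (rule summable_mult2[OF c])
      fix i z assume "z \<in> cball x 1"
      then have "\<bar>Im (x - z)\<bar> \<le> 1" using abs_Im_le_cmod[of "x - z"] by (simp add: dist_norm)
      then have "\<bar>Im z\<bar> \<le> \<bar>Im x\<bar> + 1" by simp
      then have "norm (c i) / (freq k i / 2) ^ 3 * exp \<bar>Im z\<bar> \<le> norm (c i) / (freq k i / 2) ^ 3 * exp (\<bar>Im x\<bar> + 1)"
        using freq_pos[OF k, of i] by (intro mult_left_mono) auto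
      then show "norm (?t i z) \<le> norm (c i) / (freq k i / 2) ^ 3 * exp (\<bar>Im x\<bar> + 1)"
        using b[of i z] by linarith
    qed
    then show "\<exists>d>0. cball x d \<subseteq> UNIV \<and> uniform_limit (cball x d) (\<lambda>n z. \<Sum>i<n. ?t i z) V sequentially"
      by (intro exI[of _ 1]) auto
  qed auto
qed

section \<open>Reduction to the strip and the identity for all y\<close>

lemma sin_cos_add_nat_pi:
  "sin (x + of_nat m * of_real pi) = (-1) ^ m * sin (x :: complex)"
  "cos (x + of_nat m * of_real pi) = (-1) ^ m * cos (x :: complex)"
proof -
  have p: "sin (complex_of_real pi) = 0" "cos (complex_of_real pi) = -1"
    by (simp_all add: sin_of_real cos_of_real)
  have "sin (x + of_nat m * of_real pi) = (-1) ^ m * sin x \<and> cos (x + of_nat m * of_real pi) = (-1) ^ m * cos x"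
  proof (induction m)
    case (Suc m)
    have e: "x + of_nat (Suc m) * of_real pi = (x + of_nat m * of_real pi) + of_real pi" by (simp add: distrib_right)
    show ?case unfolding e sin_add[of _ "of_real pi"] cos_add[of _ "of_real pi"] p using Suc by simp
  qed simp
  then show "sin (x + of_nat m * of_real pi) = (-1) ^ m * sin x" "cos (x + of_nat m * of_real pi) = (-1) ^ m * cos x"
    by auto
qed

text \<open>The floor in \<open>m_index\<close> puts the real part of \<open>s'\<close> into a
  half-open strip of width 2; the values of \<open>Re s\<close> excluded by admissibility remove its
  closed end. For \<open>k = 0\<close>, \<open>v = 1\<close> the prescribed interval of
  \<open>Re s\<close> is the lower half of the strip.\<close>

lemma admissible_facts:
  assumes adm: "admissible k s v"
  defines "s' \<equiv> s - 2 * of_nat (m_index k s)"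
  shows "k \<le> 1" "0 < v" "v \<le> 1" "k = 0 \<Longrightarrow> 1 < Re s' \<and> Re s' < 3" "k = 1 \<Longrightarrow> 0 < Re s' \<and> Re s' < 2" "v = 1 \<Longrightarrow> Re s' < 2"
    "s' \<noteq> 1" "s' \<noteq> 2" "Re s > 1 - real k" "sin (of_real pi * s) \<noteq> 0"
proof -
  have cases: "(k = 0 \<and> v \<in> {0<..<1} \<and> Re s > 1 \<and> (\<forall>d::nat. Re s \<noteq> 3 + 2 * of_nat d) \<and> (\<forall>n::nat. n \<ge> 1 \<longrightarrow> s \<noteq> of_nat n))
   \<or> (k = 0 \<and> v = 1 \<and> (\<exists>d::nat. Re s \<in> {1 + 2 * of_nat d <..< 2 + 2 * of_nat d}))
   \<or> (k = 1 \<and> v \<in> {0<..1} \<and> Re s > 0 \<and> (\<forall>d::nat. Re s \<noteq> 2 + 2 * of_nat d) \<and> (\<forall>n::nat. n \<ge> 1 \<longrightarrow> s \<noteq> of_nat n))"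
    using adm unfolding admissible_def .
  then show "k \<le> 1" "0 < v" "v \<le> 1" by auto
  show res: "Re s > 1 - real k" using cases by auto
  define m where "m = m_index k s"
  have Re': "Re s' = Re s - 2 * real m" by (simp add: s'_def m_def)
  have m0: "real m = of_int \<lfloor>(Re s - 1) / 2\<rfloor>" if "k = 0"
    using that res by (simp add: m_def m_index_def)
  have m1: "real m = of_int \<lfloor>Re s / 2\<rfloor>" if "k = 1"
    using that res by (simp add: m_def m_index_def)
  have fl: "real m \<le> x \<and> x < real m + 1" if "real m = of_int \<lfloor>x\<rfloor>" for x
    unfolding that by (simp add: real_of_int_floor_add_one_gt)
  have b0: "1 \<le> Re s'" "Re s' < 3" if "k = 0"
    using fl[OF m0[OF that]] unfolding Re' by (auto simp: field_simps)
  have b1: "0 \<le> Re s'" "Re s' < 2" if "k = 1"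
    using fl[OF m1[OF that]] unfolding Re' by (auto simp: field_simps)
  have md: "m = d" if "k = 0" "Re s \<in> {1 + 2 * of_nat d <..< 2 + 2 * of_nat d}" for d :: nat
  proof -
    have "\<lfloor>(Re s - 1) / 2\<rfloor> = int d" using that(2) by (intro floor_unique) auto
    then show ?thesis using m0[OF that(1)] by simp
  qed
  \<comment> \<open>For \<open>k = 0\<close>, \<open>v = 1\<close> the integers are excluded by the
    open interval between the consecutive integers \<open>1 + 2 * d\<close> and
    \<open>2 + 2 * d\<close>.\<close>
  have noint: "s \<noteq> of_nat n" if "n \<ge> 1" for n :: nat
    using cases
  proof (elim disjE conjE exE)
    fix d :: nat assume "Re s \<in> {1 + 2 * of_nat d <..< 2 + 2 * of_nat d}"
    then have b: "real (1 + 2 * d) < Re s" "Re s < real (2 + 2 * d)" by auto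
    show ?thesis
    proof
      assume "s = of_nat n"
      then have "Re s = real n" by simp
      then have "1 + 2 * d < n" "n < 2 + 2 * d" using b by (simp_all only: of_nat_less_iff)
      then show False by simp
    qed
  qed (use that in auto)
  show "k = 0 \<Longrightarrow> 1 < Re s' \<and> Re s' < 3"
  proof -
    assume k: "k = 0"
    have "Re s' \<noteq> 1"
    proof
      assume 1: "Re s' = 1"
      then have re: "Re s = 1 + 2 * real m" by (simp add: Re')
      from cases k consider "\<forall>d::nat. Re s \<noteq> 3 + 2 * of_nat d" | d :: nat where "Re s \<in> {1 + 2 * of_nat d <..< 2 + 2 * of_nat d}" by auto
      then show False
      proof cases
        case 1
        have "m \<noteq> 0" using re res k by auto
        then obtain d where "m = Suc d" using not0_implies_Suc by blast
        then show False using 1 re by auto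
      next
        case 2
        then show False using md[OF k 2] re by auto
      qed
    qed
    then show "1 < Re s' \<and> Re s' < 3" using b0[OF k] by auto
  qed
  show "k = 1 \<Longrightarrow> 0 < Re s' \<and> Re s' < 2"
  proof -
    assume k: "k = 1"
    have "Re s' \<noteq> 0"
    proof
      assume "Re s' = 0"
      then have re: "Re s = 2 * real m" by (simp add: Re')
      have "m \<noteq> 0" using re res k by auto
      then obtain d where "m = Suc d" using not0_implies_Suc by blast
      then have "Re s = 2 + 2 * of_nat d" using re by simp
      then show False using cases k by auto
    qed
    then show "0 < Re s' \<and> Re s' < 2" using b1[OF k] by auto
  qed
  show "v = 1 \<Longrightarrow> Re s' < 2"
  proof -
    assume v: "v = 1"
    show "Re s' < 2"
    proof (cases "k = 1")
      case False
      then have k: "k = 0" using \<open>k \<le> 1\<close> by auto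
      then obtain d :: nat where d: "Re s \<in> {1 + 2 * of_nat d <..< 2 + 2 * of_nat d}" using cases v by auto
      then show ?thesis using md[OF k d] by (simp add: Re')
    qed (use b1 in auto)
  qed
  show "s' \<noteq> 1" "s' \<noteq> 2"
    using noint[of "2 * m + 1"] noint[of "2 * m + 2"] by (auto simp: s'_def m_def algebra_simps)
  show "sin (of_real pi * s) \<noteq> 0"
  proof
    assume "sin (of_real pi * s) = 0"
    then obtain n :: int where "of_real pi * s = of_real (of_int n * pi)" by (auto simp: sin_eq_0)
    then have sn: "s = of_int n" by simp
    have "real k \<le> 1" using \<open>k \<le> 1\<close> by simp
    then have "0 < n" using sn res by simp
    then have "s = of_nat (nat n)" "nat n \<ge> 1" using sn by auto
    then show False using noint by blast
  qed
qed

lemma sin_shift_minus: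
  "k \<le> 1 \<Longrightarrow> sin (- y + pi * of_nat k / 2) = - ((-1) ^ k) * sin (y + pi * of_nat k / 2)"
proof -
  assume "k \<le> 1"
  then have "k = 0 \<or> k = 1" by auto
  then show ?thesis by (auto simp: sin_add sin_diff)
qed

lemma csin_quot_minus:
  assumes "k \<le> 1"
  shows "csin_quot k a (- z) = - ((-1) ^ k) * csin_quot k a z"
proof -
  have ev: "csinc (- w) = csinc w" for w by (simp add: csinc_def)
  have "csinc (- z - of_real a) = csinc (z + of_real a)" "csinc (- z + of_real a) = csinc (z - of_real a)"
    using ev[of "z + of_real a"] ev[of "z - of_real a"] by simp_all
  moreover have "k = 0 \<or> k = 1" using assms by auto
  ultimately show ?thesis by (auto simp: csin_quot_def cos_add cos_diff diff_divide_distrib)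
qed

lemma f_fun_minus:
  assumes "k \<le> 1"
  shows "f_fun k s v (- y) = - ((-1) ^ k) * f_fun k s v y"
proof -
  have "k = 0 \<or> k = 1" using assms by auto
  then show ?thesis
  proof
    assume "k = 0"
    then show ?thesis by (simp add: f_fun_def distrib_left right_diff_distrib)
  next
    assume "k = 1"
    moreover have "sin (- ((2 * v - 1) * y) - pi / 2) = sin ((2 * v - 1) * y - pi / 2)"
      "cos (- ((2 * v - 1) * y) - pi / 2) = - cos ((2 * v - 1) * y - pi / 2)"
      by (simp_all add: sin_diff cos_diff)
    ultimately show ?thesis by (simp add: f_fun_def)
  qed
qed

lemma g_fun_minus:
  assumes "k \<le> 1" and sm: "summable (\<lambda>i. gcoef k s v i * csin_quot k (freq k i / 2) (of_real y))"
  shows "g_fun k s v (- y) = - ((-1) ^ k) * g_fun k s v y"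
proof -
  have t: "g_term k s v (- y) (i + (1 - k)) = - ((-1) ^ k) * g_term k s v y (i + (1 - k))" for i
    unfolding g_term_eq[OF assms(1)] of_real_minus csin_quot_minus[OF assms(1)] by simp
  have "(\<Sum>i. g_term k s v (- y) (i + (1 - k))) = - ((-1) ^ k) * (\<Sum>i. g_term k s v y (i + (1 - k)))"
    unfolding t by (rule suminf_mult) (use sm in \<open>simp only: g_term_eq[OF assms(1)]\<close>)
  moreover have "complex_of_real (sin (- y + pi * of_nat k / 2)) = - ((-1) ^ k) * of_real (sin (y + pi * of_nat k / 2))"
    unfolding sin_shift_minus[OF assms(1)] by simp
  moreover have "(- y) ^ (2 * (m_index k s + 1)) = y ^ (2 * (m_index k s + 1))" "(2 * - y) ^ (2 * j) = (2 * y) ^ (2 * j)" for j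
    by (simp_all add: power_mult)
  ultimately show ?thesis
    unfolding g_fun_def by (simp only:) (simp add: algebra_simps)
qed

text \<open>Both \<open>f_fun\<close> and the series part of \<open>g_fun\<close> for
  \<open>s\<close> are \<open>(-1) ^ m * (2 * y) ^ (2 * m)\<close> times those for
  \<open>s'\<close>, and so is the remainder in \<open>kernel_integral_expand\<close>, whose Lerch
  terms match the polynomial part of \<open>g_fun\<close>.\<close>

lemma interpolation_identity_pos:
  assumes adm: "admissible k s v" and y: "y > 0" and ne: "sin (y + pi * of_nat k / 2) \<noteq> 0"
  shows "summable (\<lambda>i. gcoef k s v i * csin_quot k (freq k i / 2) (of_real y))"
    and "f_fun k s v y - g_fun k s v y = of_real (sin (y + pi * of_nat k / 2)) * kernel_integral k s v y"
proof -
  define m where "m = m_index k s"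
  define s' where "s' = s - 2 * of_nat m"
  note facts = admissible_facts[OF adm, folded m_def, folded s'_def]
  note k = facts(1) and v = facts(2,3)
  let ?\<sigma> = "complex_of_real (sin (y + pi * of_nat k / 2))"
  define u where "u = (\<lambda>i. of_real (freq k i / 2) powr (s' - 1) * sin (of_real (freq k i) * of_real v + of_real pi * s' / 2) * complex_of_real (1 / (y\<^sup>2 - (freq k i / 2)\<^sup>2)))"
  define I where "I = mint (mhquad k v s' (2 * y))"
  have su: "summable u" and base: "f_fun k s' v y - ?\<sigma> * (4 * of_real y ^ 2 * I)
      = - (?\<sigma> * (of_real pi * 2 powr s' * of_real y ^ 2 / sin (of_real pi * s')) * suminf u)"
    using interpolation_identity_base[OF k v y facts(4-8) ne] unfolding u_def I_def by auto
  \<comment> \<open>Source of all signs \<open>(-1) ^ m\<close>. The argument \<open>pi * s\<close>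
    itself moves by an even multiple of pi, so \<open>sin (pi * s)\<close> is unchanged.\<close>
  have half: "of_real pi * s / 2 = of_real pi * s' / 2 + of_nat m * of_real pi"
    by (simp add: s'_def algebra_simps diff_divide_distrib add_divide_distrib)
  have term_eq: "gcoef k s v i * csin_quot k (freq k i / 2) (of_real y) = ((-1) ^ m * ?\<sigma>) * u i" for i
  proof -
    have nf: "node k (int (i + (1 - k))) = freq k i / 2" by (rule node_freq[OF k])
    have n0: "node k (int (i + (1 - k))) \<noteq> 0" unfolding nf using freq_pos[OF k, of i] by simp
    have c: "csin_quot k (freq k i / 2) (of_real y) * of_real (y\<^sup>2 - (freq k i / 2)\<^sup>2) = ?\<sigma>"
      using csin_quot_mult[OF n0, of "of_real y"] unfolding nf by (simp flip: sin_of_real)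
    then have "complex_of_real (y\<^sup>2 - (freq k i / 2)\<^sup>2) \<noteq> 0" using ne by auto
    then have "csin_quot k (freq k i / 2) (of_real y) = ?\<sigma> / of_real (y\<^sup>2 - (freq k i / 2)\<^sup>2)"
      using c by (simp only: eq_divide_eq) simp
    also have "\<dots> = ?\<sigma> * of_real (1 / (y\<^sup>2 - (freq k i / 2)\<^sup>2))" by (simp only: of_real_divide of_real_1 times_divide_eq_right mult_1_right)
    finally have c': "csin_quot k (freq k i / 2) (of_real y) = ?\<sigma> * of_real (1 / (y\<^sup>2 - (freq k i / 2)\<^sup>2))" .
    have "sin (of_real (freq k i) * of_real v + of_real pi * s / 2) = (-1) ^ m * sin (of_real (freq k i) * of_real v + of_real pi * s' / 2)"
      unfolding half add.assoc[symmetric] by (rule sin_cos_add_nat_pi)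
    then show ?thesis
      unfolding c' gcoef_def u_def m_def[symmetric] s'_def by (simp only: mult_ac)
  qed
  show "summable (\<lambda>i. gcoef k s v i * csin_quot k (freq k i / 2) (of_real y))"
    unfolding term_eq by (intro summable_mult su)
  have sg: "(\<Sum>i. g_term k s v y (i + (1 - k))) = (-1) ^ m * ?\<sigma> * suminf u"
    unfolding g_term_eq[OF k] term_eq by (rule suminf_mult[OF su])
  have e2m: "(2::complex) powr (s + c) = 2 powr (s' + c) * 2 ^ (2 * m)" for c
  proof -
    have "s + c = s' + c + of_nat (2 * m)" by (simp add: s'_def)
    then have "(2::complex) powr (s + c) = 2 powr (s' + c) * 2 powr of_nat (2 * m)" by (simp only: powr_add)
    also have "(2::complex) powr of_nat (2 * m) = 2 ^ (2 * m)" by (rule powr_complexpow) simp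
    finally show ?thesis .
  qed
  have y2m: "complex_of_real y powr s = of_real y powr s' * of_real y ^ (2 * m)"
  proof -
    have "s = s' + of_nat (2 * m)" by (simp add: s'_def)
    then have "complex_of_real y powr s = of_real y powr s' * of_real y powr of_nat (2 * m)" by (metis powr_add)
    also have "complex_of_real y powr of_nat (2 * m) = of_real y ^ (2 * m)" using y by (intro powr_complexpow) auto
    finally show ?thesis .
  qed
  have inv: "x / ((-1) ^ m * w) = (-1) ^ m * (x / w)" for x w :: complex
    by (cases "even m") auto
  have fs: "f_fun k s v y = (-1) ^ m * of_real ((2 * y) ^ (2 * m)) * f_fun k s' v y"
  proof -
    have 1: "sin (of_real pi * s / 2) = (-1) ^ m * sin (of_real pi * s' / 2)" "cos (of_real pi * s / 2) = (-1) ^ m * cos (of_real pi * s' / 2)"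
      unfolding half by (rule sin_cos_add_nat_pi)+
    have 2: "(2::complex) powr (s - 2) = 2 powr (s' - 2) * 2 ^ (2 * m)" using e2m[of "-2"] by simp
    have 3: "complex_of_real \<bar>y\<bar> powr s = of_real \<bar>y\<bar> powr s' * of_real y ^ (2 * m)" using y2m y by simp
    show ?thesis unfolding f_fun_def 1 2 3 inv
      by (simp add: power_mult_distrib algebra_simps)
  qed
  have spi: "sin (of_real pi * s) = sin (of_real pi * s')"
  proof -
    have "of_real pi * s = of_real pi * s' + of_nat (2 * m) * of_real pi" by (simp add: s'_def algebra_simps)
    then show ?thesis using sin_cos_add_nat_pi(1)[of "of_real pi * s'" "2 * m"] by simp
  qed
  have coef: "of_real pi * 2 powr s * of_real (y ^ (2 * (m + 1))) / sin (of_real pi * s)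
     = of_real ((2 * y) ^ (2 * m)) * (of_real pi * 2 powr s' * of_real y ^ 2 / sin (of_real pi * s'))"
    using e2m[of 0] unfolding spi by (simp add: power_mult_distrib power_add power2_eq_square mult_ac)
  have KI: "kernel_integral k s' v y = 4 * of_real y ^ 2 * I"
  proof -
    have "kernel_integral k s' v y = (LINT t:{0<..}|lborel. of_real ((2 * y)\<^sup>2) * (mhquad k v s' (2 * y) t))"
      unfolding kernel_integral_def by (intro set_lebesgue_integral_cong allI impI) simp_all
    then show ?thesis unfolding I_def by (simp only: set_integral_mult_right) (simp add: power_mult_distrib)
  qed
  have red: "Re s - 2 * real m > 1 - real k"
    using facts(4,5) k by (cases "k = 0") (auto simp: s'_def)
  define P where "P = (\<Sum>j=1..m. (-1) ^ (j - 1) * Gamma (s - 2 * of_nat j) * lerch_phi ((-1) ^ k) (s - 2 * of_nat j) v * of_real ((2 * y) ^ (2 * j)))"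
  have K: "kernel_integral k s v y = P + (-1) ^ m * of_real ((2 * y) ^ (2 * m)) * (4 * of_real y ^ 2 * I)"
    unfolding P_def KI[symmetric] s'_def by (rule kernel_integral_expand[OF k v y red])
  have G: "g_fun k s v y = - (?\<sigma> * P + of_real ((2 * y) ^ (2 * m)) * (of_real pi * 2 powr s' * of_real y ^ 2 / sin (of_real pi * s')) * ((-1) ^ m * ?\<sigma> * suminf u))"
    unfolding g_fun_def sg m_def[symmetric] coef P_def ..
  define W where "W = of_real pi * 2 powr s' * of_real y ^ 2 / sin (of_real pi * s')"
  have base': "f_fun k s' v y = ?\<sigma> * (4 * of_real y ^ 2 * I) - ?\<sigma> * W * suminf u"
    using base unfolding W_def by (simp add: diff_eq_eq)
  show "f_fun k s v y - g_fun k s v y = ?\<sigma> * kernel_integral k s v y"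
    unfolding fs base' G K W_def[symmetric] by (simp add: algebra_simps)
qed

text \<open>Negative \<open>y\<close> by parity: \<open>f_fun\<close>, \<open>g_fun\<close> and the
  sine all acquire the factor \<open>- ((-1) ^ k)\<close>, while the kernel integral is
  even.\<close>

lemma interpolation_identity:
  assumes adm: "admissible k s v" and y: "y \<noteq> 0" and ne: "sin (y + pi * of_nat k / 2) \<noteq> 0"
  shows "f_fun k s v y - g_fun k s v y = of_real (sin (y + pi * of_nat k / 2)) * kernel_integral k s v y"
proof (cases "y > 0")
  case True
  then show ?thesis using interpolation_identity_pos[OF adm _ ne] by simp
next
  case False
  have k: "k \<le> 1" by (rule admissible_facts[OF adm])
  define w where "w = - y"
  have w: "w > 0" "y = - w" using False y by (simp_all add: w_def)
  have ne': "sin (w + pi * of_nat k / 2) \<noteq> 0" using ne unfolding w(2) sin_shift_minus[OF k] by auto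
  note id = interpolation_identity_pos[OF adm w(1) ne']
  have "- ((-1) ^ k) * (f_fun k s v w - g_fun k s v w) = - ((-1) ^ k) * (of_real (sin (w + pi * of_nat k / 2)) * kernel_integral k s v w)"
    unfolding id(2) ..
  then show ?thesis
    unfolding w(2) f_fun_minus[OF k] g_fun_minus[OF k id(1)] sin_shift_minus[OF k] kernel_integral_minus
    by (simp add: algebra_simps)
qed

section \<open>Size and limit of the kernel integral\<close>

lemma kernel_integral_bounded:
  assumes k: "k \<le> 1" and v: "0 < v" "v \<le> 1" and s: "Re s > 1 - real k"
  shows "norm (kernel_integral k s v y) \<le> (LINT t:{0<..}|lborel. norm (mhker k v s t))"
proof -
  have "norm (kernel_integral k s v y) \<le> (LINT t:{0<..}|lborel. norm (mkern k v s y t))"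
    unfolding kernel_integral_def by (rule set_integral_norm_bound[OF kernel_integrable[OF assms]])
  also have "\<dots> \<le> (LINT t:{0<..}|lborel. norm (mhker k v s t))"
  proof (rule set_integral_mono)
    show "set_integrable lborel {0<..} (\<lambda>t. norm (mkern k v s y t))"
      by (rule set_integrable_norm[OF kernel_integrable[OF assms]])
    show "set_integrable lborel {0<..} (\<lambda>t. norm (mhker k v s t))"
      by (rule set_integrable_norm[OF hker_mellin_integrable[OF assms]])
    fix t :: real
    have "\<bar>(2 * y)\<^sup>2 / (t\<^sup>2 + (2 * y)\<^sup>2)\<bar> \<le> 1" by (rule abs_ratio_le_1) auto
    then show "norm (mkern k v s y t) \<le> norm (mhker k v s t)"
      unfolding norm_mult[of "_ * _"] norm_of_real by (intro mult_left_le) auto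
  qed
  finally show ?thesis .
qed

lemma kernel_integral_tendsto:
  assumes k: "k \<le> 1" and v: "0 < v" "v \<le> 1" and s: "Re s > 1 - real k"
  shows "(kernel_integral k s v \<longlongrightarrow> (mint (mhker k v s))) at_infinity"
proof -
  let ?h = "\<lambda>t. mhker k v s t"
  have top: "(kernel_integral k s v \<longlongrightarrow> (LINT t:{0<..}|lborel. ?h t)) at_top"
    unfolding kernel_integral_def set_lebesgue_integral_def
  proof (rule integral_dominated_convergence_at_top[where w = "\<lambda>t. norm (indicator {0<..} t *\<^sub>R ?h t)"])
    show "(\<lambda>t. indicator {0<..} t *\<^sub>R ?h t) \<in> borel_measurable lborel"
      using hker_mellin_integrable[OF assms] unfolding set_integrable_def by (rule borel_measurable_integrable)
    show "(\<lambda>t. indicator {0<..} t *\<^sub>R (?h t * of_real ((2 * y)\<^sup>2 / (t\<^sup>2 + (2 * y)\<^sup>2)))) \<in> borel_measurable lborel" for y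
      using kernel_integrable[OF assms] unfolding set_integrable_def by (rule borel_measurable_integrable)
    show "integrable lborel (\<lambda>t. norm (indicator {0<..} t *\<^sub>R ?h t))"
      using hker_mellin_integrable[OF assms] unfolding set_integrable_def by (rule integrable_norm)
    show "\<forall>\<^sub>F y in at_top. AE t in lborel. norm (indicator {0<..} t *\<^sub>R (?h t * of_real ((2 * y)\<^sup>2 / (t\<^sup>2 + (2 * y)\<^sup>2)))) \<le> norm (indicator {0<..} t *\<^sub>R ?h t)"
    proof (intro always_eventually allI AE_I2)
      fix y t :: real
      have "\<bar>(2 * y)\<^sup>2 / (t\<^sup>2 + (2 * y)\<^sup>2)\<bar> \<le> 1" by (rule abs_ratio_le_1) auto
      then have "norm (?h t * of_real ((2 * y)\<^sup>2 / (t\<^sup>2 + (2 * y)\<^sup>2))) \<le> norm (?h t)"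
        unfolding norm_mult[of "_ * _"] norm_of_real by (intro mult_left_le) auto
      then show "norm (indicator {0<..} t *\<^sub>R (?h t * of_real ((2 * y)\<^sup>2 / (t\<^sup>2 + (2 * y)\<^sup>2)))) \<le> norm (indicator {0<..} t *\<^sub>R ?h t)"
        unfolding norm_scaleR by (intro mult_left_mono) auto
    qed
    show "AE t in lborel. ((\<lambda>y. indicator {0<..} t *\<^sub>R (?h t * of_real ((2 * y)\<^sup>2 / (t\<^sup>2 + (2 * y)\<^sup>2)))) \<longlongrightarrow> indicator {0<..} t *\<^sub>R ?h t) at_top"
    proof (rule AE_I2)
      fix t :: real
      have "((\<lambda>y. (2 * y)\<^sup>2 / (t\<^sup>2 + (2 * y)\<^sup>2)) \<longlongrightarrow> 1) at_top" by real_asymp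
      then have "((\<lambda>y. indicator {0<..} t *\<^sub>R (?h t * of_real ((2 * y)\<^sup>2 / (t\<^sup>2 + (2 * y)\<^sup>2)))) \<longlongrightarrow> indicator {0<..} t *\<^sub>R (?h t * of_real 1)) at_top"
        by (intro tendsto_intros)
      then show "((\<lambda>y. indicator {0<..} t *\<^sub>R (?h t * of_real ((2 * y)\<^sup>2 / (t\<^sup>2 + (2 * y)\<^sup>2)))) \<longlongrightarrow> indicator {0<..} t *\<^sub>R ?h t) at_top"
        by simp
    qed
  qed
  moreover have "(kernel_integral k s v \<longlongrightarrow> (LINT t:{0<..}|lborel. ?h t)) at_bot"
    unfolding filterlim_at_bot_mirror kernel_integral_minus by (rule top)
  ultimately show ?thesis unfolding at_infinity_eq_at_top_bot by (rule filterlim_sup)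
qed

text \<open>
  The series need not converge absolutely; its convergence is read off the interpolation identity at the
  single point \<open>y = 1\<close>.
\<close>
lemma gcoef_square_summable:
  assumes adm: "admissible k s v"
  shows "summable (\<lambda>i. gcoef k s v i / of_real (freq k i / 2) ^ 2)"
    and "summable (\<lambda>i. norm (gcoef k s v i) / (freq k i / 2) ^ 3)"
    and "gcoef k s v i * csin_quot k (freq k i / 2) z =
           z ^ 2 * (gcoef k s v i / of_real (freq k i / 2) ^ 2 * csin_quot k (freq k i / 2) z)
         - sin (z + of_real (pi * of_nat k / 2)) * (gcoef k s v i / of_real (freq k i / 2) ^ 2)"
proof -
  note facts = admissible_facts[OF adm]
  note k = facts(1)
  have sig: "sin (1 + pi * of_nat k / 2) \<noteq> 0"
  proof -
    have "sin (1::real) > 0" using pi_gt3 by (intro sin_gt_zero) auto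
    moreover have "cos (1::real) > 0" using pi_gt3 by (intro cos_gt_zero) auto
    moreover have "k = 0 \<or> k = 1" using k by auto
    ultimately show ?thesis by (auto simp: sin_add)
  qed
  show eq: "gcoef k s v i * csin_quot k (freq k i / 2) z =
           z ^ 2 * (gcoef k s v i / of_real (freq k i / 2) ^ 2 * csin_quot k (freq k i / 2) z)
         - sin (z + of_real (pi * of_nat k / 2)) * (gcoef k s v i / of_real (freq k i / 2) ^ 2)" for i z
  proof -
    have nf: "node k (int (i + (1 - k))) = freq k i / 2" by (rule node_freq[OF k])
    have a0: "freq k i / 2 > 0" using freq_pos[OF k, of i] by simp
    then have n0: "node k (int (i + (1 - k))) \<noteq> 0" unfolding nf by simp
    \<comment> \<open>This is \<open>1 = z\<^sup>2 / a\<^sup>2 - (z\<^sup>2 - a\<^sup>2) /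
      a\<^sup>2\<close>; by \<open>csin_quot_mult\<close> the second part turns \<open>Q\<close>
      into the sine and so becomes a constant coefficient.\<close>
    have "G * Q = z ^ 2 * (G / a ^ 2 * Q) - Q * (z ^ 2 - a ^ 2) * (G / a ^ 2)" if "a \<noteq> 0" for G Q a :: complex
      using that by (simp add: field_simps)
    from this[of "of_real (freq k i / 2)"] show ?thesis
      using csin_quot_mult[OF n0, of z, symmetric] a0 unfolding nf by simp
  qed
  have "Re s - 2 * real (m_index k s) < 3"
    using facts(4,5) k by (cases "k = 0") auto
  then show sm: "summable (\<lambda>i. norm (gcoef k s v i) / (freq k i / 2) ^ 3)"
    by (rule gcoef_summable[OF k])
  have s1: "summable (\<lambda>i. gcoef k s v i * csin_quot k (freq k i / 2) (of_real 1))"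
    by (rule interpolation_identity_pos(1)[OF adm _ sig]) simp
  have s2: "summable (\<lambda>i. gcoef k s v i / of_real (freq k i / 2) ^ 2 * csin_quot k (freq k i / 2) (of_real 1))"
    by (rule csin_quot_series(1)[OF k sm])
  let ?\<sigma> = "sin (of_real 1 + complex_of_real (pi * of_nat k / 2))"
  have \<sigma>: "?\<sigma> \<noteq> 0" using sig by (simp only: of_real_add[symmetric] sin_of_real of_real_eq_0_iff) simp
  \<comment> \<open>Solves the identity at \<open>z = 1\<close> for the unknown terms: the other two
    series converge and the sine is nonzero there.\<close>
  have "summable (\<lambda>i. (gcoef k s v i / of_real (freq k i / 2) ^ 2 * csin_quot k (freq k i / 2) (of_real 1) - gcoef k s v i * csin_quot k (freq k i / 2) (of_real 1)) / ?\<sigma>)"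
    by (intro summable_divide summable_diff s1 s2)
  moreover have "(gcoef k s v i / of_real (freq k i / 2) ^ 2 * csin_quot k (freq k i / 2) (of_real 1) - gcoef k s v i * csin_quot k (freq k i / 2) (of_real 1)) / ?\<sigma>
     = gcoef k s v i / of_real (freq k i / 2) ^ 2" for i
  proof -
    have "(X - (1 * X - w * Y)) / w = Y" if "w \<noteq> 0" for X Y w :: complex
      using that by simp
    from this[OF \<sigma>] show ?thesis
      unfolding eq[of i "of_real 1"] by simp
  qed
  ultimately show "summable (\<lambda>i. gcoef k s v i / of_real (freq k i / 2) ^ 2)" by (simp only:)
qed

section \<open>Assembling the entire function\<close>

definition g_series :: "nat \<Rightarrow> complex \<Rightarrow> real \<Rightarrow> complex \<Rightarrow> complex" where
  "g_series k s v z = (\<Sum>i. gcoef k s v i * csin_quot k (freq k i / 2) z)"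

text \<open>Termwise splitting gives \<open>z\<^sup>2 * V z\<close> minus the sine times
  \<open>B\<close>. Only the constant \<open>B\<close> depends on conditional convergence;
  \<open>V\<close> is entire and its growth is controlled by absolute convergence.\<close>

lemma g_series_facts:
  assumes adm: "admissible k s v"
  shows "summable (\<lambda>i. gcoef k s v i * csin_quot k (freq k i / 2) z)"
    and "g_series k s v holomorphic_on UNIV"
    and "has_exponential_type (g_series k s v) 1"
proof -
  note facts = admissible_facts[OF adm]
  note k = facts(1)
  note sm = gcoef_square_summable[OF adm]
  note ser = csin_quot_series[OF k sm(2)]
  define V where "V = (\<lambda>z. \<Sum>i. gcoef k s v i / of_real (freq k i / 2) ^ 2 * csin_quot k (freq k i / 2) z)"
  define B where "B = (\<Sum>i. gcoef k s v i / of_real (freq k i / 2) ^ 2)"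
  have su: "(\<lambda>i. gcoef k s v i * csin_quot k (freq k i / 2) z) sums (z ^ 2 * V z - sin (z + of_real (pi * of_nat k / 2)) * B)" for z
    unfolding sm(3) V_def B_def by (intro sums_diff sums_mult summable_sums sm(1) ser(1))
  then show "summable (\<lambda>i. gcoef k s v i * csin_quot k (freq k i / 2) z)" by (rule sums_summable)
  have eq: "g_series k s v = (\<lambda>z. z ^ 2 * V z + (- B) * sin (z + of_real (pi * of_nat k / 2)))"
  proof
    fix z show "g_series k s v z = z ^ 2 * V z + (- B) * sin (z + of_real (pi * of_nat k / 2))"
      using su[of z] unfolding g_series_def by (simp add: sums_iff)
  qed
  have Vh: "V holomorphic_on UNIV" unfolding V_def by (rule ser(2))
  show "g_series k s v holomorphic_on UNIV" unfolding eq by (intro holomorphic_intros Vh)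
  have "has_exponential_type V 1"
    unfolding V_def by (rule has_exponential_type_bounded_by_exp_Im[OF ser(3)])
  then have 1: "has_exponential_type (\<lambda>z. z ^ 2 * V z) 1"
    using has_exponential_type_mult[OF has_exponential_type_power[of 2]] by fastforce
  from has_exponential_type_sin_shift have 2: "has_exponential_type (\<lambda>z. (- B) * sin (z + of_real (pi * of_nat k / 2))) 1"
    by (rule has_exponential_type_cmult)
  show "has_exponential_type (g_series k s v) 1"
    unfolding eq by (rule has_exponential_type_add[OF 1 2])
qed

text \<open>\<open>g_fun\<close> on the complex plane; signs appear as factors and powers of 2 as
  coefficients, so that the closure rules for exponential type apply to it directly.\<close>

definition g_entire :: "nat \<Rightarrow> complex \<Rightarrow> real \<Rightarrow> complex \<Rightarrow> complex" where
  "g_entire k s v z =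
     (- 1) * (sin (z + of_real (pi * of_nat k / 2)) * (\<Sum>j = 1..m_index k s.
          ((-1) ^ (j - 1) * Gamma (s - 2 * of_nat j) * lerch_phi ((-1) ^ k) (s - 2 * of_nat j) v * 2 ^ (2 * j)) * z ^ (2 * j)))
   + (- (of_real pi * 2 powr s / sin (of_real pi * s))) * (z ^ (2 * (m_index k s + 1)) * g_series k s v z)"

lemma g_entire_of_real:
  assumes "k \<le> 1"
  shows "g_entire k s v (of_real y) = g_fun k s v y"
proof -
  have "sin (of_real y + complex_of_real (pi * of_nat k / 2)) = of_real (sin (y + pi * of_nat k / 2))"
    by (simp only: of_real_add[symmetric] sin_of_real)
  then show ?thesis
    unfolding g_entire_def g_fun_def g_series_def g_term_eq[OF assms]
    by (simp add: power_mult_distrib mult_ac)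
qed

lemma g_entire_holomorphic:
  assumes "admissible k s v"
  shows "g_entire k s v holomorphic_on UNIV"
  unfolding g_entire_def[abs_def] by (intro holomorphic_intros g_series_facts(2)[OF assms])

lemma g_entire_exponential_type:
  assumes adm: "admissible k s v"
  shows "has_exponential_type (g_entire k s v) 1"
proof -
  note s = has_exponential_type_sin_shift[of "pi * of_nat k / 2"]
  have p: "has_exponential_type (\<lambda>z. \<Sum>j\<in>J. c j * z ^ (2 * j)) 0" for J and c :: "nat \<Rightarrow> complex"
    by (intro has_exponential_type_sum has_exponential_type_cmult has_exponential_type_power)
  have "has_exponential_type (\<lambda>z. sin (z + of_real (pi * of_nat k / 2)) * (\<Sum>j\<in>J. c j * z ^ (2 * j))) 1" for J and c :: "nat \<Rightarrow> complex"
    using has_exponential_type_mult[OF s p[where J = J and c = c]] by simp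
  moreover have "has_exponential_type (\<lambda>z. z ^ n * g_series k s v z) 1" for n
    using has_exponential_type_mult[OF has_exponential_type_power[of n] g_series_facts(3)[OF adm]] by simp
  ultimately show ?thesis
    unfolding g_entire_def[abs_def] by (intro has_exponential_type_add has_exponential_type_cmult)
qed

text \<open>The polynomial starts with \<open>z\<^sup>2\<close> and the series carries at least the
  factor \<open>z\<^sup>2\<close>, so 0 is a zero of order at least two for both values of
  \<open>k\<close>.\<close>

lemma g_entire_at_0:
  assumes adm: "admissible k s v"
  shows "(deriv ^^ (1 - k)) (g_entire k s v) 0 = 0"
proof -
  have k: "k \<le> 1" by (rule admissible_facts[OF adm])
  define P where "P = (\<lambda>z. \<Sum>j = 1..m_index k s. ((-1) ^ (j - 1) * Gamma (s - 2 * of_nat j) * lerch_phi ((-1) ^ k) (s - 2 * of_nat j) v * 2 ^ (2 * j)) * z ^ (2 * j))"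
  have P0: "P 0 = 0" unfolding P_def by (intro sum.neutral) auto
  have ge: "g_entire k s v = (\<lambda>z. (- 1) * (sin (z + of_real (pi * of_nat k / 2)) * P z)
     + (- (of_real pi * 2 powr s / sin (of_real pi * s))) * (z ^ (2 * (m_index k s + 1)) * g_series k s v z))"
    by (simp add: g_entire_def[abs_def] P_def)
  show ?thesis
  proof (cases "k = 0")
    case False
    then have "k = 1" using k by simp
    then show ?thesis unfolding ge using P0 by simp
  next
    case True
    have "P holomorphic_on UNIV" unfolding P_def by (intro holomorphic_intros)
    then obtain P' where P': "(P has_field_derivative P') (at 0)"
      using holomorphic_derivI[of P UNIV 0] by auto
    obtain V' where V': "(g_series k s v has_field_derivative V') (at 0)"
      using holomorphic_derivI[OF g_series_facts(2)[OF adm], of 0] by auto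
    have "(g_entire k s v has_field_derivative 0) (at 0)"
      unfolding ge by (rule derivative_eq_intros refl P' V')+ (use True P0 in simp)
    then show ?thesis using True by (simp add: DERIV_imp_deriv)
  qed
qed

section \<open>Interpolation and uniqueness\<close>

definition node_value :: "nat \<Rightarrow> complex \<Rightarrow> real \<Rightarrow> int \<Rightarrow> complex" where
  "node_value k s v n = - (of_real pi * 2 powr (s - 1) * ((-1) powi (n + int k))
                 * of_real (pi * \<bar>of_int n + of_nat k / 2\<bar>) powr s / sin (of_real pi * s)
               * sin (of_real (pi * (2 * of_int n + of_nat k) * v)
                      + of_real pi * s / 2 * of_real (sgn (of_int n + of_nat k / 2))))"

lemma minus_one_powi_cases: "(-1) powi n = (if even n then 1 else (-1 :: 'a :: field))" for n :: int
  by (cases "n \<ge> 0") (auto simp: power_int_def even_nat_iff minus_one_power_iff)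

lemma sin_cos_add_int_pi:
  "sin (x - of_int n * pi) = (if even n then 1 else -1) * sin (x :: real)"
  "cos (x - of_int n * pi) = (if even n then 1 else -1) * cos (x :: real)"
proof -
  have "cos (of_int n * pi) = (if even n then 1 else -1)" "sin (of_int n * pi) = 0"
    using cos_int_times_real[of n pi] sin_int_times_real[of n pi]
    by (auto simp: cos_npi_int sin_npi_int mult.commute)
  then show "sin (x - of_int n * pi) = (if even n then 1 else -1) * sin x"
    "cos (x - of_int n * pi) = (if even n then 1 else -1) * cos x"
    by (auto simp: sin_diff cos_diff)
qed

text \<open>At a node \<open>b\<close> the phase of \<open>f_fun\<close> differs from
  \<open>2 * b * v\<close> by a multiple of pi, and the addition theorem merges the two quotients
  into one sine over \<open>q * c\<close>, which is half of \<open>sin (pi * s)\<close>.\<close>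

lemma f_fun_node:
  assumes adm: "admissible k s v"
  shows "f_fun k s v (node k n) = node_value k s v n"
proof -
  note facts = admissible_facts[OF adm]
  define r where "r = of_int n + real k / 2"
  define b where "b = node k n"
  have b: "b = pi * r" by (simp add: b_def node_def r_def)
  define e where "e = (if even (n + int k) then 1 else -1 :: real)"
  have ee: "(-1) powi (n + int k) = complex_of_real e" unfolding minus_one_powi_cases e_def by simp
  define c where "c = cos (of_real pi * s / 2)"
  define q where "q = sin (of_real pi * s / 2)"
  have s2: "sin (of_real pi * s) = 2 * q * c"
    using sin_double[of "of_real pi * s / 2"] by (simp add: q_def c_def)
  then have nz: "q \<noteq> 0" "c \<noteq> 0" using facts(10) by auto
  have arg: "(2 * v - 1) * b - pi * of_nat k / 2 = 2 * b * v - of_int (n + int k) * pi"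
    by (simp add: b r_def field_simps)
  have sc: "sin ((2 * v - 1) * b - pi * of_nat k / 2) = e * sin (2 * b * v)" "cos ((2 * v - 1) * b - pi * of_nat k / 2) = e * cos (2 * b * v)"
    unfolding arg sin_cos_add_int_pi e_def by simp_all
  have "complex_of_real (sin (2 * b * v)) / q + of_real (sgn r) * of_real (cos (2 * b * v)) / c
     = sin (of_real (2 * b * v) + of_real pi * s / 2 * of_real (sgn r)) / (q * c)" if "r \<noteq> 0"
  proof -
    have "sgn r = 1 \<or> sgn r = -1" using that by (auto simp: sgn_if)
    then have e: "sin (of_real (2 * b * v) + of_real pi * s / 2 * of_real (sgn r))
        = of_real (sin (2 * b * v)) * c + of_real (sgn r) * of_real (cos (2 * b * v)) * q"
      unfolding sin_add q_def c_def sin_of_real cos_of_real by (elim disjE) simp_all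
    have "S / q + g * C / c = (S * c + g * C * q) / (q * c)" for S C g :: complex
      using nz by (simp add: field_simps)
    then show ?thesis unfolding e .
  qed
  \<comment> \<open>The power of \<open>\<bar>b\<bar>\<close> covers the node 0 as well, since
    \<open>0 powr s = 0\<close>.\<close>
  then have main: "of_real \<bar>b\<bar> powr s * (complex_of_real (sin (2 * b * v)) / q + of_real (sgn r) * of_real (cos (2 * b * v)) / c)
     = of_real \<bar>b\<bar> powr s * (sin (of_real (2 * b * v) + of_real pi * s / 2 * of_real (sgn r)) / (q * c))"
    by (cases "r = 0") (auto simp: b)
  have p2: "(2::complex) powr (s - 1) = 2 * 2 powr (s - 2)"
    using powr_shift_one[of 2 "s - 1"] by simp
  have sg: "sgn b = sgn r" by (simp add: b sgn_mult)
  have "f_fun k s v b = - (of_real pi * 2 powr (s - 2) * of_real e * (of_real \<bar>b\<bar> powr s * (complex_of_real (sin (2 * b * v)) / q + of_real (sgn r) * of_real (cos (2 * b * v)) / c)))"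
    unfolding f_fun_def sc sg c_def[symmetric] q_def[symmetric] of_real_mult[of e] by (simp add: distrib_left mult_ac)
  also have "\<dots> = - (of_real pi * 2 powr (s - 1) * of_real e * of_real \<bar>b\<bar> powr s / sin (of_real pi * s) * sin (of_real (2 * b * v) + of_real pi * s / 2 * of_real (sgn r)))"
    unfolding main p2 s2 using nz by simp
  also have "\<dots> = node_value k s v n"
  proof -
    have p1: "pi * (2 * of_int n + of_nat k) * v = 2 * b * v" by (simp add: b r_def field_simps)
    have p2: "pi * \<bar>of_int n + of_nat k / 2\<bar> = \<bar>b\<bar>" by (simp add: b r_def abs_mult)
    show ?thesis unfolding node_value_def ee p1 p2 r_def ..
  qed
  finally show ?thesis by (simp add: b_def)
qed

text \<open>The polynomial part vanishes with the sine. In the series every \<open>csin_quot\<close>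
  vanishes at the node \<open>b\<close> except the one belonging to \<open>\<bar>b\<bar>\<close>; if
  \<open>b = 0\<close> the power of \<open>y\<close> in front gives 0.\<close>

lemma g_fun_node:
  assumes adm: "admissible k s v"
  shows "g_fun k s v (node k n) = node_value k s v n"
proof -
  note facts = admissible_facts[OF adm]
  note k = facts(1)
  define m where "m = m_index k s"
  define r where "r = of_int n + real k / 2"
  define b where "b = node k n"
  have b: "b = pi * r" by (simp add: b_def node_def r_def)
  have k01: "k = 0 \<or> k = 1" using k by auto
  have sb: "sin (b + pi * of_nat k / 2) = 0" using node_sin_zero(1)[of k n] by (simp add: b_def)
  have sbc: "sin (of_real b + complex_of_real (pi * of_nat k / 2)) = 0"
    using sb by (simp only: of_real_add[symmetric] sin_of_real) simp
  have gb: "g_fun k s v b = (- (of_real pi * 2 powr s / sin (of_real pi * s))) * (of_real b ^ (2 * (m + 1)) * g_series k s v (of_real b))"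
    unfolding g_entire_of_real[OF k, symmetric] g_entire_def sbc m_def by simp
  show ?thesis
  proof (cases "b = 0")
    case True
    then have "r = 0" by (simp add: b)
    then have "node_value k s v n = 0" unfolding node_value_def by (simp add: r_def)
    moreover have "g_fun k s v b = 0" unfolding gb using True by simp
    ultimately show ?thesis by (simp add: b_def)
  next
    case False
    have r0: "r \<noteq> 0" using False by (simp add: b)
    \<comment> \<open>Solving \<open>pi * (i + 1 - k / 2) = \<bar>b\<bar>\<close> gives
      \<open>i = n - 1 + k\<close> on the nonnegative side and \<open>i = - n - 1\<close> on the
      negative side.\<close>
    have "\<exists>i. freq k i / 2 = \<bar>b\<bar>"
    proof (cases "n \<ge> 1 - int k")
      case True
      then have i: "real (nat (n - 1 + int k)) = of_int n - 1 + real k" by simp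
      have "r \<ge> 0" using True k01 by (auto simp: r_def)
      then have "\<bar>b\<bar> = pi * r" by (simp add: b)
      also have "\<dots> = freq k (nat (n - 1 + int k)) / 2"
        unfolding freq_def i by (simp add: r_def field_simps)
      finally show ?thesis by metis
    next
      case f: False
      have n0: "n \<noteq> 0 \<or> k \<noteq> 0" using r0 by (auto simp: r_def)
      have n1: "n \<le> -1" using f n0 k01 by auto
      then have "real_of_int n \<le> -1" by simp
      then have "r \<le> 0" using k01 by (auto simp: r_def)
      then have "\<bar>b\<bar> = - (pi * r)" by (simp add: b abs_mult)
      moreover have i: "real (nat (- n - 1)) = - of_int n - 1" using n1 by simp
      have "- (pi * r) = freq k (nat (- n - 1)) / 2"
        unfolding freq_def i by (simp add: r_def field_simps)
      ultimately show ?thesis by metis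
    qed
    then obtain i where i: "freq k i / 2 = \<bar>b\<bar>" by blast
    have fi: "freq k i = 2 * \<bar>b\<bar>" using i by simp
    define e where "e = (if even (n + int k) then 1 else -1 :: real)"
    have ee: "(-1) powi (n + int k) = complex_of_real e" unfolding minus_one_powi_cases e_def by simp
    have bc: "cos (b + pi * of_nat k / 2) = e"
    proof -
      have "b + pi * of_nat k / 2 = - (0 - of_int (n + int k) * pi)" by (simp add: b r_def algebra_simps)
      then have "cos (b + pi * of_nat k / 2) = cos (0 - of_int (n + int k) * pi)" by (simp only: cos_minus)
      then show ?thesis unfolding sin_cos_add_int_pi e_def by simp
    qed
    have c0: "csinc (of_real (2 * \<bar>b\<bar>)) = 0" "csinc (- of_real (2 * \<bar>b\<bar>)) = 0"
      using cos_sin_freq(2)[OF k, of i] False unfolding fi by (auto simp: csinc_def sin_of_real simp del: of_real_mult)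
    \<comment> \<open>One of the two \<open>csinc\<close> factors is taken at 0, the other at plus
      or minus \<open>freq k i\<close>, a nonzero multiple of pi, where it vanishes.\<close>
    have cb: "csin_quot k (freq k i / 2) (of_real b) = of_real e / of_real (2 * b)"
    proof (cases "b > 0")
      case True
      then have ab: "\<bar>b\<bar> = b" by simp
      have "of_real b + of_real b = complex_of_real (2 * \<bar>b\<bar>)" by (simp add: ab)
      then show ?thesis unfolding i csin_quot_def using c0 bc ab by (simp add: csinc_def)
    next
      case nb: False
      then have ab: "\<bar>b\<bar> = - b" by simp
      have "complex_of_real b - of_real (- b) = - of_real (2 * \<bar>b\<bar>)" by (simp add: ab)
      moreover have "cos (pi * of_nat k / 2 - \<bar>b\<bar>) = e" using bc by (simp add: ab add.commute)
      ultimately show ?thesis unfolding i csin_quot_def using c0 ab by (simp add: csinc_def)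
    qed
    have other: "csin_quot k (freq k j / 2) (of_real b) = 0" if "j \<noteq> i" for j
    proof -
      have nf: "node k (int (j + (1 - k))) = freq k j / 2" by (rule node_freq[OF k])
      have fj: "freq k j / 2 > 0" using freq_pos[OF k, of j] by simp
      then have n0: "node k (int (j + (1 - k))) \<noteq> 0" unfolding nf by simp
      have "freq k j \<noteq> freq k i" using that by (simp add: freq_def)
      then have "freq k j / 2 \<noteq> \<bar>b\<bar>" unfolding i[symmetric] by simp
      then have "b\<^sup>2 \<noteq> (freq k j / 2)\<^sup>2" using fj by (auto simp: power2_eq_iff abs_if)
      then have "complex_of_real (b\<^sup>2 - (freq k j / 2)\<^sup>2) \<noteq> 0" by (simp only: of_real_eq_0_iff right_minus_eq not_False_eq_True)
      moreover have "csin_quot k (freq k j / 2) (of_real b) * of_real (b\<^sup>2 - (freq k j / 2)\<^sup>2) = 0"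
        using csin_quot_mult[OF n0, of "of_real b"] sbc unfolding nf by simp
      ultimately show ?thesis by simp
    qed
    have gs: "g_series k s v (of_real b) = gcoef k s v i * (of_real e / of_real (2 * b))"
    proof -
      have "g_series k s v (of_real b) = (\<Sum>j\<in>{i}. gcoef k s v j * csin_quot k (freq k j / 2) (of_real b))"
        unfolding g_series_def by (rule suminf_finite) (auto simp: other)
      then show ?thesis by (simp add: cb)
    qed
    define B where "B = complex_of_real \<bar>b\<bar>"
    have B0: "B \<noteq> 0" using False by (simp add: B_def)
    define \<epsilon> where "\<epsilon> = complex_of_real (sgn r)"
    have sg: "sgn b = sgn r" by (simp add: b sgn_mult)
    have bB: "complex_of_real b = \<epsilon> * B" unfolding \<epsilon>_def B_def sg[symmetric] by (simp only: of_real_mult[symmetric] sgn_mult_abs)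
    have ee2: "\<epsilon> * \<epsilon> = 1" using r0 unfolding \<epsilon>_def by (auto simp: sgn_if)
    have Bs: "B powr (s - 2 * of_nat m - 1) * B ^ (2 * (m + 1)) = B powr s * B"
    proof -
      have "B powr (s - 2 * of_nat m - 1) * B ^ (2 * (m + 1)) = B powr (s - 2 * of_nat m - 1) * B powr of_nat (2 * (m + 1))"
        by (simp only: powr_complexpow[OF B0])
      also have "\<dots> = B powr (s - 2 * of_nat m - 1 + of_nat (2 * (m + 1)))" by (rule powr_add[symmetric])
      also have "s - 2 * of_nat m - 1 + of_nat (2 * (m + 1)) = s + 1" by simp
      also have "B powr (s + 1) = B powr s * B" using B0 by (subst powr_add) simp
      finally show ?thesis .
    qed
    have pw: "of_real b ^ (2 * (m + 1)) = B ^ (2 * (m + 1))"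
      unfolding bB power_mult_distrib using ee2 by (simp add: power_mult power2_eq_square)
    have p2: "(2::complex) powr s = 2 * 2 powr (s - 1)"
      using powr_shift_one[of 2 s] by simp
    define S where "S = sin (of_real (freq k i) * of_real v + of_real pi * s / 2)"
    have gc: "gcoef k s v i = B powr (s - 2 * of_nat m - 1) * S"
      unfolding gcoef_def i B_def m_def S_def ..
    have odd: "\<epsilon> * S = sin (of_real (2 * b * v) + of_real pi * s / 2 * of_real (sgn r))"
    proof -
      have "of_real (freq k i) = \<epsilon> * of_real (2 * b)" unfolding fi of_real_mult bB B_def[symmetric] using ee2 by (simp add: mult_ac)
      then have "of_real (freq k i) * of_real v = \<epsilon> * of_real (2 * b * v)" by simp
      moreover have "\<epsilon> * (X + Y * \<epsilon>) = \<epsilon> * X + Y" for X Y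
      proof -
        have "\<epsilon> * (X + Y * \<epsilon>) = \<epsilon> * X + (\<epsilon> * \<epsilon>) * Y" by (simp add: algebra_simps)
        then show ?thesis by (simp only: ee2 mult_1)
      qed
      ultimately have "S = sin (\<epsilon> * (of_real (2 * b * v) + of_real pi * s / 2 * \<epsilon>))"
        unfolding S_def by (simp only:)
      moreover have "\<epsilon> = 1 \<or> \<epsilon> = -1" using r0 unfolding \<epsilon>_def by (auto simp: sgn_if)
      moreover have "\<epsilon> * sin (\<epsilon> * W) = sin W" if "\<epsilon> = 1 \<or> \<epsilon> = -1" for W
        using that by auto
      ultimately show ?thesis unfolding \<epsilon>_def[symmetric] by (simp only:)
    qed
    have "of_real b ^ (2 * (m + 1)) * g_series k s v (of_real b) = (B powr (s - 2 * of_nat m - 1) * B ^ (2 * (m + 1))) * S * of_real e / (2 * (\<epsilon> * B))"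
    proof -
      have "complex_of_real (2 * b) = 2 * (\<epsilon> * B)" unfolding of_real_mult bB by simp
      moreover have "x * (y * S * (c / d)) = y * x * S * c / d" for x y c d by simp
      ultimately show ?thesis unfolding gs gc pw by (simp only:)
    qed
    also have "\<dots> = B powr s * of_real e * (S / \<epsilon>) / 2"
      unfolding Bs using B0 by (simp add: mult_ac)
    also have "S / \<epsilon> = \<epsilon> * S" using r0 unfolding \<epsilon>_def by (auto simp: sgn_if)
    finally have F: "of_real b ^ (2 * (m + 1)) * g_series k s v (of_real b) = B powr s * of_real e * (\<epsilon> * S) / 2" .
    have "g_fun k s v b = - (of_real pi * 2 powr (s - 1) * of_real e * B powr s / sin (of_real pi * s) * sin (of_real (2 * b * v) + of_real pi * s / 2 * of_real (sgn r)))"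
      unfolding gb F p2 odd by (simp add: mult_ac)
    also have "\<dots> = node_value k s v n"
    proof -
    have p1: "pi * (2 * of_int n + of_nat k) * v = 2 * b * v" by (simp add: b r_def field_simps)
    have p2: "pi * \<bar>of_int n + of_nat k / 2\<bar> = \<bar>b\<bar>" by (simp add: b r_def abs_mult)
    show ?thesis unfolding node_value_def ee p1 p2 r_def B_def ..
    qed
    finally show ?thesis by (simp add: b_def)
  qed
qed

text \<open>Off the nodes the difference is the sine times a bounded integral, and at the nodes it
  is 0. The point \<open>y = 0\<close>, excluded from the identity, is a node for
  \<open>k = 0\<close>; for \<open>k = 1\<close> both functions vanish there.\<close>

lemma f_minus_g_bounded:
  assumes adm: "admissible k s v"
  shows "\<exists>M. \<forall>y. norm (f_fun k s v y - g_fun k s v y) \<le> M"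
proof -
  note facts = admissible_facts[OF adm]
  define M where "M = (LINT t:{0<..}|lborel. norm (mhker k v s t))"
  have K: "norm (kernel_integral k s v y) \<le> M" for y
    unfolding M_def by (rule kernel_integral_bounded[OF facts(1-3,9)])
  then have M0: "M \<ge> 0" using order_trans[OF norm_ge_zero] by blast
  have "norm (f_fun k s v y - g_fun k s v y) \<le> M" for y
  proof (cases "sin (y + pi * of_nat k / 2) = 0")
    case True
    then obtain j :: int where "y + pi * of_nat k / 2 = of_int j * pi" by (auto simp: sin_zero_iff_int2)
    then have "y = node k (j - int k)" by (simp add: node_def algebra_simps)
    then show ?thesis using f_fun_node[OF adm] g_fun_node[OF adm] M0 by simp
  next
    case False
    show ?thesis
    proof (cases "y = 0")
      case True
      then have "k \<noteq> 0" using False by (intro notI) simp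
      then have "g_entire k s v 0 = 0" using g_entire_at_0[OF adm] facts(1) by simp
      then have "g_fun k s v 0 = 0" using g_entire_of_real[OF facts(1), of s v 0] by simp
      then show ?thesis using True M0 by (simp add: f_fun_def)
    next
      case nz: False
      have "norm (f_fun k s v y - g_fun k s v y) = \<bar>sin (y + pi * of_nat k / 2)\<bar> * norm (kernel_integral k s v y)"
        unfolding interpolation_identity[OF adm nz False] norm_mult norm_of_real ..
      also have "\<dots> \<le> 1 * M" by (intro mult_mono K) auto
      finally show ?thesis by simp
    qed
  qed
  then show ?thesis by blast
qed

lemma f_fun_measurable: "f_fun k s v \<in> borel_measurable borel"
proof -
  have "(\<lambda>y. complex_of_real \<bar>y\<bar> powr s) = (\<lambda>y. if y = 0 then 0 else exp (s * of_real (ln \<bar>y\<bar>)))"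
    by (auto simp: powr_def Ln_of_real)
  moreover have "(\<lambda>y. if y = 0 then 0 else exp (s * complex_of_real (ln \<bar>y\<bar>))) \<in> borel_measurable borel"
    by measurable
  ultimately have [measurable]: "(\<lambda>y. complex_of_real \<bar>y\<bar> powr s) \<in> borel_measurable borel" by simp
  show ?thesis unfolding f_fun_def[abs_def] by measurable
qed

lemma g_entire_is_interpolant:
  assumes adm: "admissible k s v"
  shows "is_interpolant k s v (g_entire k s v)"
  unfolding is_interpolant_def
proof (intro conjI allI)
  note facts = admissible_facts[OF adm]
  show "g_entire k s v holomorphic_on UNIV" by (rule g_entire_holomorphic[OF adm])
  show "has_exponential_type (g_entire k s v) 1" by (rule g_entire_exponential_type[OF adm])
  show "g_entire k s v (of_real (node k n)) = f_fun k s v (node k n)" for n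
    unfolding g_entire_of_real[OF facts(1)] f_fun_node[OF adm] g_fun_node[OF adm] ..
  show "(deriv ^^ (1 - k)) (g_entire k s v) 0 = 0" by (rule g_entire_at_0[OF adm])
  have "continuous_on UNIV (\<lambda>y. g_entire k s v (of_real y))"
    using g_entire_holomorphic[OF adm]
    by (intro continuous_on_compose2[of UNIV "g_entire k s v" UNIV of_real] continuous_intros)
       (auto intro: holomorphic_on_imp_continuous_on)
  then have "(\<lambda>y. g_entire k s v (of_real y)) \<in> borel_measurable borel"
    by (rule borel_measurable_continuous_onI)
  then have "(\<lambda>y. f_fun k s v y - g_entire k s v (of_real y)) \<in> borel_measurable borel"
    using f_fun_measurable by (intro borel_measurable_diff)
  then have m: "(\<lambda>y. f_fun k s v y - g_entire k s v (of_real y)) \<in> borel_measurable lebesgue"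
    by (intro measurable_completion) simp
  obtain M where "\<And>y. norm (f_fun k s v y - g_fun k s v y) \<le> M" using f_minus_g_bounded[OF adm] by blast
  then show "in_L_infinity (\<lambda>y. f_fun k s v y - g_entire k s v (of_real y))"
    unfolding in_L_infinity_def using m unfolding g_entire_of_real[OF facts(1)] by auto
qed

text \<open>The difference of two interpolants is bounded on the real line and vanishes at the
  nodes, hence is a multiple of the shifted sine.\<close>

lemma interpolant_unique:
  assumes k: "k \<le> 1" and G: "is_interpolant k s v G" and H: "is_interpolant k s v H"
  shows "H = G"
proof -
  define D where "D = (\<lambda>z. H z + (- 1) * G z)"
  have hG: "G holomorphic_on UNIV" and hH: "H holomorphic_on UNIV"
    using G H by (auto simp: is_interpolant_def)
  have hD: "D holomorphic_on UNIV" unfolding D_def by (intro holomorphic_intros hG hH)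
  have "has_exponential_type D 1"
    unfolding D_def using G H by (intro has_exponential_type_add has_exponential_type_cmult) (auto simp: is_interpolant_def)
  then have growth: "\<exists>C. \<forall>z. norm (D z) \<le> C * exp ((1 + \<epsilon>) * norm z)" if "\<epsilon> > 0" for \<epsilon>
    using that unfolding has_exponential_type_def by blast
  obtain A where A: "AE y in lebesgue. norm (f_fun k s v y - G (of_real y)) \<le> A"
    using G by (auto simp: is_interpolant_def in_L_infinity_def)
  obtain B where B: "AE y in lebesgue. norm (f_fun k s v y - H (of_real y)) \<le> B"
    using H by (auto simp: is_interpolant_def in_L_infinity_def)
  have real: "norm (D (of_real x)) \<le> A + B" for x
  proof (rule ccontr)
    define S where "S = {y. norm (D (of_real y)) > A + B}"
    assume "\<not> norm (D (of_real x)) \<le> A + B"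
    then have "x \<in> S" by (simp add: S_def)
    then have ne: "S \<noteq> {}" by blast
    have "continuous_on UNIV (\<lambda>y. D (of_real y))"
      using hD by (intro continuous_on_compose2[of UNIV D UNIV of_real] continuous_intros)
       (auto intro: holomorphic_on_imp_continuous_on)
    then have op: "open S" unfolding S_def by (intro open_Collect_less continuous_intros)
    \<comment> \<open>An essential bound of a continuous function holds everywhere: the set where it
      fails is open and null, hence empty.\<close>
    have "AE y in lebesgue. y \<notin> S"
      using A B
    proof eventually_elim
      case (elim y)
      have "D (of_real y) = (f_fun k s v y - G (of_real y)) - (f_fun k s v y - H (of_real y))" by (simp add: D_def)
      then have "norm (D (of_real y)) \<le> norm (f_fun k s v y - G (of_real y)) + norm (f_fun k s v y - H (of_real y))"
        by (metis norm_triangle_ineq4)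
      then show ?case using elim by (simp add: S_def)
    qed
    moreover have "S \<in> sets lebesgue" using op by (simp add: borel_open lmeasurable_iff_integrable)
    ultimately have "negligible S" by (simp add: negligible_iff_null_sets AE_iff_null_sets)
    then show False using open_not_negligible[OF op ne] by simp
  qed
  have bound: "norm (D z) \<le> (A + B) * exp \<bar>Im z\<bar>" for z
    by (rule exponential_type_bound[OF hD growth real])
  let ?b = "complex_of_real (pi * of_nat k / 2)"
  have "\<exists>c. \<forall>z. D (z - ?b) = c * sin z"
  proof (rule sine_type_multiple)
    show "(\<lambda>z. D (z - ?b)) holomorphic_on UNIV"
      by (intro holomorphic_compose_UNIV[OF hD] holomorphic_intros)
    show "norm (D (z - ?b)) \<le> (A + B) * exp \<bar>Im z\<bar>" for z
      using bound[of "z - ?b"] by simp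
    fix n :: int
    have "complex_of_real (pi * of_int n) - ?b = of_real (node k (n - int k))"
      by (simp add: node_def algebra_simps)
    then show "D (of_real (pi * of_int n) - ?b) = 0"
      using G H by (simp add: D_def is_interpolant_def)
  qed
  then obtain c where c: "\<And>z. D (z - ?b) = c * sin z" by blast
  have D: "D z = c * sin (z + ?b)" for z using c[of "z + ?b"] by simp
  \<comment> \<open>The shifted sine itself vanishes at the nodes and is bounded on the real line;
    only the condition at 0 excludes it, as there its derivative (\<open>k = 0\<close>) or its value
    (\<open>k = 1\<close>) is 1.\<close>
  have "c = 0"
  proof (cases "k = 0")
    case False
    then have "k = 1" using k by simp
    then have "D 0 = 0" using G H by (simp add: D_def is_interpolant_def)
    then show ?thesis using D[of 0] \<open>k = 1\<close> sin_of_real[of "pi / 2", where ?'a = complex] by simp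
  next
    case True
    have "deriv G 0 = 0" "deriv H 0 = 0" using G H True by (auto simp: is_interpolant_def)
    then have g: "(G has_field_derivative 0) (at 0)" and h: "(H has_field_derivative 0) (at 0)"
      using holomorphic_derivI[OF hG, of 0] holomorphic_derivI[OF hH, of 0] by auto
    have "(D has_field_derivative 0 + (- 1) * 0) (at 0)"
      unfolding D_def by (intro DERIV_add DERIV_cmult g h)
    moreover have "D = (\<lambda>z. c * sin z)" using D True by auto
    then have "(D has_field_derivative c * cos 0) (at 0)"
      by (auto intro!: derivative_eq_intros)
    ultimately have "c * cos 0 = 0 + (- 1) * 0" by (rule DERIV_unique[rotated])
    then show ?thesis by simp
  qed
  then show ?thesis using D by (auto simp: D_def fun_eq_iff)
qed

theorem theorem2p1:
  fixes k :: nat and s :: complex and v :: real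
  assumes "k \<in> {0, 1}" and "v \<in> {0<..1}" and "admissible k s v"
  shows
    "(\<forall>y. summable (\<lambda>i. g_term k s v y (i + (1 - k))))
   \<and> (\<exists>G. (\<forall>y::real. G (of_real y) = g_fun k s v y)
          \<and> is_interpolant k s v G
          \<and> (\<forall>H. is_interpolant k s v H \<longrightarrow> H = G))
   \<and> (\<forall>n::int.
          f_fun k s v (node k n) = g_fun k s v (node k n)
        \<and> g_fun k s v (node k n) =
            - (of_real pi * 2 powr (s - 1) * ((-1) powi (n + int k))
                 * of_real (pi * \<bar>of_int n + of_nat k / 2\<bar>) powr s / sin (of_real pi * s)
               * sin (of_real (pi * (2 * of_int n + of_nat k) * v)
                      + of_real pi * s / 2 * of_real (sgn (of_int n + of_nat k / 2)))))
   \<and> (\<exists>L. ((\<lambda>y. (f_fun k s v y - g_fun k s v y) / of_real (sin (y + pi * of_nat k / 2))) \<longlongrightarrow> L)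
            (inf at_infinity (principal {y::real. sin (y + pi * of_nat k / 2) \<noteq> 0}))
        \<and> lerch_phi ((-1) ^ k) s v = 1 / Gamma s * L)"
proof (intro conjI allI)
  note adm = assms(3)
  note facts = admissible_facts[OF adm]
  show "summable (\<lambda>i. g_term k s v y (i + (1 - k)))" for y
    unfolding g_term_eq[OF facts(1)] by (rule g_series_facts(1)[OF adm])
  show "\<exists>G. (\<forall>y::real. G (of_real y) = g_fun k s v y) \<and> is_interpolant k s v G \<and> (\<forall>H. is_interpolant k s v H \<longrightarrow> H = G)"
    using g_entire_of_real[OF facts(1)] g_entire_is_interpolant[OF adm] interpolant_unique[OF facts(1) g_entire_is_interpolant[OF adm]]
    by blast
  show "f_fun k s v (node k n) = g_fun k s v (node k n)" for n
    unfolding f_fun_node[OF adm] g_fun_node[OF adm] ..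
  show "g_fun k s v (node k n) =
            - (of_real pi * 2 powr (s - 1) * ((-1) powi (n + int k))
                 * of_real (pi * \<bar>of_int n + of_nat k / 2\<bar>) powr s / sin (of_real pi * s)
               * sin (of_real (pi * (2 * of_int n + of_nat k) * v)
                      + of_real pi * s / 2 * of_real (sgn (of_int n + of_nat k / 2))))" for n
    unfolding g_fun_node[OF adm] node_value_def ..
  let ?F = "inf at_infinity (principal {y::real. sin (y + pi * of_nat k / 2) \<noteq> 0})"
  define L where "L = mint (mhker k v s)"
  have "(kernel_integral k s v \<longlongrightarrow> L) ?F"
    unfolding L_def by (rule tendsto_mono[OF inf_le1 kernel_integral_tendsto[OF facts(1-3,9)]])
  \<comment> \<open>The filter already avoids the zeros of the sine; the remaining exception
    \<open>y = 0\<close> of the identity disappears near infinity.\<close>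
  moreover have "\<forall>\<^sub>F y in ?F. kernel_integral k s v y = (f_fun k s v y - g_fun k s v y) / of_real (sin (y + pi * of_nat k / 2))"
    unfolding eventually_inf_principal
    using eventually_not_equal_at_infinity[of "0::real"]
    by eventually_elim (auto simp: interpolation_identity[OF adm])
  ultimately have lim: "((\<lambda>y. (f_fun k s v y - g_fun k s v y) / of_real (sin (y + pi * of_nat k / 2))) \<longlongrightarrow> L) ?F"
    by (rule Lim_transform_eventually)
  have "real k \<le> 1" using facts(1) by simp
  then have Re: "Re s > 0" using facts(9) by linarith
  then have "s \<notin> \<int>\<^sub>\<le>\<^sub>0" by (auto elim!: nonpos_Ints_cases)
  then have "Gamma s \<noteq> 0" by (simp add: Gamma_eq_zero_iff)
  then have "lerch_phi ((-1) ^ k) s v = 1 / Gamma s * L"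
    using Gamma_lerch_phi[OF Re, of k v] unfolding L_def by (simp add: field_simps)
  with lim show "\<exists>L. ((\<lambda>y. (f_fun k s v y - g_fun k s v y) / of_real (sin (y + pi * of_nat k / 2))) \<longlongrightarrow> L) ?F
        \<and> lerch_phi ((-1) ^ k) s v = 1 / Gamma s * L"
    by blast
qed

end
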